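(* Let $\{v_j\}_{j\in\mathbb Z}\in \ell^p(\mathbb Z)$ be a real sequence for some $1\le p\le\infty$. Let $\{a_j\}_{j\in\mathbb Z}$ be any increasing sequence of positive numbers, and let $T^*f(x)=\sup_N|T_Nf(x)|$, where the supremum is taken over all $N=(N_1,N_2)\in\mathbb Z^2$ with $N_1<N_2$ and $$T_Nf(x)=\sum_{j=N_1}^{N_2}v_j\left(e^{-a_{j+1}(-\Delta)^\alpha}f(x)-e^{-a_j(-\Delta)^\alpha}f(x)\right),\quad x\in\mathbb R^n.$$ Then for every $f\in L^\infty(\mathbb R^n)$ with support in the unit ball $B=B(0,1)$, and for any ball $B_r\subset B$ with $2r<1$, we have $$\frac1{|B_r|}\int_{B_r}|T^*f(x)|\,dx\le C\left(\log\frac2r\right)^{1/p'}\|v\|_{\ell^p(\mathbb Z)}\|f\|_{L^\infty(\mathbb R^n)}.$$ Here $p'=\frac{p}{p-1}$, and if $p=1$, $p'=\infty$.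
   Context: For $\alpha\in(0,1)$ and $t>0$, the fractional heat semigroup $e^{-t(-\Delta)^\alpha}$ on $\mathbb R^n$ is the Fourier multiplier operator with symbol $e^{-t|\xi|^{2\alpha}}$, i.e. $\mathcal F(e^{-t(-\Delta)^\alpha}f)(\xi)=e^{-t|\xi|^{2\alpha}}\mathcal F(f)(\xi)$, where $\mathcal F$ is the Fourier transform. $B_r$ denotes a ball of radius $r$ and $|B_r|$ its Lebesgue measure. For $p=\infty$ one has $p'=1$, and for $p'=\infty$ the exponent $1/p'$ is $0$. The letter $C$ denotes a positive constant which may depend on the parameters involved; its dependence is not specified further. *)

theory Defs
  imports "HOL-Analysis.Analysis" "HOL-Probability.Essential_Supremum"
begin

text \<open>
  The sign and scaling of the Fourier transform are chosen so that the negative Laplacian has the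
  symbol \<open>norm \<xi> ^ 2\<close> and its power with exponent \<open>\<alpha>\<close> the symbol \<open>norm \<xi> powr (2 * \<alpha>)\<close>.
\<close>

definition fourier :: "(real ^ 'n \<Rightarrow> complex) \<Rightarrow> real ^ 'n \<Rightarrow> complex" where
  "fourier f \<xi> = (LINT x|lebesgue. cis (- (x \<bullet> \<xi>)) * f x)"

definition inverse_fourier :: "(real ^ 'n \<Rightarrow> complex) \<Rightarrow> real ^ 'n \<Rightarrow> complex" where
  "inverse_fourier g x = (LINT \<xi>|lebesgue. cis (x \<bullet> \<xi>) * g \<xi>) / (2 * pi) ^ CARD('n)"

text \<open>
  For an integrable \<open>f\<close> (in particular a bounded one with bounded support) and the symbol
  \<open>exp (- t * norm \<xi> powr (2 * \<alpha>))\<close> with \<open>t > 0\<close>, the inverse transform below is an absolutely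
  convergent integral at every point; it selects the continuous representative.
\<close>

definition fourier_multiplier ::
    "(real ^ 'n \<Rightarrow> complex) \<Rightarrow> (real ^ 'n \<Rightarrow> complex) \<Rightarrow> real ^ 'n \<Rightarrow> complex" where
  "fourier_multiplier m f = inverse_fourier (\<lambda>\<xi>. m \<xi> * fourier f \<xi>)"

definition frac_heat :: "real \<Rightarrow> real \<Rightarrow> (real ^ 'n \<Rightarrow> complex) \<Rightarrow> real ^ 'n \<Rightarrow> complex" where
  "frac_heat \<alpha> t = fourier_multiplier (\<lambda>\<xi>. of_real (exp (- t * norm \<xi> powr (2 * \<alpha>))))"

definition diff_transform ::
    "real \<Rightarrow> (int \<Rightarrow> real) \<Rightarrow> (int \<Rightarrow> real) \<Rightarrow> int \<times> int \<Rightarrow> (real ^ 'n \<Rightarrow> complex) \<Rightarrow> real ^ 'n \<Rightarrow> complex"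
  where
  "diff_transform \<alpha> v a N f x =
     (\<Sum>j = fst N..snd N. of_real (v j) * (frac_heat \<alpha> (a (j + 1)) f x - frac_heat \<alpha> (a j) f x))"

text \<open>The supremum is taken in \<open>[0, \<infinity>]\<close>, since its finiteness is not known beforehand.\<close>

definition max_diff_transform ::
    "real \<Rightarrow> (int \<Rightarrow> real) \<Rightarrow> (int \<Rightarrow> real) \<Rightarrow> (real ^ 'n \<Rightarrow> complex) \<Rightarrow> real ^ 'n \<Rightarrow> ennreal" where
  "max_diff_transform \<alpha> v a f x =
     (SUP N\<in>{N. fst N < snd N}. ennreal (norm (diff_transform \<alpha> v a N f x)))"

definition in_lp :: "ereal \<Rightarrow> (int \<Rightarrow> real) \<Rightarrow> bool" where
  "in_lp p v \<longleftrightarrow>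
     (if p = \<infinity> then bounded (range v)
      else (\<lambda>j. \<bar>v j\<bar> powr real_of_ereal p) summable_on UNIV)"

definition lp_norm :: "ereal \<Rightarrow> (int \<Rightarrow> real) \<Rightarrow> real" where
  "lp_norm p v =
     (if p = \<infinity> then (SUP j. \<bar>v j\<bar>)
      else (\<Sum>\<^sub>\<infinity>j. \<bar>v j\<bar> powr real_of_ereal p) powr (1 / real_of_ereal p))"

definition conj_exponent :: "ereal \<Rightarrow> ereal" where
  "conj_exponent p = (if p = 1 then \<infinity> else if p = \<infinity> then 1 else p / (p - 1))"

definition in_linfty :: "(real ^ 'n \<Rightarrow> complex) \<Rightarrow> bool" where
  "in_linfty f \<longleftrightarrow>
     f \<in> borel_measurable lebesgue \<and> esssup lebesgue (\<lambda>x. ereal (norm (f x))) < \<infinity>"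

definition linfty_norm :: "(real ^ 'n \<Rightarrow> complex) \<Rightarrow> real" where
  "linfty_norm f = real_of_ereal (esssup lebesgue (\<lambda>x. ereal (norm (f x))))"

end

theory Submission
  imports Defs "HOL-Probability.Probability" "HOL-Real_Asymp.Real_Asymp"
begin

text \<open>
  Cut every time at \<open>r powr (2 * \<alpha>)\<close>. For the later times, subordination to the Gaussian
  semigroup shows that the increments of the semigroup at a point are bounded and have
  total variation \<open>O(ln (2 / r))\<close>, so Hoelder's inequality produces the power of the logarithm.
  For the earlier times only \<open>sup \<bar>v j\<bar>\<close> matters: the part of \<open>f\<close> away from the
  ball is handled by the off-diagonal decay of the kernel, and the part close to the ball by an
  \<open>L\<^sup>2\<close> maximal estimate. In the latter, the tail \<open>\<Sum>j\<ge>m\<close> of the sum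
  differs from the heat semigroup at time \<open>a m powr (1 / \<alpha>)\<close> applied to the full sum by
  a quantity that Plancherel's theorem controls uniformly in \<open>m\<close>. Averages over a ball of the
  maximal function of the heat semigroup are bounded by a \<open>T T*\<close> argument, in which the
  characteristic function of the ball is estimated in \<open>L\<^sup>\<infinity>\<close> and no maximal theorem is needed.
\<close>

section \<open>Gaussian integrals and the heat kernel\<close>

text \<open>The times may have gaps of any size, so every increment is measured by the relative gap
  of its two times, which behaves like an increment of the logarithm. Integrating dt / t from the
  scale \<open>r powr (2 * \<alpha>)\<close> of the ball to the scale 1 of the support is what
  produces \<open>ln (2 / r)\<close>. Beyond time 1 the total variation is finite, and below the
  scale of the ball no logarithm may be lost: there \<open>L2\<close> theory suffices, because the
  near part of the function has squared \<open>L2\<close> norm comparable with the measure of the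
  ball. The fractional kernel has no elementary closed form in general, hence the use of Gaussians.
  With x = \<open>a m * l\<close> the factors \<open>exp (- x)\<close> and
  \<open>exp (- (x powr (1 / \<alpha>)))\<close> both differ from 1 by at most x and both decay for
  large x, but only the second one is a Gaussian in the frequency variable. Tails are compared
  rather than initial parts of the sum, because the symbol of a tail decays in x as well; so the
  difference is small at both ends.\<close>

lemma
  fixes f :: "'a::euclidean_space \<Rightarrow> real \<Rightarrow> 'b::{real_normed_field,banach,second_countable_topology}"
  assumes f: "\<And>b. b \<in> Basis \<Longrightarrow> integrable lborel (f b)"
  shows integrable_prod_Basis: "integrable lborel (\<lambda>x. \<Prod>b\<in>Basis. f b (x \<bullet> b))" (is ?A)
    and integral_prod_Basis:
      "(\<integral>x. (\<Prod>b\<in>Basis. f b (x \<bullet> b)) \<partial>lborel) = (\<Prod>b\<in>Basis. integral\<^sup>L lborel (f b))" (is ?B)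
proof -
  interpret product_sigma_finite "\<lambda>_::'a. lborel :: real measure" by standard
  let ?s = "\<lambda>g::'a \<Rightarrow> real. \<Sum>b\<in>Basis. g b *\<^sub>R b"
  have meas[measurable]: "?s \<in> measurable (\<Pi>\<^sub>M b\<in>Basis. lborel) borel"
    by measurable
  have [measurable]: "\<And>b. b \<in> Basis \<Longrightarrow> f b \<in> borel_measurable borel"
    using f by (simp add: integrable_iff_bounded)
  have eq: "(\<Prod>b\<in>Basis. f b (?s g \<bullet> b)) = (\<Prod>b\<in>Basis. f b (g b))" for g
    by (intro prod.cong) (simp_all add: inner_sum_left inner_Basis if_distrib cong: if_cong)
  have int: "integrable (\<Pi>\<^sub>M b\<in>Basis. lborel) (\<lambda>x. \<Prod>b\<in>Basis. f b (x b))"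
    by (rule product_integrable_prod) (simp_all add: f)
  show ?A
    by (subst lborel_eq, subst integrable_distr_eq) (use int in \<open>simp_all add: eq\<close>)
  have "(\<integral>x. (\<Prod>b\<in>Basis. f b (x \<bullet> b)) \<partial>lborel)
      = (\<integral>g. (\<Prod>b\<in>Basis. f b (g b)) \<partial>(\<Pi>\<^sub>M b\<in>Basis. lborel))"
    by (subst lborel_eq, subst integral_distr) (simp_all add: eq)
  also have "\<dots> = (\<Prod>b\<in>Basis. integral\<^sup>L lborel (f b))"
    by (rule product_integral_prod) (simp_all add: f)
  finally show ?B .
qed

lemma cis_measurable [measurable]: "cis \<in> borel_measurable borel"
  by (intro borel_measurable_continuous_onI continuous_intros)

text \<open>Dilation by \<open>sqrt (2 * u)\<close> turns the standard normal density into a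
  multiple of the Gaussian, so the value can be read off from the characteristic function of the
  normal distribution.\<close>

lemma
  fixes u t :: real
  assumes u: "0 < u"
  shows integrable_cis_gaussian_real: "integrable lborel (\<lambda>x. cis (x * t) * exp (- u * x\<^sup>2))" (is ?A)
    and integral_cis_gaussian_real:
      "(\<integral>x. cis (x * t) * exp (- u * x\<^sup>2) \<partial>lborel) = sqrt (pi / u) * exp (- t\<^sup>2 / (4 * u))" (is ?B)
proof -
  let ?c = "sqrt (2 * u)"
  have c: "0 < ?c" "?c \<noteq> 0" using u by auto
  have 1: "std_normal_density (0 + ?c * x) = exp (- u * x\<^sup>2) / sqrt (2 * pi)" for x
    using u by (simp add: std_normal_density_def power_mult_distrib)
  have "integrable lborel std_normal_density" by simp
  from lborel_integrable_real_affine[OF this c(2), of 0]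
  have "integrable lborel (\<lambda>x. exp (- u * x\<^sup>2) / sqrt (2 * pi))" by (simp only: 1)
  then have int: "integrable lborel (\<lambda>x. exp (- u * x\<^sup>2))"
    using integrable_mult_right[of "sqrt (2*pi)" lborel "\<lambda>x. exp (- u * x\<^sup>2) / sqrt (2 * pi)"] by simp
  show ?A
    by (rule Bochner_Integration.integrable_bound[OF int]) (auto simp: norm_mult)
  have "complex_of_real (exp (- ((t / ?c)\<^sup>2) / 2)) = char std_normal_distribution (t / ?c)"
    by (simp add: char_std_normal_distribution)
  also have "\<dots> = (\<integral>x. std_normal_density x *\<^sub>R iexp (t / ?c * x) \<partial>lborel)"
    unfolding char_def by (subst integral_density) (auto simp: normal_density_nonneg)
  also have "\<dots> = ?c *\<^sub>R (\<integral>x. std_normal_density (0 + ?c * x) *\<^sub>R iexp (t / ?c * (0 + ?c * x)) \<partial>lborel)"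
    using lborel_integral_real_affine[OF c(2), of "\<lambda>x. std_normal_density x *\<^sub>R iexp (t / ?c * x)" 0] c(1)
    by (simp only: abs_of_pos)
  also have "(\<lambda>x. std_normal_density (0 + ?c * x) *\<^sub>R iexp (t / ?c * (0 + ?c * x)))
      = (\<lambda>x. (1 / sqrt (2 * pi)) *\<^sub>R (cis (x * t) * exp (- u * x\<^sup>2)))"
    using c by (subst 1) (auto simp: fun_eq_iff cis_conv_exp scaleR_conv_of_real field_simps)
  also have "?c *\<^sub>R (\<integral>x. (1 / sqrt (2 * pi)) *\<^sub>R (cis (x * t) * exp (- u * x\<^sup>2)) \<partial>lborel)
      = (sqrt (u / pi)) *\<^sub>R (\<integral>x. cis (x * t) * exp (- u * x\<^sup>2) \<partial>lborel)"
    using u by (simp add: real_sqrt_mult real_sqrt_divide)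
  finally have e: "complex_of_real (exp (- ((t / ?c)\<^sup>2) / 2)) =
     (sqrt (u / pi)) *\<^sub>R (\<integral>x. cis (x * t) * exp (- u * x\<^sup>2) \<partial>lborel)" .
  have "- ((t / ?c)\<^sup>2) / 2 = - t\<^sup>2 / (4 * u)"
    using u by (simp add: power_divide)
  then have "(\<integral>x. cis (x * t) * exp (- u * x\<^sup>2) \<partial>lborel) = inverse (sqrt (u / pi)) *\<^sub>R complex_of_real (exp (- t\<^sup>2 / (4 * u)))"
    using e u by simp
  also have "\<dots> = sqrt (pi / u) * exp (- t\<^sup>2 / (4 * u))"
    by (simp add: real_sqrt_divide scaleR_conv_of_real)
  finally show ?B by simp
qed

lemma
  fixes u :: real
  assumes u: "0 < u"
  shows integrable_square_gaussian_real: "integrable lborel (\<lambda>x. x\<^sup>2 * exp (- u * x\<^sup>2))" (is ?A)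
    and integral_square_gaussian_real:
      "(\<integral>x. x\<^sup>2 * exp (- u * x\<^sup>2) \<partial>lborel) = sqrt (pi / u) / (2 * u)" (is ?B)
proof -
  let ?c = "sqrt (2 * u)"
  have c: "0 < ?c" "?c \<noteq> 0" using u by auto
  have m: "has_bochner_integral lborel (\<lambda>x. std_normal_density x * x\<^sup>2) 1"
    using std_normal_moment_even[of 1] by simp
  have 1: "std_normal_density (0 + ?c * x) * (0 + ?c * x)\<^sup>2 = (2 * u / sqrt (2 * pi)) * (x\<^sup>2 * exp (- u * x\<^sup>2))" for x
    using u by (simp add: std_normal_density_def power_mult_distrib)
  have i: "has_bochner_integral lborel (\<lambda>x. (2 * u / sqrt (2 * pi)) * (x\<^sup>2 * exp (- u * x\<^sup>2))) (1 / ?c)"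
    using lborel_has_bochner_integral_real_affine_iff[OF c(2), of "\<lambda>x. std_normal_density x * x\<^sup>2" 1 0] m c
    by (simp only: 1) (simp add: divide_inverse)
  have "has_bochner_integral lborel (\<lambda>x. (sqrt (2 * pi) / (2 * u)) * ((2 * u / sqrt (2 * pi)) * (x\<^sup>2 * exp (- u * x\<^sup>2)))) ((sqrt (2 * pi) / (2 * u)) * (1 / ?c))"
    by (intro has_bochner_integral_mult_right i)
  moreover have "(sqrt (2 * pi) / (2 * u)) * (1 / ?c) = sqrt (pi / u) / (2 * u)"
    using u by (simp add: real_sqrt_mult real_sqrt_divide)
  ultimately have "has_bochner_integral lborel (\<lambda>x. x\<^sup>2 * exp (- u * x\<^sup>2)) (sqrt (pi / u) / (2 * u))"
    using u by simp
  then show ?A ?B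
    by (auto simp: has_bochner_integral_iff)
qed

text \<open>The heat kernel at time u, with Fourier transform
  \<open>exp (- u * (norm \<xi>)^2)\<close> in the present normalisation. Its dimensional factor is
  a natural power of a square root, which splits over the basis like the exponential.\<close>

definition gauss_kernel :: "real \<Rightarrow> 'a::euclidean_space \<Rightarrow> real" where
  "gauss_kernel u z = (1 / sqrt (4 * pi * u)) ^ DIM('a) * exp (- (norm z)\<^sup>2 / (4 * u))"

lemma gauss_kernel_nonneg [simp]: "0 \<le> u \<Longrightarrow> 0 \<le> gauss_kernel u z"
  by (simp add: gauss_kernel_def)

lemma gauss_kernel_measurable [measurable (raw)]:
  fixes g :: "'b \<Rightarrow> 'a::euclidean_space"
  assumes [measurable]: "f \<in> borel_measurable M" "g \<in> borel_measurable M"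
  shows "(\<lambda>x. gauss_kernel (f x) (g x)) \<in> borel_measurable M"
  unfolding gauss_kernel_def by measurable

lemma norm_power2_Basis: "(norm (x::'a::euclidean_space))\<^sup>2 = (\<Sum>b\<in>Basis. (x \<bullet> b)\<^sup>2)"
  by (subst power2_norm_eq_inner, subst euclidean_inner) (simp add: power2_eq_square)

lemma exp_norm_power2_prod:
  "exp (- u * (norm (x::'a::euclidean_space))\<^sup>2) = (\<Prod>b\<in>Basis. exp (- u * (x \<bullet> b)\<^sup>2))"
  by (simp add: norm_power2_Basis sum_distrib_left sum_negf flip: exp_sum)

lemma cis_sum: "finite A \<Longrightarrow> cis (sum f A) = (\<Prod>x\<in>A. cis (f x))"
  by (induction A rule: finite_induct) (simp_all flip: cis_mult)

lemma
  fixes z :: "'a::euclidean_space"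
  assumes u: "0 < u"
  shows integrable_cis_gaussian: "integrable lborel (\<lambda>x::'a. cis (x \<bullet> z) * exp (- u * (norm x)\<^sup>2))" (is ?A)
    and integral_cis_gaussian: "(\<integral>x. cis (x \<bullet> z) * exp (- u * (norm x)\<^sup>2) \<partial>lborel) =
      (2 * pi) ^ DIM('a) * gauss_kernel u z" (is ?B)
proof -
  let ?f = "\<lambda>b x. cis (x * (z \<bullet> b)) * exp (- u * x\<^sup>2)"
  have eq: "cis (x \<bullet> z) * exp (- u * (norm x)\<^sup>2) = (\<Prod>b\<in>Basis. ?f b (x \<bullet> b))" for x :: 'a
  proof -
    have "cis (x \<bullet> z) = (\<Prod>b\<in>Basis. cis ((x \<bullet> b) * (z \<bullet> b)))"
      by (subst euclidean_inner) (simp add: cis_sum)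
    moreover have "complex_of_real (exp (- u * (norm x)\<^sup>2)) = (\<Prod>b\<in>Basis. complex_of_real (exp (- u * (x \<bullet> b)\<^sup>2)))"
      by (subst exp_norm_power2_prod) (simp only: of_real_prod)
    ultimately show ?thesis by (simp only: prod.distrib)
  qed
  show ?A
    unfolding eq by (rule integrable_prod_Basis) (rule integrable_cis_gaussian_real[OF u])
  have "(\<integral>x. cis (x \<bullet> z) * exp (- u * (norm x)\<^sup>2) \<partial>lborel) = (\<Prod>b\<in>Basis. integral\<^sup>L lborel (?f b))"
    unfolding eq by (rule integral_prod_Basis) (rule integrable_cis_gaussian_real[OF u])
  also have "\<dots> = (\<Prod>b\<in>Basis. complex_of_real (sqrt (pi / u) * exp (- (z \<bullet> b)\<^sup>2 / (4 * u))))"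
    by (simp only: integral_cis_gaussian_real[OF u] of_real_mult)
  also have "\<dots> = complex_of_real (sqrt (pi / u) ^ DIM('a) * (\<Prod>b\<in>Basis. exp (- (z \<bullet> b)\<^sup>2 / (4 * u))))"
    by (simp add: prod.distrib)
  also have "(\<Prod>b\<in>Basis. exp (- (z \<bullet> b)\<^sup>2 / (4 * u))) = exp (- (norm z)\<^sup>2 / (4 * u))"
    using exp_norm_power2_prod[of "1 / (4 * u)" z] by simp
  also have "sqrt (pi / u) = 2 * pi * (1 / sqrt (4 * pi * u))"
    using u by (simp add: real_sqrt_mult real_sqrt_divide field_simps)
  finally show ?B
    by (simp add: gauss_kernel_def power_mult_distrib power_divide)
qed

lemma
  fixes u :: real
  assumes u: "0 < u"
  shows integrable_exp_norm_power2: "integrable lborel (\<lambda>x::'a::euclidean_space. exp (- u * (norm x)\<^sup>2))" (is ?A)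
    and integral_exp_norm_power2: "(\<integral>(x::'a). exp (- u * (norm x)\<^sup>2) \<partial>lborel) = sqrt (pi / u) ^ DIM('a)" (is ?B)
proof -
  have i: "integrable lborel (\<lambda>x::real. exp (- u * x\<^sup>2))" "(\<integral>(x::real). exp (- u * x\<^sup>2) \<partial>lborel) = sqrt (pi / u)"
  proof -
    show "integrable lborel (\<lambda>x::real. exp (- u * x\<^sup>2))"
      using integrable_cis_gaussian_real[OF u, of 0] complex_of_real_integrable_eq[of lborel "\<lambda>x. exp (- u * x\<^sup>2)"]
      by simp
    have "complex_of_real (\<integral>(x::real). exp (- u * x\<^sup>2) \<partial>lborel) = complex_of_real (sqrt (pi / u))"
      using integral_cis_gaussian_real[OF u, of 0] integral_complex_of_real[of lborel "\<lambda>x. exp (- u * x\<^sup>2)"]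
      by simp
    then show "(\<integral>(x::real). exp (- u * x\<^sup>2) \<partial>lborel) = sqrt (pi / u)"
      by (simp only: of_real_eq_iff)
  qed
  show ?A unfolding exp_norm_power2_prod by (rule integrable_prod_Basis) (rule i)
  show ?B unfolding exp_norm_power2_prod by (subst integral_prod_Basis) (simp_all only: i prod_constant)
qed

lemma
  fixes u :: real
  assumes u: "0 < u"
  shows integrable_norm_power2_exp: "integrable lborel (\<lambda>x::'a::euclidean_space. (norm x)\<^sup>2 * exp (- u * (norm x)\<^sup>2))" (is ?A)
    and integral_norm_power2_exp: "(\<integral>(x::'a). (norm x)\<^sup>2 * exp (- u * (norm x)\<^sup>2) \<partial>lborel)
      = DIM('a) / (2 * u) * sqrt (pi / u) ^ DIM('a)" (is ?B)
proof -
  \<comment> \<open>The squared norm is a sum over the coordinates c, and the summand of c is again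
    a product over the basis, with the factor at c replaced by the integrand of a second
    moment.\<close>
  define f where "f c b x = (if b = c then x\<^sup>2 * exp (- u * x\<^sup>2) else exp (- u * x\<^sup>2))" for c b :: 'a and x
  have i: "integrable lborel (\<lambda>x::real. exp (- u * x\<^sup>2))" "(\<integral>(x::real). exp (- u * x\<^sup>2) \<partial>lborel) = sqrt (pi / u)"
    using integrable_exp_norm_power2[OF u, where 'a=real] integral_exp_norm_power2[OF u, where 'a=real] by simp_all
  have f: "integrable lborel (f c b)" for c b
    unfolding f_def using i(1) integrable_square_gaussian_real[OF u] by (cases "b = c") simp_all
  have fi: "integral\<^sup>L lborel (f c b) = (if b = c then 1 / (2 * u) else 1) * sqrt (pi / u)" for c b
    unfolding f_def using i(2) integral_square_gaussian_real[OF u] by (cases "b = c") (simp_all add: field_simps)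
  have eq: "(norm x)\<^sup>2 * exp (- u * (norm x)\<^sup>2) = (\<Sum>c\<in>Basis. \<Prod>b\<in>Basis. f c b (x \<bullet> b))" for x :: 'a
  proof -
    have "(\<Prod>b\<in>Basis. f c b (x \<bullet> b)) = (x \<bullet> c)\<^sup>2 * (\<Prod>b\<in>Basis. exp (- u * (x \<bullet> b)\<^sup>2))" if "c \<in> Basis" for c
    proof -
      have "(\<Prod>b\<in>Basis. f c b (x \<bullet> b)) = (\<Prod>b\<in>Basis. (if b = c then (x \<bullet> b)\<^sup>2 else 1) * exp (- u * (x \<bullet> b)\<^sup>2))"
        by (intro prod.cong) (auto simp: f_def)
      then show ?thesis using that by (simp add: prod.distrib)
    qed
    then show ?thesis
      by (subst exp_norm_power2_prod) (simp add: norm_power2_Basis sum_distrib_right)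
  qed
  show ?A unfolding eq by (intro Bochner_Integration.integrable_sum integrable_prod_Basis f)
  have "(\<integral>(x::'a). (norm x)\<^sup>2 * exp (- u * (norm x)\<^sup>2) \<partial>lborel) = (\<Sum>c\<in>(Basis::'a set). \<Prod>b\<in>Basis. integral\<^sup>L lborel (f c b))"
    unfolding eq by (subst Bochner_Integration.integral_sum) (simp_all add: integrable_prod_Basis integral_prod_Basis f)
  also have "\<dots> = (\<Sum>c\<in>(Basis::'a set). 1 / (2 * u) * sqrt (pi / u) ^ DIM('a))"
    by (intro sum.cong refl) (simp add: fi prod.distrib)
  finally show ?B by simp
qed

text \<open>Mass 1 serves the bounds in the supremum norm. The second moment, linear in u, is the
  source of the decay away from the diagonal, by an argument in the manner of Chebyshev.\<close>

lemma
  fixes u :: real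
  assumes u: "0 < u"
  shows integrable_gauss_kernel: "integrable lborel (gauss_kernel u :: 'a::euclidean_space \<Rightarrow> real)" (is ?A)
    and integral_gauss_kernel: "(\<integral>(z::'a). gauss_kernel u z \<partial>lborel) = 1" (is ?B)
    and integrable_norm_power2_gauss_kernel: "integrable lborel (\<lambda>z::'a. (norm z)\<^sup>2 * gauss_kernel u z)" (is ?C)
    and integral_norm_power2_gauss_kernel: "(\<integral>(z::'a). (norm z)\<^sup>2 * gauss_kernel u z \<partial>lborel) = 2 * DIM('a) * u" (is ?D)
proof -
  have v: "0 < 1 / (4 * u)" using u by simp
  have g: "gauss_kernel u = (\<lambda>z::'a. (1 / sqrt (4 * pi * u)) ^ DIM('a) * exp (- (1 / (4 * u)) * (norm z)\<^sup>2))"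
    by (simp add: gauss_kernel_def fun_eq_iff)
  have g': "(norm z)\<^sup>2 * gauss_kernel u z = (1 / sqrt (4 * pi * u)) ^ DIM('a) * ((norm z)\<^sup>2 * exp (- (1 / (4 * u)) * (norm z)\<^sup>2))" for z :: 'a
    by (simp add: gauss_kernel_def)
  have c: "(1 / sqrt (4 * pi * u)) ^ DIM('a) * sqrt (pi / (1 / (4 * u))) ^ DIM('a) = 1"
    using u by (simp add: ac_simps flip: power_mult_distrib)
  show ?A unfolding g by (intro integrable_mult_right integrable_exp_norm_power2 v)
  show ?B unfolding g using c by (simp only: integral_mult_right_zero integral_exp_norm_power2[OF v])
  show ?C unfolding g' by (intro integrable_mult_right integrable_norm_power2_exp v)
  have "(\<integral>(z::'a). (norm z)\<^sup>2 * gauss_kernel u z \<partial>lborel) =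
    DIM('a) / (2 * (1 / (4 * u))) * ((1 / sqrt (4 * pi * u)) ^ DIM('a) * sqrt (pi / (1 / (4 * u))) ^ DIM('a))"
    unfolding g' integral_mult_right_zero integral_norm_power2_exp[OF v] by (simp only: ac_simps)
  then show ?D unfolding c by simp
qed

section \<open>Quadratic forms of the Fourier transform\<close>

text \<open>The counterpart of \<open>fourier\<close> for \<open>lborel\<close>, on which Fubini's
  theorem is applied to product measures; \<open>fourier_eq_ft\<close> connects the two.\<close>

definition ft :: "('a::euclidean_space \<Rightarrow> complex) \<Rightarrow> 'a \<Rightarrow> complex" where
  "ft f \<xi> = (\<integral>x. cis (- (x \<bullet> \<xi>)) * f x \<partial>lborel)"

lemma ft_measurable [measurable]:
  assumes [measurable]: "f \<in> borel_measurable borel"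
  shows "ft f \<in> borel_measurable borel"
  unfolding ft_def by measurable

lemma cnj_measurable [measurable]: "cnj \<in> borel_measurable borel"
  by (intro borel_measurable_continuous_onI continuous_intros)

lemma norm_ft_le:
  assumes "integrable lborel f"
  shows "norm (ft f \<xi>) \<le> (\<integral>x. norm (f x) \<partial>lborel)"
proof -
  have "norm (ft f \<xi>) \<le> (\<integral>x. norm (cis (- (x \<bullet> \<xi>)) * f x) \<partial>lborel)"
    unfolding ft_def by (rule integral_norm_bound)
  then show ?thesis by (simp add: norm_mult)
qed

lemma integrable_cis_mult:
  fixes g :: "'a::euclidean_space \<Rightarrow> complex"
  assumes g: "integrable lborel g" and [measurable]: "h \<in> borel_measurable borel"
  shows "integrable lborel (\<lambda>x. cis (h x) * g x)"
  by (rule Bochner_Integration.integrable_bound[OF g]) (use g in \<open>auto simp: norm_mult\<close>)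

text \<open>The multiplication formula, by Fubini's theorem. Applied to a modulated Gaussian, whose
  transform is known, it takes the place of Fourier inversion.\<close>

lemma integral_mult_ft:
  fixes g \<psi> :: "'a::euclidean_space \<Rightarrow> complex"
  assumes g: "integrable lborel g" and \<psi>: "integrable lborel \<psi>"
  shows "(\<integral>\<xi>. g \<xi> * ft \<psi> \<xi> \<partial>lborel) = (\<integral>y. \<psi> y * ft g y \<partial>lborel)"
proof -
  have [measurable]: "g \<in> borel_measurable borel" "\<psi> \<in> borel_measurable borel"
    using g \<psi> by auto
  let ?F = "\<lambda>\<xi> y. g \<xi> * (cis (- (y \<bullet> \<xi>)) * \<psi> y)"
  have int: "integrable (lborel \<Otimes>\<^sub>M lborel) (case_prod ?F)"
  proof (rule lborel_pair.Fubini_integrable)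
    show "integrable lborel (\<lambda>\<xi>. \<integral>y. norm (case_prod ?F (\<xi>, y)) \<partial>lborel)"
      using g by (auto simp: norm_mult intro!: integrable_mult_left integrable_norm)
    show "AE \<xi> in lborel. integrable lborel (\<lambda>y. case_prod ?F (\<xi>, y))"
      using \<psi> by (auto intro!: integrable_mult_right integrable_cis_mult)
  qed measurable
  have "(\<integral>\<xi>. g \<xi> * ft \<psi> \<xi> \<partial>lborel) = (\<integral>\<xi>. (\<integral>y. ?F \<xi> y \<partial>lborel) \<partial>lborel)"
    unfolding ft_def by simp
  also have "\<dots> = (\<integral>y. (\<integral>\<xi>. ?F \<xi> y \<partial>lborel) \<partial>lborel)"
    using lborel_pair.Fubini_integral[OF int] by simp
  also have "\<dots> = (\<integral>y. \<psi> y * ft g y \<partial>lborel)"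
  proof (rule Bochner_Integration.integral_cong[OF refl])
    fix y
    have "(\<integral>\<xi>. ?F \<xi> y \<partial>lborel) = (\<integral>\<xi>. \<psi> y * (cis (- (\<xi> \<bullet> y)) * g \<xi>) \<partial>lborel)"
      by (simp add: ac_simps inner_commute)
    then show "(\<integral>\<xi>. ?F \<xi> y \<partial>lborel) = \<psi> y * ft g y" by (simp add: ft_def)
  qed
  finally show ?thesis .
qed

lemma integrable_exp_mult_bounded:
  fixes F :: "'a::euclidean_space \<Rightarrow> complex"
  assumes u: "0 < u" and [measurable]: "F \<in> borel_measurable borel" and F: "\<And>\<xi>. norm (F \<xi>) \<le> K"
  shows "integrable lborel (\<lambda>\<xi>. complex_of_real (exp (- u * (norm \<xi>)\<^sup>2)) * F \<xi>)"
proof (rule Bochner_Integration.integrable_bound)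
  show "integrable lborel (\<lambda>\<xi>::'a. K * exp (- u * (norm \<xi>)\<^sup>2))"
    by (intro integrable_mult_right integrable_exp_norm_power2 u)
  have "0 \<le> K" using F[of 0] norm_ge_zero order_trans by blast
  then show "AE \<xi> in lborel. norm (complex_of_real (exp (- u * (norm \<xi>)\<^sup>2)) * F \<xi>) \<le> norm (K * exp (- u * (norm \<xi>)\<^sup>2))"
    using F by (intro AE_I2) (simp add: norm_mult mult.commute mult_right_mono)
qed measurable

text \<open>A polarised Plancherel identity with a Gaussian regularisation, which makes all
  integrals absolutely convergent. Using the multiplication formula twice moves both transforms onto
  the Gaussian, where they become the heat kernel.\<close>

lemma
  fixes \<phi> \<psi> :: "'a::euclidean_space \<Rightarrow> complex"
  assumes u: "0 < u" and \<phi>: "integrable lborel \<phi>" and \<psi>: "integrable lborel \<psi>"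
  shows integrable_exp_ft_cnj_ft: "integrable lborel (\<lambda>\<xi>. exp (- u * (norm \<xi>)\<^sup>2) * (ft \<phi> \<xi> * cnj (ft \<psi> \<xi>)))" (is ?A)
    and integral_exp_ft_cnj_ft: "(\<integral>\<xi>. exp (- u * (norm \<xi>)\<^sup>2) * (ft \<phi> \<xi> * cnj (ft \<psi> \<xi>)) \<partial>lborel) =
      (2 * pi) ^ DIM('a) * (\<integral>x. (\<integral>y. \<phi> x * cnj (\<psi> y) * gauss_kernel u (x - y) \<partial>lborel) \<partial>lborel)" (is ?B)
proof -
  have [measurable]: "\<phi> \<in> borel_measurable borel" "\<psi> \<in> borel_measurable borel"
    using \<phi> \<psi> by auto
  let ?e = "\<lambda>\<xi>::'a. complex_of_real (exp (- u * (norm \<xi>)\<^sup>2))"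
  have e: "integrable lborel (\<lambda>\<xi>. ?e \<xi> * cis (\<xi> \<bullet> x))" for x :: 'a
    using integrable_cis_gaussian[OF u, of x] by (simp add: mult.commute)
  show ?A
  proof (rule integrable_exp_mult_bounded[OF u])
    show "norm (ft \<phi> \<xi> * cnj (ft \<psi> \<xi>)) \<le> (\<integral>x. norm (\<phi> x) \<partial>lborel) * (\<integral>x. norm (\<psi> x) \<partial>lborel)" for \<xi>
      unfolding norm_mult complex_mod_cnj by (intro mult_mono norm_ft_le \<phi> \<psi>) auto
  qed measurable
  have g: "integrable lborel (\<lambda>\<xi>. ?e \<xi> * cnj (ft \<psi> \<xi>))"
    by (rule integrable_exp_mult_bounded[OF u, where K = "\<integral>x. norm (\<psi> x) \<partial>lborel"]) (auto intro: norm_ft_le \<psi>)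
  have "(\<integral>\<xi>. ?e \<xi> * (ft \<phi> \<xi> * cnj (ft \<psi> \<xi>)) \<partial>lborel) = (\<integral>\<xi>. (?e \<xi> * cnj (ft \<psi> \<xi>)) * ft \<phi> \<xi> \<partial>lborel)"
    by (simp add: ac_simps)
  also have "\<dots> = (\<integral>x. \<phi> x * ft (\<lambda>\<xi>. ?e \<xi> * cnj (ft \<psi> \<xi>)) x \<partial>lborel)"
    by (rule integral_mult_ft[OF g \<phi>])
  also have "\<dots> = (\<integral>x. (2 * pi) ^ DIM('a) * (\<integral>y. \<phi> x * cnj (\<psi> y) * gauss_kernel u (x - y) \<partial>lborel) \<partial>lborel)"
  proof (rule Bochner_Integration.integral_cong[OF refl])
    fix x
    have "ft (\<lambda>\<xi>. ?e \<xi> * cnj (ft \<psi> \<xi>)) x = cnj (\<integral>\<xi>. (?e \<xi> * cis (\<xi> \<bullet> x)) * ft \<psi> \<xi> \<partial>lborel)"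
      unfolding ft_def[of "\<lambda>\<xi>. ?e \<xi> * cnj (ft \<psi> \<xi>)"]
      by (subst Bochner_Integration.integral_cnj[symmetric], intro Bochner_Integration.integral_cong) (auto simp: cis_cnj)
    also have "\<dots> = cnj (\<integral>y. \<psi> y * ft (\<lambda>\<xi>. ?e \<xi> * cis (\<xi> \<bullet> x)) y \<partial>lborel)"
      by (subst integral_mult_ft[OF e \<psi>]) simp
    also have "\<dots> = cnj (\<integral>y. \<psi> y * ((2 * pi) ^ DIM('a) * gauss_kernel u (x - y)) \<partial>lborel)"
    proof -
      have "ft (\<lambda>\<xi>. ?e \<xi> * cis (\<xi> \<bullet> x)) y = (2 * pi) ^ DIM('a) * gauss_kernel u (x - y)" for y
        unfolding ft_def integral_cis_gaussian[OF u, symmetric]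
        by (intro Bochner_Integration.integral_cong refl)
           (simp add: cis_mult inner_diff_right mult.left_commute mult.commute[of "cis _" "?e _"])
      then show ?thesis by simp
    qed
    also have "\<dots> = (\<integral>y. (2 * pi) ^ DIM('a) * (cnj (\<psi> y) * gauss_kernel u (x - y)) \<partial>lborel)"
      by (subst Bochner_Integration.integral_cnj[symmetric]) (simp add: ac_simps)
    finally have "ft (\<lambda>\<xi>. ?e \<xi> * cnj (ft \<psi> \<xi>)) x =
      (2 * pi) ^ DIM('a) * (\<integral>y. cnj (\<psi> y) * gauss_kernel u (x - y) \<partial>lborel)"
      by (simp only: integral_mult_right_zero)
    moreover have "(\<integral>y. \<phi> x * cnj (\<psi> y) * gauss_kernel u (x - y) \<partial>lborel) =
        \<phi> x * (\<integral>y. cnj (\<psi> y) * gauss_kernel u (x - y) \<partial>lborel)"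
      by (simp only: integral_mult_right_zero mult.assoc)
    ultimately show "\<phi> x * ft (\<lambda>\<xi>. ?e \<xi> * cnj (ft \<psi> \<xi>)) x =
      (2 * pi) ^ DIM('a) * (\<integral>y. \<phi> x * cnj (\<psi> y) * gauss_kernel u (x - y) \<partial>lborel)"
      by (simp only: mult.left_commute)
  qed
  finally show ?B by simp
qed

text \<open>If the function is not integrable, its integral is 0 by convention and the bound is
  trivial.\<close>

lemma norm_integral_le_nn_integral:
  fixes f :: "'a \<Rightarrow> 'b::{banach,second_countable_topology}"
  shows "ennreal (norm (integral\<^sup>L M f)) \<le> (\<integral>\<^sup>+x. norm (f x) \<partial>M)"
  by (cases "integrable M f") (auto simp: integral_norm_bound_ennreal not_integrable_integral_eq)

section \<open>Plancherel's inequality and superpositions of Gaussian multipliers\<close>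

lemma nn_integral_lborel_diff:
  fixes f :: "'a::euclidean_space \<Rightarrow> ennreal"
  assumes [measurable]: "f \<in> borel_measurable borel"
  shows "(\<integral>\<^sup>+y. f (y - x) \<partial>lborel) = (\<integral>\<^sup>+y. f y \<partial>lborel)"
proof -
  have "(\<integral>\<^sup>+y. f y \<partial>lborel) = (\<integral>\<^sup>+y. f y \<partial>distr lborel borel ((+) (- x)))"
    by (simp add: lborel_distr_plus)
  also have "\<dots> = (\<integral>\<^sup>+y. f (y - x) \<partial>lborel)"
    by (subst nn_integral_distr) auto
  finally show ?thesis by simp
qed

lemma gauss_kernel_minus_commute: "gauss_kernel u (x - y) = gauss_kernel u (y - x)"
  by (simp add: gauss_kernel_def norm_minus_commute)

lemma nn_integral_gauss_kernel:
  fixes x :: "'a::euclidean_space"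
  assumes u: "0 < u"
  shows "(\<integral>\<^sup>+y. gauss_kernel u (y - x) \<partial>lborel) = 1" "(\<integral>\<^sup>+y. gauss_kernel u (x - y) \<partial>lborel) = 1"
proof -
  have "(\<integral>\<^sup>+(y::'a). gauss_kernel u y \<partial>lborel) = 1"
    using u by (subst nn_integral_eq_integral) (auto simp: integrable_gauss_kernel integral_gauss_kernel)
  then show "(\<integral>\<^sup>+y. gauss_kernel u (y - x) \<partial>lborel) = 1"
    by (subst nn_integral_lborel_diff[of "\<lambda>y. ennreal (gauss_kernel u y)"]) auto
  then show "(\<integral>\<^sup>+y. gauss_kernel u (x - y) \<partial>lborel) = 1"
    by (simp add: gauss_kernel_minus_commute)
qed

lemma norm_integral_exp_ft_cnj_ft_le:
  fixes \<phi> \<psi> :: "'a::euclidean_space \<Rightarrow> complex"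
  assumes u: "0 < u" and \<phi>: "integrable lborel \<phi>" and \<psi>: "integrable lborel \<psi>"
  shows "ennreal (norm (\<integral>\<xi>. exp (- u * (norm \<xi>)\<^sup>2) * (ft \<phi> \<xi> * cnj (ft \<psi> \<xi>)) \<partial>lborel)) \<le>
     ennreal ((2 * pi) ^ DIM('a)) * (\<integral>\<^sup>+x. (\<integral>\<^sup>+y. norm (\<phi> x) * norm (\<psi> y) * gauss_kernel u (x - y) \<partial>lborel) \<partial>lborel)"
proof -
  have "ennreal (norm (\<integral>x. (\<integral>y. \<phi> x * cnj (\<psi> y) * gauss_kernel u (x - y) \<partial>lborel) \<partial>lborel))
    \<le> (\<integral>\<^sup>+x. norm (\<integral>y. \<phi> x * cnj (\<psi> y) * gauss_kernel u (x - y) \<partial>lborel) \<partial>lborel)"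
    by (rule norm_integral_le_nn_integral)
  also have "\<dots> \<le> (\<integral>\<^sup>+x. (\<integral>\<^sup>+y. norm (\<phi> x * cnj (\<psi> y) * gauss_kernel u (x - y)) \<partial>lborel) \<partial>lborel)"
    by (intro nn_integral_mono norm_integral_le_nn_integral)
  also have "\<dots> = (\<integral>\<^sup>+x. (\<integral>\<^sup>+y. norm (\<phi> x) * norm (\<psi> y) * gauss_kernel u (x - y) \<partial>lborel) \<partial>lborel)"
    using u by (simp add: norm_mult)
  finally show ?thesis
    unfolding integral_exp_ft_cnj_ft[OF assms]
    by (simp add: norm_mult norm_power ennreal_mult mult_left_mono)
qed

text \<open>For positive u the regularised identity reduces the claim to a Schur test: a product is
  at most half the sum of the squares, and the heat kernel has mass 1 in either variable. Fatou's
  lemma then removes the regularisation.\<close>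

lemma nn_integral_norm_ft_power2_le:
  fixes f :: "'a::euclidean_space \<Rightarrow> complex"
  assumes f: "integrable lborel f"
  shows "(\<integral>\<^sup>+\<xi>. (norm (ft f \<xi>))\<^sup>2 \<partial>lborel) \<le> ennreal ((2 * pi) ^ DIM('a)) * (\<integral>\<^sup>+x. (norm (f x))\<^sup>2 \<partial>lborel)"
proof -
  have [measurable]: "f \<in> borel_measurable borel" using f by auto
  have *: "(\<integral>\<^sup>+\<xi>. exp (- u * (norm \<xi>)\<^sup>2) * (norm (ft f \<xi>))\<^sup>2 \<partial>lborel)
      \<le> ennreal ((2 * pi) ^ DIM('a)) * (\<integral>\<^sup>+x. (norm (f x))\<^sup>2 \<partial>lborel)" if u: "0 < u" for u :: real
  proof -
    have eq: "exp (- u * (norm \<xi>)\<^sup>2) * (ft f \<xi> * cnj (ft f \<xi>)) = complex_of_real (exp (- u * (norm \<xi>)\<^sup>2) * (norm (ft f \<xi>))\<^sup>2)" for \<xi>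
      by (simp add: complex_norm_square[symmetric] del: of_real_power)
    have "integrable lborel (\<lambda>\<xi>. exp (- u * (norm \<xi>)\<^sup>2) * (norm (ft f \<xi>))\<^sup>2)"
      using integrable_exp_ft_cnj_ft[OF u f f] unfolding eq complex_of_real_integrable_eq .
    then have "(\<integral>\<^sup>+\<xi>. exp (- u * (norm \<xi>)\<^sup>2) * (norm (ft f \<xi>))\<^sup>2 \<partial>lborel) =
        ennreal (\<integral>\<xi>. exp (- u * (norm \<xi>)\<^sup>2) * (norm (ft f \<xi>))\<^sup>2 \<partial>lborel)"
      by (intro nn_integral_eq_integral) auto
    also have "\<dots> = ennreal (norm (\<integral>\<xi>. exp (- u * (norm \<xi>)\<^sup>2) * (ft f \<xi> * cnj (ft f \<xi>)) \<partial>lborel))"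
      unfolding eq integral_complex_of_real norm_of_real by (simp add: abs_of_nonneg)
    also have "\<dots> \<le> ennreal ((2 * pi) ^ DIM('a)) * (\<integral>\<^sup>+x. (\<integral>\<^sup>+y. norm (f x) * norm (f y) * gauss_kernel u (x - y) \<partial>lborel) \<partial>lborel)"
      by (rule norm_integral_exp_ft_cnj_ft_le[OF u f f])
    also have "(\<integral>\<^sup>+x. (\<integral>\<^sup>+y. norm (f x) * norm (f y) * gauss_kernel u (x - y) \<partial>lborel) \<partial>lborel)
       \<le> (\<integral>\<^sup>+x. (\<integral>\<^sup>+y. ennreal ((norm (f x))\<^sup>2 / 2) * gauss_kernel u (x - y) + ennreal ((norm (f y))\<^sup>2 / 2) * gauss_kernel u (x - y) \<partial>lborel) \<partial>lborel)"
    proof (intro nn_integral_mono)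
      fix x y
      have "norm (f x) * norm (f y) \<le> (norm (f x))\<^sup>2 / 2 + (norm (f y))\<^sup>2 / 2"
        using sum_squares_bound[of "norm (f x)" "norm (f y)"] by (simp add: field_simps)
      then have "norm (f x) * norm (f y) * gauss_kernel u (x - y) \<le> ((norm (f x))\<^sup>2 / 2 + (norm (f y))\<^sup>2 / 2) * gauss_kernel u (x - y)"
        using u by (intro mult_right_mono) auto
      also have "ennreal \<dots> = ennreal ((norm (f x))\<^sup>2 / 2) * gauss_kernel u (x - y) + ennreal ((norm (f y))\<^sup>2 / 2) * gauss_kernel u (x - y)"
        using u by (simp only: distrib_right) (simp flip: ennreal_mult ennreal_plus)
      finally show "ennreal (norm (f x) * norm (f y) * gauss_kernel u (x - y)) \<le> \<dots>"
        by (simp add: ennreal_leI)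
    qed
    also have "\<dots> = (\<integral>\<^sup>+x. (\<integral>\<^sup>+y. ennreal ((norm (f x))\<^sup>2 / 2) * gauss_kernel u (x - y) \<partial>lborel) \<partial>lborel)
       + (\<integral>\<^sup>+x. (\<integral>\<^sup>+y. ennreal ((norm (f y))\<^sup>2 / 2) * gauss_kernel u (x - y) \<partial>lborel) \<partial>lborel)"
      by (simp add: nn_integral_add)
    also have "(\<integral>\<^sup>+x. (\<integral>\<^sup>+y. ennreal ((norm (f y))\<^sup>2 / 2) * gauss_kernel u (x - y) \<partial>lborel) \<partial>lborel)
        = (\<integral>\<^sup>+y. (\<integral>\<^sup>+x. ennreal ((norm (f y))\<^sup>2 / 2) * gauss_kernel u (x - y) \<partial>lborel) \<partial>lborel)"
      by (rule lborel_pair.Fubini') measurable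
    also have "(\<integral>\<^sup>+x. (\<integral>\<^sup>+y. ennreal ((norm (f x))\<^sup>2 / 2) * gauss_kernel u (x - y) \<partial>lborel) \<partial>lborel) = (\<integral>\<^sup>+x. ennreal ((norm (f x))\<^sup>2 / 2) \<partial>lborel)"
      by (simp add: nn_integral_cmult nn_integral_gauss_kernel u)
    also have "(\<integral>\<^sup>+y. (\<integral>\<^sup>+x. ennreal ((norm (f y))\<^sup>2 / 2) * gauss_kernel u (x - y) \<partial>lborel) \<partial>lborel) = (\<integral>\<^sup>+x. ennreal ((norm (f x))\<^sup>2 / 2) \<partial>lborel)"
      by (simp add: nn_integral_cmult nn_integral_gauss_kernel u)
    also have "(\<integral>\<^sup>+x. ennreal ((norm (f x))\<^sup>2 / 2) \<partial>lborel) + (\<integral>\<^sup>+x. ennreal ((norm (f x))\<^sup>2 / 2) \<partial>lborel)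
      = (\<integral>\<^sup>+x. (norm (f x))\<^sup>2 \<partial>lborel)"
      by (subst nn_integral_add[symmetric]) (auto simp flip: ennreal_plus)
    finally show ?thesis by (simp add: mult_left_mono)
  qed
  have "(\<integral>\<^sup>+\<xi>. (norm (ft f \<xi>))\<^sup>2 \<partial>lborel) = (\<integral>\<^sup>+\<xi>. liminf (\<lambda>k. ennreal (exp (- inverse (Suc k) * (norm \<xi>)\<^sup>2) * (norm (ft f \<xi>))\<^sup>2)) \<partial>lborel)"
  proof (intro nn_integral_cong)
    fix \<xi> :: 'a
    have "(\<lambda>k. exp (- inverse (Suc k) * (norm \<xi>)\<^sup>2) * (norm (ft f \<xi>))\<^sup>2) \<longlonglongrightarrow> exp (- 0 * (norm \<xi>)\<^sup>2) * (norm (ft f \<xi>))\<^sup>2"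
      by (intro tendsto_intros LIMSEQ_inverse_real_of_nat)
    then have "(\<lambda>k. ennreal (exp (- inverse (Suc k) * (norm \<xi>)\<^sup>2) * (norm (ft f \<xi>))\<^sup>2)) \<longlonglongrightarrow> ennreal ((norm (ft f \<xi>))\<^sup>2)"
      by (intro tendsto_ennrealI) simp
    then show "ennreal ((norm (ft f \<xi>))\<^sup>2) = liminf (\<lambda>k. ennreal (exp (- inverse (Suc k) * (norm \<xi>)\<^sup>2) * (norm (ft f \<xi>))\<^sup>2))"
      by (intro lim_imp_Liminf[symmetric]) auto
  qed
  also have "\<dots> \<le> liminf (\<lambda>k. \<integral>\<^sup>+\<xi>. ennreal (exp (- inverse (Suc k) * (norm \<xi>)\<^sup>2) * (norm (ft f \<xi>))\<^sup>2) \<partial>lborel)"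
    by (rule nn_integral_liminf) measurable
  also have "\<dots> \<le> ennreal ((2 * pi) ^ DIM('a)) * (\<integral>\<^sup>+x. (norm (f x))\<^sup>2 \<partial>lborel)"
    by (intro Liminf_le always_eventually allI *) auto
  finally show ?thesis .
qed

text \<open>If v is the smaller time, then \<open>u + v\<close> lies between u and
  \<open>2 * u\<close>, and doubling the time of a Gaussian costs at most \<open>sqrt 2\<close> per
  dimension. Taking the sum of both kernels on the right avoids asking which time is larger and
  leaves summands that depend on one time each.\<close>

lemma gauss_kernel_add_le:
  fixes z :: "'a::euclidean_space"
  assumes "0 < u" "0 < v"
  shows "gauss_kernel (u + v) z \<le> sqrt 2 ^ DIM('a) * (gauss_kernel (2 * u) z + gauss_kernel (2 * v) z)"
proof -
  have *: "gauss_kernel (u + v) z \<le> sqrt 2 ^ DIM('a) * gauss_kernel (2 * u) z" if "v \<le> u" "0 < v" for u v :: real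
  proof -
    have "1 / sqrt (4 * pi * (u + v)) \<le> sqrt 2 * (1 / sqrt (4 * pi * (2 * u)))"
    proof -
      have "sqrt 2 * (1 / sqrt (4 * pi * (2 * u))) = 1 / sqrt (4 * pi * u)"
      proof -
        have "sqrt (4 * pi * (2 * u)) = sqrt 2 * sqrt (4 * pi * u)"
          by (simp flip: real_sqrt_mult)
        then show ?thesis by simp
      qed
      also have "1 / sqrt (4 * pi * (u + v)) \<le> 1 / sqrt (4 * pi * u)"
        using that by (intro divide_left_mono) auto
      finally show ?thesis .
    qed
    moreover have "exp (- (norm z)\<^sup>2 / (4 * (u + v))) \<le> exp (- (norm z)\<^sup>2 / (4 * (2 * u)))"
      using that by (auto intro!: divide_left_mono)
    ultimately have "(1 / sqrt (4 * pi * (u + v))) ^ DIM('a) * exp (- (norm z)\<^sup>2 / (4 * (u + v)))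
       \<le> (sqrt 2 * (1 / sqrt (4 * pi * (2 * u)))) ^ DIM('a) * exp (- (norm z)\<^sup>2 / (4 * (2 * u)))"
      using that by (intro mult_mono power_mono) auto
    then show ?thesis
      unfolding gauss_kernel_def power_mult_distrib by simp
  qed
  show ?thesis
  proof (cases "v \<le> u")
    case True
    have "sqrt 2 ^ DIM('a) * gauss_kernel (2 * u) z \<le> sqrt 2 ^ DIM('a) * (gauss_kernel (2 * u) z + gauss_kernel (2 * v) z)"
      using assms by (intro mult_left_mono) auto
    then show ?thesis using *[OF True] assms by linarith
  next
    case False
    have a: "gauss_kernel (v + u) z \<le> sqrt 2 ^ DIM('a) * gauss_kernel (2 * v) z"
      using False assms by (intro *) auto
    have b: "sqrt 2 ^ DIM('a) * gauss_kernel (2 * v) z \<le> sqrt 2 ^ DIM('a) * (gauss_kernel (2 * u) z + gauss_kernel (2 * v) z)"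
      using assms by (intro mult_left_mono) auto
    show ?thesis using order_trans[OF a b] unfolding add.commute[of v u] .
  qed
qed

lemma nn_integral_gauss_kernel_double_le:
  fixes f g :: "'a::euclidean_space \<Rightarrow> real"
  assumes u: "0 < u" and [measurable]: "f \<in> borel_measurable borel" "g \<in> borel_measurable borel"
    and f: "\<And>x. 0 \<le> f x" and g: "\<And>x. 0 \<le> g x" "\<And>x. g x \<le> 1"
  shows "(\<integral>\<^sup>+x. (\<integral>\<^sup>+y. f x * g y * gauss_kernel u (x - y) \<partial>lborel) \<partial>lborel) \<le> (\<integral>\<^sup>+x. f x \<partial>lborel)"
proof (intro nn_integral_mono)
  fix x
  have "(\<integral>\<^sup>+y. f x * g y * gauss_kernel u (x - y) \<partial>lborel) \<le> (\<integral>\<^sup>+y. ennreal (f x) * gauss_kernel u (x - y) \<partial>lborel)"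
  proof (intro nn_integral_mono)
    fix y
    have "f x * g y * gauss_kernel u (x - y) \<le> f x * 1 * gauss_kernel u (x - y)"
      using f g u by (intro mult_mono mult_nonneg_nonneg) auto
    then show "ennreal (f x * g y * gauss_kernel u (x - y)) \<le> ennreal (f x) * gauss_kernel u (x - y)"
      using f u by (simp add: ennreal_leI flip: ennreal_mult)
  qed
  also have "\<dots> = f x"
    by (simp add: nn_integral_cmult nn_integral_gauss_kernel u)
  finally show "(\<integral>\<^sup>+y. f x * g y * gauss_kernel u (x - y) \<partial>lborel) \<le> f x" .
qed

text \<open>
  The \<open>T T*\<close> argument: expanding the square produces Gaussian kernels at the times \<open>u m + u k\<close>, which
  are dominated by the kernels at the times \<open>2 * u m\<close> and \<open>2 * u k\<close>; one of the two summations then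
  disappears because the \<open>\<phi> m\<close> add up to at most 1.
\<close>

lemma nn_integral_sum_exp_ft_power2_le:
  fixes \<phi> :: "'i \<Rightarrow> 'a::euclidean_space \<Rightarrow> complex" and u :: "'i \<Rightarrow> real"
  assumes I: "finite I" and u: "\<And>m. m \<in> I \<Longrightarrow> 0 < u m"
    and \<phi>_meas: "\<And>m. m \<in> I \<Longrightarrow> \<phi> m \<in> borel_measurable borel"
    and \<phi>: "\<And>x. (\<Sum>m\<in>I. norm (\<phi> m x)) \<le> indicator A x"
    and A: "A \<in> sets borel" "emeasure lborel A < \<infinity>"
  shows "(\<integral>\<^sup>+\<xi>. (norm (\<Sum>m\<in>I. exp (- u m * (norm \<xi>)\<^sup>2) * ft (\<phi> m) \<xi>))\<^sup>2 \<partial>lborel)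
    \<le> ennreal (2 * (2 * pi) ^ DIM('a) * sqrt 2 ^ DIM('a)) * emeasure lborel A"
proof -
  have [measurable]: "A \<in> sets borel" by (rule A)
  have le1: "norm (\<phi> m x) \<le> indicator A x" if "m \<in> I" for m x
    using member_le_sum[OF that, of "\<lambda>m. norm (\<phi> m x)"] I \<phi>[of x] by simp
  have intA: "integrable lborel (indicator A :: 'a \<Rightarrow> real)"
    using A by simp
  have int: "integrable lborel (\<phi> m)" if "m \<in> I" for m
    using le1[OF that] \<phi>_meas[OF that] by (intro Bochner_Integration.integrable_bound[OF intA]) auto
  let ?t = "\<lambda>m k \<xi>. exp (- (u m + u k) * (norm \<xi>)\<^sup>2) * (ft (\<phi> m) \<xi> * cnj (ft (\<phi> k) \<xi>))"
  have t_int: "integrable lborel (?t m k)" if "m \<in> I" "k \<in> I" for m k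
    using that u[of m] u[of k] by (intro integrable_exp_ft_cnj_ft int) auto
  let ?S = "\<lambda>\<xi>. (norm (\<Sum>m\<in>I. exp (- u m * (norm \<xi>)\<^sup>2) * ft (\<phi> m) \<xi>))\<^sup>2"
  have eq: "complex_of_real (?S \<xi>) = (\<Sum>m\<in>I. \<Sum>k\<in>I. ?t m k \<xi>)" for \<xi>
    by (simp add: complex_norm_square sum_product cnj_sum distrib_right exp_add exp_diff exp_minus field_simps del: of_real_power)
  have S_int: "integrable lborel ?S"
  proof -
    have "integrable lborel (\<lambda>\<xi>. complex_of_real (?S \<xi>))"
      unfolding eq by (intro Bochner_Integration.integrable_sum t_int)
    then show ?thesis by (simp only: complex_of_real_integrable_eq)
  qed
  let ?c = "ennreal ((2 * pi) ^ DIM('a))" and ?d = "ennreal (sqrt 2 ^ DIM('a))"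
  let ?n = "\<lambda>m x. norm (\<phi> m x)"
  let ?Q = "\<lambda>v f g. (\<integral>\<^sup>+x. (\<integral>\<^sup>+y. f x * g y * gauss_kernel v (x - y) \<partial>lborel) \<partial>lborel)"
  have nm[measurable]: "?n m \<in> borel_measurable borel" if "m \<in> I" for m
    using \<phi>_meas[OF that] by measurable
  have "(\<integral>\<^sup>+\<xi>. ?S \<xi> \<partial>lborel) = ennreal (\<integral>\<xi>. ?S \<xi> \<partial>lborel)"
    by (intro nn_integral_eq_integral S_int) auto
  also have "(\<integral>\<xi>. ?S \<xi> \<partial>lborel) = norm (\<integral>\<xi>. complex_of_real (?S \<xi>) \<partial>lborel)"
    unfolding integral_complex_of_real norm_of_real by (intro abs_of_nonneg[symmetric] integral_nonneg_AE) auto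
  also have "\<dots> = norm (\<Sum>m\<in>I. \<Sum>k\<in>I. \<integral>\<xi>. ?t m k \<xi> \<partial>lborel)"
  proof -
    have "(\<integral>\<xi>. (\<Sum>m\<in>I. \<Sum>k\<in>I. ?t m k \<xi>) \<partial>lborel) = (\<Sum>m\<in>I. \<integral>\<xi>. (\<Sum>k\<in>I. ?t m k \<xi>) \<partial>lborel)"
      by (intro Bochner_Integration.integral_sum Bochner_Integration.integrable_sum t_int)
    also have "\<dots> = (\<Sum>m\<in>I. \<Sum>k\<in>I. \<integral>\<xi>. ?t m k \<xi> \<partial>lborel)"
      by (intro sum.cong refl Bochner_Integration.integral_sum t_int)
    finally show ?thesis unfolding eq by simp
  qed
  also have "ennreal \<dots> \<le> ennreal (\<Sum>m\<in>I. \<Sum>k\<in>I. norm (\<integral>\<xi>. ?t m k \<xi> \<partial>lborel))"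
    by (intro ennreal_leI order_trans[OF norm_sum] sum_mono order_refl)
  also have "\<dots> = (\<Sum>m\<in>I. \<Sum>k\<in>I. ennreal (norm (\<integral>\<xi>. ?t m k \<xi> \<partial>lborel)))"
    by (simp add: sum_nonneg)
  also have "\<dots> \<le> (\<Sum>m\<in>I. \<Sum>k\<in>I. ?c * ?Q (u m + u k) (?n m) (?n k))"
    using u by (intro sum_mono norm_integral_exp_ft_cnj_ft_le int add_pos_pos) auto
  also have "\<dots> \<le> (\<Sum>m\<in>I. \<Sum>k\<in>I. ?c * (?d * (?Q (2 * u m) (?n m) (?n k) + ?Q (2 * u k) (?n k) (?n m))))"
  proof (intro sum_mono mult_left_mono)
    fix m k assume mk: "m \<in> I" "k \<in> I"
    have [measurable]: "?n m \<in> borel_measurable borel" "?n k \<in> borel_measurable borel"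
      using mk nm by auto
    have "?Q (u m + u k) (?n m) (?n k) \<le> (\<integral>\<^sup>+x. (\<integral>\<^sup>+y. ?d * (ennreal (?n m x * ?n k y * gauss_kernel (2 * u m) (x - y)) + ennreal (?n m x * ?n k y * gauss_kernel (2 * u k) (x - y))) \<partial>lborel) \<partial>lborel)"
    proof (intro nn_integral_mono)
      fix x y
      have "?n m x * ?n k y * gauss_kernel (u m + u k) (x - y) \<le> ?n m x * ?n k y * (sqrt 2 ^ DIM('a) * (gauss_kernel (2 * u m) (x - y) + gauss_kernel (2 * u k) (x - y)))"
        using u mk by (intro mult_left_mono gauss_kernel_add_le) auto
      also have "\<dots> = sqrt 2 ^ DIM('a) * (?n m x * ?n k y * gauss_kernel (2 * u m) (x - y) + ?n m x * ?n k y * gauss_kernel (2 * u k) (x - y))"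
        by (simp add: algebra_simps)
      finally show "ennreal (?n m x * ?n k y * gauss_kernel (u m + u k) (x - y)) \<le>
        ?d * (ennreal (?n m x * ?n k y * gauss_kernel (2 * u m) (x - y)) + ennreal (?n m x * ?n k y * gauss_kernel (2 * u k) (x - y)))"
        using u[OF mk(1)] u[OF mk(2)] by (subst ennreal_plus[symmetric], simp, simp, subst ennreal_mult[symmetric]) (auto intro!: ennreal_leI)
    qed
    also have "\<dots> = ?d * (?Q (2 * u m) (?n m) (?n k) + (\<integral>\<^sup>+x. (\<integral>\<^sup>+y. ?n m x * ?n k y * gauss_kernel (2 * u k) (x - y) \<partial>lborel) \<partial>lborel))"
      by (simp add: nn_integral_cmult nn_integral_add)
    \<comment> \<open>Exchanging the variables, by the symmetry of the kernel, gives the second term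
      the form of the first one with m and k interchanged. The double sums of the two terms are
      therefore equal.\<close>
    also have "(\<integral>\<^sup>+x. (\<integral>\<^sup>+y. ?n m x * ?n k y * gauss_kernel (2 * u k) (x - y) \<partial>lborel) \<partial>lborel)
       = (\<integral>\<^sup>+y. (\<integral>\<^sup>+x. ?n m x * ?n k y * gauss_kernel (2 * u k) (x - y) \<partial>lborel) \<partial>lborel)"
      by (rule lborel_pair.Fubini') measurable
    also have "\<dots> = ?Q (2 * u k) (?n k) (?n m)"
    proof (intro nn_integral_cong)
      fix x y
      show "ennreal (?n m x * ?n k y * gauss_kernel (2 * u k) (x - y)) = ennreal (?n k y * ?n m x * gauss_kernel (2 * u k) (y - x))"
        by (subst gauss_kernel_minus_commute) (simp only: mult.commute)
    qed
    finally show "?Q (u m + u k) (?n m) (?n k) \<le> ?d * (?Q (2 * u m) (?n m) (?n k) + ?Q (2 * u k) (?n k) (?n m))" .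
  qed simp_all
  also have "\<dots> = ?c * (?d * (2 * (\<Sum>m\<in>I. \<Sum>k\<in>I. ?Q (2 * u m) (?n m) (?n k))))"
  proof -
    have "(\<Sum>m\<in>I. \<Sum>k\<in>I. ?Q (2 * u k) (?n k) (?n m)) = (\<Sum>m\<in>I. \<Sum>k\<in>I. ?Q (2 * u m) (?n m) (?n k))"
      by (rule sum.swap)
    then show ?thesis
      by (simp only: sum_distrib_left[symmetric] sum.distrib mult_2)
  qed
  also have "(\<Sum>m\<in>I. \<Sum>k\<in>I. ?Q (2 * u m) (?n m) (?n k)) \<le> (\<Sum>m\<in>I. (\<integral>\<^sup>+x. ?n m x \<partial>lborel))"
  proof (intro sum_mono)
    fix m assume m: "m \<in> I"
    have [measurable]: "?n m \<in> borel_measurable borel" using m by (rule nm)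
    have [measurable]: "(\<lambda>y. \<Sum>k\<in>I. ?n k y) \<in> borel_measurable borel"
      by (intro borel_measurable_sum nm)
    have "(\<Sum>k\<in>I. ?Q (2 * u m) (?n m) (?n k)) = (\<integral>\<^sup>+x. (\<Sum>k\<in>I. \<integral>\<^sup>+y. ?n m x * ?n k y * gauss_kernel (2 * u m) (x - y) \<partial>lborel) \<partial>lborel)"
      using nm by (intro nn_integral_sum[symmetric]) measurable
    also have "\<dots> = (\<integral>\<^sup>+x. (\<integral>\<^sup>+y. (\<Sum>k\<in>I. ennreal (?n m x * ?n k y * gauss_kernel (2 * u m) (x - y))) \<partial>lborel) \<partial>lborel)"
      using nm by (intro nn_integral_cong nn_integral_sum[symmetric]) measurable
    also have "\<dots> = ?Q (2 * u m) (?n m) (\<lambda>y. \<Sum>k\<in>I. ?n k y)"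
      using u[OF m] by (intro nn_integral_cong) (simp add: sum_distrib_left sum_distrib_right)
    also have "\<dots> \<le> (\<integral>\<^sup>+x. ?n m x \<partial>lborel)"
      using u[OF m] \<phi> by (intro nn_integral_gauss_kernel_double_le) (auto intro: sum_nonneg order_trans[OF \<phi>] simp: indicator_def)
    finally show "(\<Sum>k\<in>I. ?Q (2 * u m) (?n m) (?n k)) \<le> (\<integral>\<^sup>+x. ?n m x \<partial>lborel)" .
  qed
  also have "(\<Sum>m\<in>I. (\<integral>\<^sup>+x. ?n m x \<partial>lborel)) = (\<integral>\<^sup>+x. (\<Sum>m\<in>I. ?n m x) \<partial>lborel)"
    using nm by (subst nn_integral_sum[symmetric]) auto
  also have "\<dots> \<le> (\<integral>\<^sup>+x. indicator A x \<partial>lborel)"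
    by (intro nn_integral_mono) (simp add: \<phi> ennreal_leI flip: ennreal_indicator)
  also have "\<dots> = emeasure lborel A" by simp
  also have "?c * (?d * (2 * emeasure lborel A)) = ennreal (2 * (2 * pi) ^ DIM('a) * sqrt 2 ^ DIM('a)) * emeasure lborel A"
    by (simp add: ennreal_mult ac_simps)
  finally show ?thesis by (simp add: mult_left_mono)
qed

section \<open>Stable subordinators\<close>

text \<open>
  The stable law of index \<open>\<alpha>\<close> arises as the limit of normalized sums of independent variables with the
  Sibuya distribution, because the generating function of the latter is \<open>1 - (1 - z) powr \<alpha>\<close>.
\<close>

definition sibuya :: "real \<Rightarrow> nat \<Rightarrow> real" where
  "sibuya \<alpha> j = (if j = 0 then 0 else - ((\<alpha> gchoose j) * (- 1) ^ j))"

lemma gbinomial_Suc_eq: "((a::real) gchoose Suc k) = (a gchoose k) * (a - k) / (k + 1)"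
  by (simp add: gbinomial_prod_rev field_simps)

text \<open>The first weight is \<open>\<alpha>\<close>, and consecutive weights have the ratio
  \<open>(k + 1 - \<alpha>) / (k + 2)\<close>, which is positive as
  \<open>\<alpha> < 1\<close>.\<close>

lemma sibuya_nonneg:
  assumes "0 < \<alpha>" "\<alpha> < 1"
  shows "0 \<le> sibuya \<alpha> j"
proof (cases j)
  case (Suc k)
  have "0 \<le> - ((\<alpha> gchoose Suc k) * (- 1) ^ Suc k)"
  proof (induction k)
    case 0
    show ?case using assms by simp
  next
    case (Suc k)
    have "- ((\<alpha> gchoose Suc (Suc k)) * (- 1) ^ Suc (Suc k)) =
       - ((\<alpha> gchoose Suc k) * (- 1) ^ Suc k) * ((k + 1 - \<alpha>) / (k + 2))"
      by (subst gbinomial_Suc_eq) (simp add: field_simps)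
    also have "0 \<le> \<dots>"
      using assms Suc.IH by (intro mult_nonneg_nonneg) auto
    finally show ?case .
  qed
  then show ?thesis by (simp add: sibuya_def Suc)
qed (simp add: sibuya_def)

lemma sibuya_sums:
  assumes "0 \<le> z" "z < 1"
  shows "(\<lambda>j. sibuya \<alpha> j * z ^ j) sums (1 - (1 - z) powr \<alpha>)"
proof -
  have "(\<lambda>j. (if j = 0 then 1 else 0) - (\<alpha> gchoose j) * (- z) ^ j) sums (1 - (1 + - z) powr \<alpha>)"
    using assms by (intro sums_diff gen_binomial_real) (use sums_single[of 0 "\<lambda>_. 1::real"] in auto)
  also have "(\<lambda>j. (if j = 0 then 1 else 0) - (\<alpha> gchoose j) * (- z) ^ j) = (\<lambda>j. sibuya \<alpha> j * z ^ j)"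
    using power_mult_distrib[of "-1" z] by (auto simp: fun_eq_iff sibuya_def)
  finally show ?thesis by simp
qed

text \<open>An Abel argument: as the weights are nonnegative, letting z tend to 1 from the left in
  the generating function bounds the partial sums from above and the full sum from below.\<close>

lemma sibuya_sums_1:
  assumes \<alpha>: "0 < \<alpha>" "\<alpha> < 1"
  shows "sibuya \<alpha> sums 1"
proof -
  note nn = sibuya_nonneg[OF \<alpha>]
  have partial: "sum (sibuya \<alpha>) {..<n} \<le> 1" for n
  proof (rule tendsto_upperbound)
    show "((\<lambda>z. \<Sum>j<n. sibuya \<alpha> j * z ^ j) \<longlongrightarrow> sum (sibuya \<alpha>) {..<n}) (at_left 1)"
      by (rule tendsto_eq_intros refl | simp)+
    show "\<forall>\<^sub>F z in at_left (1::real). (\<Sum>j<n. sibuya \<alpha> j * z ^ j) \<le> 1"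
    proof (rule eventually_at_leftI[of 0])
      fix z :: real assume z: "z \<in> {0<..<1}"
      have "(\<Sum>j<n. sibuya \<alpha> j * z ^ j) \<le> (\<Sum>j. sibuya \<alpha> j * z ^ j)"
        using z nn sibuya_sums[of z \<alpha>] by (intro sum_le_suminf) (auto simp: sums_iff)
      also have "\<dots> = 1 - (1 - z) powr \<alpha>"
        using z sibuya_sums[of z \<alpha>] by (simp add: sums_iff)
      finally show "(\<Sum>j<n. sibuya \<alpha> j * z ^ j) \<le> 1" by (smt (verit) powr_ge_zero)
    qed simp
  qed simp
  have summable: "summable (sibuya \<alpha>)"
    by (rule summableI_nonneg_bounded[OF nn partial])
  have "suminf (sibuya \<alpha>) \<le> 1"
    by (rule suminf_le_const[OF summable partial])
  moreover have "1 \<le> suminf (sibuya \<alpha>)"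
  proof (rule tendsto_upperbound)
    show "((\<lambda>z. 1 - (1 - z) powr \<alpha>) \<longlongrightarrow> 1) (at_left (1::real))"
      using \<alpha> by real_asymp
    show "\<forall>\<^sub>F z in at_left (1::real). 1 - (1 - z) powr \<alpha> \<le> suminf (sibuya \<alpha>)"
    proof (rule eventually_at_leftI[of 0])
      fix z :: real assume z: "z \<in> {0<..<1}"
      have "(\<Sum>j. sibuya \<alpha> j * z ^ j) \<le> suminf (sibuya \<alpha>)"
        using z nn sibuya_sums[of z \<alpha>]
        by (intro suminf_le summable) (auto simp: sums_iff intro!: mult_left_le power_le_one)
      then show "1 - (1 - z) powr \<alpha> \<le> suminf (sibuya \<alpha>)"
        using z sibuya_sums[of z \<alpha>] by (simp add: sums_iff)
    qed simp
  qed simp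
  ultimately show ?thesis using summable by (simp add: sums_iff)
qed

definition sibuya_pmf :: "real \<Rightarrow> nat pmf" where
  "sibuya_pmf \<alpha> = embed_pmf (sibuya \<alpha>)"

primrec sibuya_sum_pmf :: "real \<Rightarrow> nat \<Rightarrow> nat pmf" where
  "sibuya_sum_pmf \<alpha> 0 = return_pmf 0"
| "sibuya_sum_pmf \<alpha> (Suc k) = map_pmf (\<lambda>(i, j). i + j) (pair_pmf (sibuya_pmf \<alpha>) (sibuya_sum_pmf \<alpha> k))"

lemma pmf_sibuya:
  assumes "0 < \<alpha>" "\<alpha> < 1"
  shows "pmf (sibuya_pmf \<alpha>) j = sibuya \<alpha> j"
  unfolding sibuya_pmf_def
proof (rule pmf_embed_pmf)
  show "(\<integral>\<^sup>+j. ennreal (sibuya \<alpha> j) \<partial>count_space UNIV) = 1"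
    using sibuya_sums_1[OF assms] sibuya_nonneg[OF assms]
    by (simp add: nn_integral_count_space_nat suminf_ennreal2 sums_iff)
qed (rule sibuya_nonneg[OF assms])

lemma nn_integral_sibuya_sum_pmf:
  assumes \<alpha>: "0 < \<alpha>" "\<alpha> < 1" and z: "0 \<le> z" "z < 1"
  shows "(\<integral>\<^sup>+j. ennreal (z ^ j) \<partial>sibuya_sum_pmf \<alpha> k) = ennreal ((1 - (1 - z) powr \<alpha>) ^ k)"
proof (induction k)
  case (Suc k)
  have "(\<integral>\<^sup>+j. ennreal (z ^ j) \<partial>sibuya_pmf \<alpha>) = ennreal (1 - (1 - z) powr \<alpha>)"
    using sibuya_sums[OF z, of \<alpha>] sibuya_nonneg[OF \<alpha>] z
    by (subst nn_integral_measure_pmf)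
       (simp add: pmf_sibuya \<alpha> nn_integral_count_space_nat suminf_ennreal2 sums_iff flip: ennreal_mult)
  moreover have "(1 - z) powr \<alpha> \<le> 1"
    using z \<alpha> by (intro powr_le1) auto
  ultimately show ?case
    using z by (simp add: nn_integral_pair_pmf' power_add ennreal_mult nn_integral_cmult nn_integral_multc Suc.IH)
qed simp

text \<open>The shift of the index keeps the number of summands positive. The exponent
  \<open>- (1 / \<alpha>)\<close> is the scaling of sums of independent variables attracted to a
  stable law of index \<open>\<alpha>\<close>.\<close>

definition sibuya_distr :: "real \<Rightarrow> nat \<Rightarrow> real measure" where
  "sibuya_distr \<alpha> k = distr (sibuya_sum_pmf \<alpha> (Suc k)) borel (\<lambda>j. real j * real (Suc k) powr (- (1 / \<alpha>)))"

lemma real_distribution_sibuya_distr: "real_distribution (sibuya_distr \<alpha> k)"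
  unfolding sibuya_distr_def
  by (simp add: real_distribution_def real_distribution_axioms_def measure_pmf.prob_space_distr)

text \<open>The Laplace transform of \<open>sibuya_distr\<close> at l: the generating function of
  one variable at \<open>exp (- l * c)\<close>, where c is the scale, raised to the number of
  summands.\<close>

definition sibuya_laplace :: "real \<Rightarrow> nat \<Rightarrow> real \<Rightarrow> real" where
  "sibuya_laplace \<alpha> k l = (1 - (1 - exp (- l * real (Suc k) powr (- (1 / \<alpha>)))) powr \<alpha>) ^ Suc k"

text \<open>With \<open>max w 0\<close> the test function is bounded and continuous on the whole
  line, as weak convergence requires; on the nonnegative reals, which carry the distribution,
  nothing changes.\<close>

lemma integral_sibuya_distr:
  assumes \<alpha>: "0 < \<alpha>" "\<alpha> < 1" and l: "0 < l"
  shows "(\<integral>w. exp (- l * max w 0) \<partial>sibuya_distr \<alpha> k) = sibuya_laplace \<alpha> k l"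
proof -
  define c where "c = real (Suc k) powr (- (1 / \<alpha>))"
  have c: "0 < c" unfolding c_def by simp
  define z where "z = exp (- l * c)"
  have z: "0 \<le> z" "z < 1" using l c by (auto simp: z_def)
  have "(1 - z) powr \<alpha> \<le> 1"
    using z \<alpha> by (intro powr_le1) auto
  have "(\<integral>w. exp (- l * max w 0) \<partial>sibuya_distr \<alpha> k) = (\<integral>j. z ^ j \<partial>sibuya_sum_pmf \<alpha> (Suc k))"
  proof -
    have "exp (- l * max (real j * c) 0) = z ^ j" for j
    proof -
      have "max (real j * c) 0 = real j * c" using c by simp
      then show ?thesis by (simp add: z_def ac_simps flip: exp_of_nat_mult)
    qed
    then show ?thesis
      unfolding sibuya_distr_def c_def[symmetric] by (subst integral_distr) simp_all
  qed
  also have "\<dots> = enn2real (\<integral>\<^sup>+j. ennreal (z ^ j) \<partial>sibuya_sum_pmf \<alpha> (Suc k))"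
    using z by (intro integral_eq_nn_integral) auto
  also have "\<dots> = (1 - (1 - z) powr \<alpha>) ^ Suc k"
    unfolding nn_integral_sibuya_sum_pmf[OF \<alpha> z]
    using \<open>(1 - z) powr \<alpha> \<le> 1\<close> by (intro enn2real_ennreal zero_le_power) simp
  finally show ?thesis unfolding sibuya_laplace_def z_def c_def .
qed

text \<open>The inequality \<open>1 - exp (- x) \<le> x\<close> bounds the base and Bernoulli's
  inequality the power. The bound is uniform in k, which is what tightness asks for.\<close>

lemma sibuya_laplace_ge:
  assumes \<alpha>: "0 < \<alpha>" "\<alpha> < 1" and l: "0 < l" "l \<le> 1"
  shows "1 - l powr \<alpha> \<le> sibuya_laplace \<alpha> k l"
proof -
  define c where "c = real (Suc k) powr (- (1 / \<alpha>))"
  have c: "0 < c" unfolding c_def by simp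
  have "(1 - exp (- l * c)) powr \<alpha> \<le> (l * c) powr \<alpha>"
    using l c \<alpha> exp_ge_add_one_self[of "- (l * c)"] by (intro powr_mono2) auto
  also have "\<dots> = l powr \<alpha> * c powr \<alpha>"
    using l c by (simp add: powr_mult)
  also have "c powr \<alpha> = 1 / real (Suc k)"
    unfolding c_def powr_powr using \<alpha> by (simp add: powr_minus_divide)
  finally have le: "(1 - exp (- l * c)) powr \<alpha> \<le> l powr \<alpha> / real (Suc k)"
    by simp
  have l1: "l powr \<alpha> \<le> 1" using l \<alpha> by (intro powr_le1) auto
  then have l2: "l powr \<alpha> / real (Suc k) \<le> 1" by (simp add: field_simps)
  have "1 - l powr \<alpha> = 1 + real (Suc k) * (- (l powr \<alpha> / real (Suc k)))" by (simp del: of_nat_Suc)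
  also have "\<dots> \<le> (1 + (- (l powr \<alpha> / real (Suc k)))) ^ Suc k"
    using l2 by (intro Bernoulli_inequality) simp
  also have "\<dots> \<le> (1 - (1 - exp (- l * c)) powr \<alpha>) ^ Suc k"
    using le l2 by (intro power_mono) (simp_all del: of_nat_Suc)
  finally show ?thesis unfolding sibuya_laplace_def c_def .
qed

lemma sibuya_laplace_tendsto:
  assumes \<alpha>: "0 < \<alpha>" "\<alpha> < 1" and l: "0 < l"
  shows "(\<lambda>k. sibuya_laplace \<alpha> k l) \<longlonglongrightarrow> exp (- (l powr \<alpha>))"
proof -
  have "((\<lambda>x::real. (1 - (1 - exp (- l * x powr (- (1 / \<alpha>)))) powr \<alpha>) powr x) \<longlongrightarrow> exp (- (l powr \<alpha>))) at_top"
    using \<alpha> l by real_asymp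
  moreover have "filterlim (\<lambda>k. real (Suc k)) at_top sequentially"
    by real_asymp
  ultimately have "(\<lambda>k. (1 - (1 - exp (- l * real (Suc k) powr (- (1 / \<alpha>)))) powr \<alpha>) powr real (Suc k)) \<longlonglongrightarrow> exp (- (l powr \<alpha>))"
    by (rule filterlim_compose)
  moreover have "(1 - (1 - exp (- l * real (Suc k) powr (- (1 / \<alpha>)))) powr \<alpha>) powr real (Suc k) = sibuya_laplace \<alpha> k l" for k
  proof -
    have "(1 - exp (- l * real (Suc k) powr (- (1 / \<alpha>)))) powr \<alpha> < 1 powr \<alpha>"
      using \<alpha> l by (intro powr_less_mono2) auto
    then show ?thesis unfolding sibuya_laplace_def by (subst powr_realpow) auto
  qed
  ultimately show ?thesis by simp
qed

lemma tight_sibuya_distr: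
  assumes \<alpha>: "0 < \<alpha>" "\<alpha> < 1"
  shows "tight (sibuya_distr \<alpha>)"
  unfolding tight_def
proof (intro conjI allI impI)
  fix k show "real_distribution (sibuya_distr \<alpha> k)" by (rule real_distribution_sibuya_distr)
next
  fix \<epsilon> :: real assume \<epsilon>: "0 < \<epsilon>"
  \<comment> \<open>The number l is so small that the Laplace transform at l misses 1 by at most
    half of \<open>\<epsilon> * (1 - exp (- 1))\<close>; it is at most 1 because
    \<open>sibuya_laplace_ge\<close> assumes so.\<close>
  define l where "l = min 1 ((\<epsilon> * (1 - exp (- 1)) / 2) powr (1 / \<alpha>))"
  have e1: "exp (- 1) < (1::real)" by simp
  have l: "0 < l" "l \<le> 1" using \<epsilon> e1 by (auto simp: l_def)
  have "l powr \<alpha> \<le> ((\<epsilon> * (1 - exp (- 1)) / 2) powr (1 / \<alpha>)) powr \<alpha>"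
    using l \<alpha> by (intro powr_mono2) (auto simp: l_def)
  also have "\<dots> = \<epsilon> * (1 - exp (- 1)) / 2"
    using \<alpha> \<epsilon> by (simp add: powr_powr)
  finally have la: "l powr \<alpha> \<le> \<epsilon> * (1 - exp (- 1)) / 2" .
  have "measure (sibuya_distr \<alpha> k) {- 1<..1 / l} > 1 - \<epsilon>" for k
  proof -
    interpret real_distribution "sibuya_distr \<alpha> k" by (rule real_distribution_sibuya_distr)
    have nn: "AE w in sibuya_distr \<alpha> k. 0 \<le> w"
      unfolding sibuya_distr_def by (subst AE_distr_iff) auto
    have i: "integrable (sibuya_distr \<alpha> k) (\<lambda>w. exp (- l * max w 0))"
      using l by (intro integrable_const_bound[of _ 1]) (auto simp: mult_nonneg_nonneg)
    have i2: "integrable (sibuya_distr \<alpha> k) (\<lambda>w. exp (- 1) + (1 - exp (- 1)) * indicator {- 1<..1 / l} w :: real)"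
      by (intro integrable_const_bound[of _ 1]) (auto simp: indicator_def)
    have "1 - l powr \<alpha> \<le> (\<integral>w. exp (- l * max w 0) \<partial>sibuya_distr \<alpha> k)"
      unfolding integral_sibuya_distr[OF \<alpha> l(1)] by (rule sibuya_laplace_ge[OF \<alpha> l])
    \<comment> \<open>Mass beyond \<open>1 / l\<close> enters the Laplace transform with a factor of
      at most \<open>exp (- 1)\<close>; a transform close to 1 therefore forces most of the mass
      below \<open>1 / l\<close>.\<close>
    also have "\<dots> \<le> (\<integral>w. exp (- 1) + (1 - exp (- 1)) * indicator {- 1<..1 / l} w \<partial>sibuya_distr \<alpha> k)"
    proof (intro integral_mono_AE i i2)
      show "AE w in sibuya_distr \<alpha> k. exp (- l * max w 0) \<le> exp (- 1) + (1 - exp (- 1)) * indicator {- 1<..1 / l} w"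
        using nn
      proof eventually_elim
        case (elim w)
        show ?case
        proof (cases "w \<le> 1 / l")
          case True
          then show ?thesis using elim l by (auto simp: indicator_def)
        next
          case False
          then have "1 \<le> l * w" using l by (simp add: field_simps)
          then show ?thesis using elim False by (simp add: indicator_def max_def)
        qed
      qed
    qed
    also have "\<dots> = exp (- 1) + (1 - exp (- 1)) * measure (sibuya_distr \<alpha> k) {- 1<..1 / l}"
    proof -
      have "integrable (sibuya_distr \<alpha> k) (indicator {- 1<..1 / l} :: real \<Rightarrow> real)"
        by (intro integrable_const_bound[of _ 1]) (auto simp: indicator_def)
      moreover have "prob UNIV = 1" using prob_space by simp
      ultimately show ?thesis by (subst Bochner_Integration.integral_add) auto
    qed
    finally have "(1 - exp (- 1)) * (1 - measure (sibuya_distr \<alpha> k) {- 1<..1 / l}) \<le> l powr \<alpha>"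
      by (simp add: algebra_simps)
    also have "\<dots> < (1 - exp (- 1)) * \<epsilon>"
    proof -
      have "0 < (1 - exp (- 1)) * \<epsilon>" using \<epsilon> e1 by (intro mult_pos_pos) auto
      then show ?thesis using la unfolding mult.commute[of \<epsilon>] by linarith
    qed
    finally have "1 - measure (sibuya_distr \<alpha> k) {- 1<..1 / l} < \<epsilon>"
      using e1 by (simp add: mult_less_cancel_left_pos)
    then show ?thesis by simp
  qed
  moreover have "-1 < 1 / l" using l by (smt (verit) divide_pos_pos)
  ultimately show "\<exists>a b. a < b \<and> (\<forall>n. 1 - \<epsilon> < measure (sibuya_distr \<alpha> n) {a<..b})"
    by blast
qed

text \<open>Tightness gives a weak limit along a subsequence only, but the Laplace transforms
  converge along the whole sequence, and they fix the transform of the limit.\<close>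

theorem ex_stable_subordinator:
  assumes \<alpha>: "0 < \<alpha>" "\<alpha> < 1"
  obtains \<mu> where "real_distribution \<mu>" "AE w in \<mu>. 0 < w"
    "\<And>l. 0 \<le> l \<Longrightarrow> (\<integral>w. exp (- l * w) \<partial>\<mu>) = exp (- (l powr \<alpha>))"
proof -
  obtain r \<mu> where r: "strict_mono (r :: nat \<Rightarrow> nat)" and \<mu>: "real_distribution \<mu>"
    and conv: "weak_conv_m (sibuya_distr \<alpha> \<circ> id \<circ> r) \<mu>"
    using tight_imp_convergent_subsubsequence[OF tight_sibuya_distr[OF \<alpha>], of id]
    by (auto simp: strict_mono_def)
  interpret real_distribution \<mu> by (rule \<mu>)
  have lap: "(\<integral>w. exp (- l * max w 0) \<partial>\<mu>) = exp (- (l powr \<alpha>))" if l: "0 < l" for l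
  proof (rule LIMSEQ_unique)
    show "(\<lambda>k. \<integral>w. exp (- l * max w 0) \<partial>((sibuya_distr \<alpha> \<circ> id \<circ> r) k)) \<longlonglongrightarrow> (\<integral>w. exp (- l * max w 0) \<partial>\<mu>)"
    proof (rule weak_conv_imp_integral_bdd_continuous_conv[OF _ \<mu> conv])
      show "isCont (\<lambda>w. exp (- l * max w 0)) x" for x :: real
        by (intro continuous_intros)
      show "norm (exp (- l * max w 0)) \<le> 1" for w
        using l by (simp add: mult_nonneg_nonneg)
    qed (simp add: real_distribution_sibuya_distr)
    show "(\<lambda>k. \<integral>w. exp (- l * max w 0) \<partial>((sibuya_distr \<alpha> \<circ> id \<circ> r) k)) \<longlonglongrightarrow> exp (- (l powr \<alpha>))"
      using LIMSEQ_subseq_LIMSEQ[OF sibuya_laplace_tendsto[OF \<alpha> l] r]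
      unfolding o_def id_def integral_sibuya_distr[OF \<alpha> l] .
  qed
  \<comment> \<open>The mass at or below 0 is a lower bound for the Laplace transform at every l,
    and the transform tends to 0 as l grows.\<close>
  have "measure \<mu> {..0} \<le> exp (- (l powr \<alpha>))" if l: "0 < l" for l
  proof -
    have "measure \<mu> {..0} = (\<integral>w. indicator {..0} w \<partial>\<mu>)" by simp
    also have "\<dots> \<le> (\<integral>w. exp (- l * max w 0) \<partial>\<mu>)"
    proof (rule integral_mono)
      show "integrable \<mu> (indicator {..0} :: real \<Rightarrow> real)"
        by (intro integrable_const_bound[of _ 1]) (auto simp: indicator_def)
      show "integrable \<mu> (\<lambda>w. exp (- l * max w 0))"
        using l by (intro integrable_const_bound[of _ 1]) (auto simp: mult_nonneg_nonneg)
    qed (auto simp: indicator_def max_def)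
    finally show ?thesis using lap[OF l] by simp
  qed
  moreover have "((\<lambda>l. exp (- (l powr \<alpha>))) \<longlongrightarrow> 0) at_top"
    using \<alpha> by real_asymp
  ultimately have "measure \<mu> {..0} \<le> 0"
    by (intro tendsto_lowerbound[of "\<lambda>l. exp (- (l powr \<alpha>))" 0 at_top]) (auto intro: eventually_mono[OF eventually_gt_at_top[of 0]])
  then have "measure \<mu> {..0} = 0" using measure_nonneg[of \<mu> "{..0}"] by linarith
  then have pos: "AE w in \<mu>. 0 < w"
    by (intro AE_I[of _ _ "{..0}"]) (auto simp: emeasure_eq_measure)
  show ?thesis
  proof (rule that[OF \<mu> pos])
    fix l :: real assume "0 \<le> l"
    have "(\<integral>w. exp (- l * w) \<partial>\<mu>) = (\<integral>w. exp (- l * max w 0) \<partial>\<mu>)"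
    proof (rule integral_cong_AE)
      show "AE w in \<mu>. exp (- l * w) = exp (- l * max w 0)"
        using pos by eventually_elim simp
    qed measurable
    then show "(\<integral>w. exp (- l * w) \<partial>\<mu>) = exp (- (l powr \<alpha>))"
      using lap[of l] \<open>0 \<le> l\<close> prob_space by (cases "l = 0") auto
  qed
qed

section \<open>Subordination and regularity in time\<close>

text \<open>The exponential increases with the time, so the ratio of the two dimensional factors is
  the only loss.\<close>

lemma gauss_kernel_scale_le:
  fixes z :: "'a::euclidean_space"
  assumes "0 < u" "u \<le> v"
  shows "sqrt (u / v) ^ DIM('a) * gauss_kernel u z \<le> gauss_kernel v z"
proof -
  have "sqrt (u / v) * (1 / sqrt (4 * pi * u)) = 1 / sqrt (4 * pi * v)"
    using assms by (simp add: real_sqrt_mult real_sqrt_divide)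
  then have "sqrt (u / v) ^ DIM('a) * (1 / sqrt (4 * pi * u)) ^ DIM('a) = (1 / sqrt (4 * pi * v)) ^ DIM('a)"
    by (simp only: flip: power_mult_distrib)
  moreover have "exp (- (norm z)\<^sup>2 / (4 * u)) \<le> exp (- (norm z)\<^sup>2 / (4 * v))"
    using assms by (auto intro!: divide_left_mono)
  ultimately show ?thesis
    using assms unfolding gauss_kernel_def mult.assoc[symmetric] by (auto intro!: mult_left_mono)
qed

lemma integrable_norm_power2_gauss_kernel_diff:
  fixes u v :: real
  assumes u: "0 < u" and v: "0 < v"
  shows "integrable lborel (\<lambda>z::'a::euclidean_space. (norm z)\<^sup>2 * \<bar>gauss_kernel v z - gauss_kernel u z\<bar>)"
proof (rule Bochner_Integration.integrable_bound)
  show "integrable lborel (\<lambda>z::'a. (norm z)\<^sup>2 * gauss_kernel v z + (norm z)\<^sup>2 * gauss_kernel u z)"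
    by (intro Bochner_Integration.integrable_add integrable_norm_power2_gauss_kernel u v)
  show "AE z::'a in lborel. norm ((norm z)\<^sup>2 * \<bar>gauss_kernel v z - gauss_kernel u z\<bar>) \<le>
      norm ((norm z)\<^sup>2 * gauss_kernel v z + (norm z)\<^sup>2 * gauss_kernel u z)"
  proof (intro AE_I2)
    fix z :: 'a
    have "\<bar>gauss_kernel v z - gauss_kernel u z\<bar> \<le> gauss_kernel v z + gauss_kernel u z"
      using gauss_kernel_nonneg[of u z] gauss_kernel_nonneg[of v z] u v by linarith
    then have "(norm z)\<^sup>2 * \<bar>gauss_kernel v z - gauss_kernel u z\<bar> \<le> (norm z)\<^sup>2 * (gauss_kernel v z + gauss_kernel u z)"
      by (intro mult_left_mono) auto
    then show "norm ((norm z)\<^sup>2 * \<bar>gauss_kernel v z - gauss_kernel u z\<bar>) \<le>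
      norm ((norm z)\<^sup>2 * gauss_kernel v z + (norm z)\<^sup>2 * gauss_kernel u z)"
      by (simp add: distrib_left abs_mult)
  qed
qed measurable

text \<open>
  Subtracting \<open>sqrt (u / v) ^ DIM('a)\<close> times the earlier kernel from the later one leaves a nonnegative
  function, so the absolute moments of the difference are differences of moments.
\<close>

lemma
  fixes u v :: real
  assumes u: "0 < u" "u \<le> v"
  shows integral_gauss_kernel_diff_le:
      "(\<integral>(z::'a::euclidean_space). \<bar>gauss_kernel v z - gauss_kernel u z\<bar> \<partial>lborel)
        \<le> 2 * real DIM('a) * (1 - u / v)" (is ?A)
    and integral_norm_power2_gauss_kernel_diff_le:
      "(\<integral>(z::'a). (norm z)\<^sup>2 * \<bar>gauss_kernel v z - gauss_kernel u z\<bar> \<partial>lborel)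
        \<le> 2 * real DIM('a) * (2 * real DIM('a) + 1) * v * (1 - u / v)" (is ?B)
proof -
  define s where "s = sqrt (u / v) ^ DIM('a)"
  have v: "0 < v" using u by simp
  have x: "0 < u / v" "u / v \<le> 1" using u v by auto
  have sx: "0 < sqrt (u / v)" "sqrt (u / v) \<le> 1" "u / v \<le> sqrt (u / v)"
    using x power_decreasing[of 1 2 "u / v"] by (auto simp del: real_sqrt_divide intro!: real_le_rsqrt)
  have s: "0 \<le> s" "s \<le> 1" using sx by (auto simp: s_def power_le_one simp del: real_sqrt_divide)
  \<comment> \<open>Bernoulli's inequality turns the power into the factor \<open>DIM('a)\<close>,
    and a number in [0, 1] is at most its square root, so the root may be dropped.\<close>
  have "1 + real DIM('a) * (sqrt (u / v) - 1) \<le> (1 + (sqrt (u / v) - 1)) ^ DIM('a)"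
    using sx by (intro Bernoulli_inequality) auto
  then have "1 - s \<le> real DIM('a) * (1 - sqrt (u / v))"
    by (simp add: s_def algebra_simps)
  also have "\<dots> \<le> real DIM('a) * (1 - u / v)"
    using sx by (intro mult_left_mono) auto
  finally have s1: "1 - s \<le> real DIM('a) * (1 - u / v)" .
  let ?k = "\<lambda>(z::'a). (gauss_kernel v z - s * gauss_kernel u z) + (1 - s) * gauss_kernel u z"
  have le: "\<bar>gauss_kernel v z - gauss_kernel u z\<bar> \<le> ?k z" for z :: 'a
  proof -
    have "0 \<le> (1 - s) * gauss_kernel u z" using s u by simp
    moreover have "s * gauss_kernel u z \<le> gauss_kernel v z"
      unfolding s_def by (rule gauss_kernel_scale_le[OF u])
    ultimately show ?thesis by (simp add: algebra_simps)
  qed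
  note int = integrable_gauss_kernel[OF u(1), where 'a='a] integrable_gauss_kernel[OF v, where 'a='a]
    integrable_norm_power2_gauss_kernel[OF u(1), where 'a='a] integrable_norm_power2_gauss_kernel[OF v, where 'a='a]
  have "(\<integral>(z::'a). \<bar>gauss_kernel v z - gauss_kernel u z\<bar> \<partial>lborel) \<le> (\<integral>z. ?k z \<partial>lborel)"
    using int le by (intro integral_mono) auto
  also have "\<dots> = 2 * (1 - s)"
    using int u v by (simp add: integral_gauss_kernel)
  also have "\<dots> \<le> 2 * real DIM('a) * (1 - u / v)"
    using s1 by simp
  finally show ?A .
  have "(\<integral>(z::'a). (norm z)\<^sup>2 * \<bar>gauss_kernel v z - gauss_kernel u z\<bar> \<partial>lborel) \<le>
    (\<integral>(z::'a). ((norm z)\<^sup>2 * gauss_kernel v z - s * ((norm z)\<^sup>2 * gauss_kernel u z)) + (1 - s) * ((norm z)\<^sup>2 * gauss_kernel u z) \<partial>lborel)"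
  proof (intro integral_mono)
    show "integrable lborel (\<lambda>z::'a. (norm z)\<^sup>2 * \<bar>gauss_kernel v z - gauss_kernel u z\<bar>)"
      by (rule integrable_norm_power2_gauss_kernel_diff[OF u(1) v])
    show "(norm z)\<^sup>2 * \<bar>gauss_kernel v z - gauss_kernel u z\<bar> \<le> ((norm z)\<^sup>2 * gauss_kernel v z - s * ((norm z)\<^sup>2 * gauss_kernel u z)) + (1 - s) * ((norm z)\<^sup>2 * gauss_kernel u z)" for z :: 'a
      using mult_left_mono[OF le[of z], of "(norm z)\<^sup>2"] by (simp add: algebra_simps)
  qed (use int in auto)
  also have "\<dots> = 2 * real DIM('a) * v - s * (2 * real DIM('a) * u) + (1 - s) * (2 * real DIM('a) * u)"
    using int u v by (simp add: integral_norm_power2_gauss_kernel)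
  also have "\<dots> = 2 * real DIM('a) * (v - u + 2 * (u * (1 - s)))"
    by (simp add: algebra_simps)
  also have "\<dots> \<le> 2 * real DIM('a) * (v - u + 2 * (v * (real DIM('a) * (1 - u / v))))"
    using u v s s1 by (intro mult_left_mono add_left_mono mult_mono) auto
  also have "\<dots> = 2 * real DIM('a) * (2 * real DIM('a) + 1) * v * (1 - u / v)"
    using v by (simp add: field_simps)
  finally show ?B .
qed

section \<open>Increments of the heat semigroup in time\<close>

definition heat :: "real \<Rightarrow> ('a::euclidean_space \<Rightarrow> complex) \<Rightarrow> 'a \<Rightarrow> complex" where
  "heat u f x = (\<integral>y. complex_of_real (gauss_kernel u (x - y)) * f y \<partial>lborel)"

lemma heat_measurable:
  assumes [measurable]: "f \<in> borel_measurable borel"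
  shows "(\<lambda>u. heat u f x) \<in> borel_measurable borel"
  unfolding heat_def by measurable

lemma gauss_kernel_le: "0 < u \<Longrightarrow> gauss_kernel u (z::'a::euclidean_space) \<le> (1 / sqrt (4 * pi * u)) ^ DIM('a)"
  unfolding gauss_kernel_def by (rule mult_left_le) auto

lemma integrable_gauss_kernel_mult:
  assumes u: "0 < u" and f: "integrable lborel f"
  shows "integrable lborel (\<lambda>y::'a::euclidean_space. complex_of_real (gauss_kernel u (x - y)) * f y)"
proof (rule Bochner_Integration.integrable_bound)
  show "integrable lborel (\<lambda>y. (1 / sqrt (4 * pi * u)) ^ DIM('a) * norm (f y))"
    using f by auto
  show "AE y in lborel. norm (complex_of_real (gauss_kernel u (x - y)) * f y) \<le> norm ((1 / sqrt (4 * pi * u)) ^ DIM('a) * norm (f y))"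
    using u by (intro AE_I2) (simp add: norm_mult abs_mult mult_right_mono gauss_kernel_le del: power_divide)
qed (use f in measurable)

text \<open>The weight w has two uses: w = 1 gives the general bound, and the squared distance
  divided by \<open>\<rho>^2\<close>, which is at least 1 wherever a function vanishing near x can
  be nonzero, brings in the second moment.\<close>

lemma norm_heat_diff_le:
  fixes f :: "'a::euclidean_space \<Rightarrow> complex"
  assumes u: "0 < u" "u \<le> v" and f: "integrable lborel f" and M: "0 \<le> M"
    and fw: "\<And>y. norm (f y) \<le> M * w (y - x)" and [measurable]: "w \<in> borel_measurable borel" and w: "\<And>z. 0 \<le> w z"
    and int: "integrable lborel (\<lambda>z. w z * \<bar>gauss_kernel v z - gauss_kernel u z\<bar>)"
  shows "norm (heat v f x - heat u f x) \<le> M * (\<integral>z. w z * \<bar>gauss_kernel v z - gauss_kernel u z\<bar> \<partial>lborel)"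
proof -
  have v: "0 < v" using u by simp
  let ?k = "\<lambda>z. M * (w z * \<bar>gauss_kernel v z - gauss_kernel u z\<bar>)"
  have "heat v f x - heat u f x = (\<integral>y. (gauss_kernel v (x - y) - gauss_kernel u (x - y)) * f y \<partial>lborel)"
    unfolding heat_def
    by (subst Bochner_Integration.integral_diff[symmetric])
       (simp_all add: integrable_gauss_kernel_mult u v f left_diff_distrib)
  then have "ennreal (norm (heat v f x - heat u f x)) \<le> (\<integral>\<^sup>+y. norm ((gauss_kernel v (x - y) - gauss_kernel u (x - y)) * f y) \<partial>lborel)"
    by (simp only: norm_integral_le_nn_integral)
  also have "\<dots> \<le> (\<integral>\<^sup>+y. ennreal (?k (y - x)) \<partial>lborel)"
  proof (intro nn_integral_mono ennreal_leI)
    fix y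
    have "norm ((gauss_kernel v (x - y) - gauss_kernel u (x - y)) * f y) = \<bar>gauss_kernel v (y - x) - gauss_kernel u (y - x)\<bar> * norm (f y)"
      by (simp add: norm_mult gauss_kernel_minus_commute[of _ x] flip: of_real_diff)
    also have "\<dots> \<le> \<bar>gauss_kernel v (y - x) - gauss_kernel u (y - x)\<bar> * (M * w (y - x))"
      by (intro mult_left_mono fw) auto
    finally show "norm ((gauss_kernel v (x - y) - gauss_kernel u (x - y)) * f y) \<le> ?k (y - x)"
      by (simp add: ac_simps)
  qed
  also have "\<dots> = (\<integral>\<^sup>+z. ennreal (?k z) \<partial>lborel)"
    by (rule nn_integral_lborel_diff[of "\<lambda>z. ennreal (?k z)"]) measurable
  also have "\<dots> = ennreal (\<integral>z. ?k z \<partial>lborel)"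
    using int M w by (intro nn_integral_eq_integral) auto
  also have "(\<integral>z. ?k z \<partial>lborel) = M * (\<integral>z. w z * \<bar>gauss_kernel v z - gauss_kernel u z\<bar> \<partial>lborel)"
    by simp
  finally show ?thesis
    using M w by (subst (asm) ennreal_le_iff) (auto intro!: mult_nonneg_nonneg integral_nonneg_AE)
qed

text \<open>The off-diagonal bound linear in the time cannot be averaged over a stable subordinator,
  whose mean is infinite, so it is truncated by the general bound. The right side replaces this
  minimum because its average is given by the Laplace transform.\<close>

lemma min_le_exp: "0 \<le> y \<Longrightarrow> min 1 y \<le> 2 * (1 - exp (- y))" for y :: real
proof -
  assume y: "0 \<le> y"
  have "exp (- y) \<le> 1 / (1 + y)"
    using exp_ge_add_one_self[of y] y by (simp add: exp_minus divide_simps)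
  moreover have "1 / (1 + y) \<le> 1 - min 1 y / 2"
    using y by (cases "y \<le> 1") (auto simp: field_simps min_def mult_left_le)
  ultimately show ?thesis by simp
qed

text \<open>This is the constant of the second moment bound; it also dominates the constant
  \<open>2 * real DIM('a)\<close> of the bound for the total mass.\<close>

definition heat_const :: "'a::euclidean_space itself \<Rightarrow> real" where
  "heat_const _ = 2 * real DIM('a) * (2 * real DIM('a) + 1)"

lemma norm_heat_diff_le_bounded:
  fixes f :: "'a::euclidean_space \<Rightarrow> complex"
  assumes u: "0 < u" "u \<le> v" and f: "integrable lborel f" and M: "\<And>y. norm (f y) \<le> M"
  shows "norm (heat v f x - heat u f x) \<le> heat_const TYPE('a) * M * (1 - u / v)"
proof -
  have v: "0 < v" using u by simp
  have M0: "0 \<le> M" using M[of 0] norm_ge_zero order_trans by blast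
  have x: "0 \<le> 1 - u / v" using u v by simp
  have gen: "norm (heat v f x - heat u f x) \<le> M * (\<integral>(z::'a). \<bar>gauss_kernel v z - gauss_kernel u z\<bar> \<partial>lborel)"
  proof -
    have "norm (heat v f x - heat u f x) \<le> M * (\<integral>(z::'a). 1 * \<bar>gauss_kernel v z - gauss_kernel u z\<bar> \<partial>lborel)"
      using M integrable_gauss_kernel[OF u(1), where 'a='a] integrable_gauss_kernel[OF v, where 'a='a]
      by (intro norm_heat_diff_le[OF u f M0]) auto
    then show ?thesis by simp
  qed
  also have "\<dots> \<le> M * (2 * real DIM('a) * (1 - u / v))"
    by (intro mult_left_mono integral_gauss_kernel_diff_le u M0)
  also have "\<dots> \<le> M * (heat_const TYPE('a) * (1 - u / v))"
    using x M0 by (intro mult_left_mono mult_right_mono) (auto simp: heat_const_def field_simps)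
  finally show ?thesis by (simp add: ac_simps)
qed

lemma norm_heat_diff_le_off_diagonal:
  fixes f :: "'a::euclidean_space \<Rightarrow> complex"
  assumes u: "0 < u" "u \<le> v" and f: "integrable lborel f" and M: "\<And>y. norm (f y) \<le> M"
    and \<rho>: "0 < \<rho>" and f0: "\<And>y. norm (y - x) < \<rho> \<Longrightarrow> f y = 0"
  shows "norm (heat v f x - heat u f x) \<le> heat_const TYPE('a) * M * (1 - u / v) * (2 * (1 - exp (- (v / \<rho>\<^sup>2))))"
proof -
  have v: "0 < v" using u by simp
  have M0: "0 \<le> M" using M[of 0] norm_ge_zero order_trans by blast
  have x: "0 \<le> 1 - u / v" using u v by simp
  have int: "integrable lborel (\<lambda>z::'a. (norm z)\<^sup>2 * \<bar>gauss_kernel v z - gauss_kernel u z\<bar>)"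
    by (rule integrable_norm_power2_gauss_kernel_diff[OF u(1) v])
  have "norm (heat v f x - heat u f x) \<le> M * (\<integral>(z::'a). ((norm z)\<^sup>2 / \<rho>\<^sup>2) * \<bar>gauss_kernel v z - gauss_kernel u z\<bar> \<partial>lborel)"
  proof (intro norm_heat_diff_le[OF u f M0])
    show "norm (f y) \<le> M * ((norm (y - x))\<^sup>2 / \<rho>\<^sup>2)" for y
    proof (cases "norm (y - x) < \<rho>")
      case True
      then show ?thesis using f0 M0 by simp
    next
      case False
      then have "1 \<le> (norm (y - x))\<^sup>2 / \<rho>\<^sup>2" using \<rho> by (simp add: power_mono)
      then have "M * 1 \<le> M * ((norm (y - x))\<^sup>2 / \<rho>\<^sup>2)" using M0 by (intro mult_left_mono)
      then show ?thesis using M[of y] by linarith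
    qed
  qed (use int in auto)
  also have "\<dots> = M * ((\<integral>(z::'a). (norm z)\<^sup>2 * \<bar>gauss_kernel v z - gauss_kernel u z\<bar> \<partial>lborel) / \<rho>\<^sup>2)"
    by simp
  also have "\<dots> \<le> M * ((heat_const TYPE('a) * v * (1 - u / v)) / \<rho>\<^sup>2)"
    unfolding heat_const_def
    by (intro mult_left_mono divide_right_mono integral_norm_power2_gauss_kernel_diff_le u M0) auto
  also have "\<dots> = heat_const TYPE('a) * M * (1 - u / v) * (v / \<rho>\<^sup>2)" by simp
  finally have B: "norm (heat v f x - heat u f x) \<le> heat_const TYPE('a) * M * (1 - u / v) * (v / \<rho>\<^sup>2)" .
  have c: "0 \<le> heat_const TYPE('a) * M * (1 - u / v)"
    using x M0 by (simp add: heat_const_def)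
  have "norm (heat v f x - heat u f x) \<le> heat_const TYPE('a) * M * (1 - u / v) * min 1 (v / \<rho>\<^sup>2)"
    using norm_heat_diff_le_bounded[OF u f M] B by (simp add: min_def)
  also have "\<dots> \<le> heat_const TYPE('a) * M * (1 - u / v) * (2 * (1 - exp (- (v / \<rho>\<^sup>2))))"
    using v by (intro mult_left_mono min_le_exp c) auto
  finally show ?thesis .
qed

section \<open>From the Gaussian to the fractional semigroup\<close>

definition ift :: "('a::euclidean_space \<Rightarrow> complex) \<Rightarrow> 'a \<Rightarrow> complex" where
  "ift g x = (\<integral>\<xi>. cis (x \<bullet> \<xi>) * g \<xi> \<partial>lborel) / (2 * pi) ^ DIM('a)"

lemma ft_modulated_gaussian:
  assumes "0 < u"
  shows "ft (\<lambda>\<xi>::'a::euclidean_space. exp (- u * (norm \<xi>)\<^sup>2) * cis (\<xi> \<bullet> x)) y = (2 * pi) ^ DIM('a) * gauss_kernel u (x - y)"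
  unfolding ft_def integral_cis_gaussian[OF assms, symmetric]
  by (intro Bochner_Integration.integral_cong refl)
     (simp add: cis_mult inner_diff_right mult.left_commute mult.commute[of "cis _" "complex_of_real (exp _)"])

lemma heat_eq_ift:
  fixes f :: "'a::euclidean_space \<Rightarrow> complex"
  assumes u: "0 < u" and f: "integrable lborel f"
  shows "heat u f x = ift (\<lambda>\<xi>. exp (- u * (norm \<xi>)\<^sup>2) * ft f \<xi>) x"
proof -
  let ?e = "\<lambda>\<xi>::'a. complex_of_real (exp (- u * (norm \<xi>)\<^sup>2))"
  have "integrable lborel (\<lambda>\<xi>. ?e \<xi> * cis (\<xi> \<bullet> x))"
    using integrable_cis_gaussian[OF u, of x] by (simp add: mult.commute)
  from integral_mult_ft[OF this f]
  have "(\<integral>\<xi>. cis (x \<bullet> \<xi>) * (?e \<xi> * ft f \<xi>) \<partial>lborel) = (\<integral>y. f y * ((2 * pi) ^ DIM('a) * gauss_kernel u (x - y)) \<partial>lborel)"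
    unfolding ft_modulated_gaussian[OF u] by (simp add: ac_simps inner_commute)
  also have "\<dots> = (\<integral>y. (2 * pi) ^ DIM('a) * (gauss_kernel u (x - y) * f y) \<partial>lborel)"
    by (simp add: ac_simps)
  also have "\<dots> = (2 * pi) ^ DIM('a) * heat u f x"
    unfolding integral_mult_right_zero heat_def by simp
  finally show ?thesis by (simp add: ift_def)
qed

lemma integrable_exp_norm_powr_real:
  fixes c a :: real
  assumes c: "0 < c" and a: "0 < a"
  shows "integrable lborel (\<lambda>x::real. exp (- c * \<bar>x\<bar> powr a))"
proof -
  \<comment> \<open>With \<open>a * k\<close> at least 2, the square of x is at most the k-th power
    of \<open>\<bar>x\<bar> powr a\<close> once \<open>\<bar>x\<bar>\<close> is at least 1, and the
    k-th term of the exponential series absorbs that power. The two summands of K below are for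
    \<open>\<bar>x\<bar> \<le> 1\<close> and for the rest.\<close>
  define k where "k = nat \<lceil>2 / a\<rceil>"
  have k: "2 \<le> a * k"
  proof -
    have "2 / a \<le> k" unfolding k_def by linarith
    then show ?thesis using a by (simp add: field_simps)
  qed
  define K where "K = 2 + 2 * fact k / c ^ k"
  have "set_integrable lborel (einterval (- \<infinity>) \<infinity>) (\<lambda>x::real. inverse (1 + x\<^sup>2))"
    by (rule integrable_inverse_1_plus_square)
  then have "integrable lborel (\<lambda>x::real. inverse (1 + x\<^sup>2))"
    by (simp add: set_integrable_def)
  then have int: "integrable lborel (\<lambda>x::real. K * inverse (1 + x\<^sup>2))"
    by (rule integrable_mult_right)
  show ?thesis
  proof (rule Bochner_Integration.integrable_bound[OF int])
    show "AE x in lborel. norm (exp (- c * \<bar>x\<bar> powr a)) \<le> norm (K * inverse (1 + x\<^sup>2))"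
    proof (intro AE_I2)
      fix x :: real
      have "exp (- c * \<bar>x\<bar> powr a) * (1 + x\<^sup>2) \<le> K"
      proof (cases "\<bar>x\<bar> \<le> 1")
        case True
        then have "x\<^sup>2 \<le> 1" by (simp add: abs_square_le_1)
        moreover have "exp (- c * \<bar>x\<bar> powr a) \<le> 1" using c by simp
        ultimately have "exp (- c * \<bar>x\<bar> powr a) * (1 + x\<^sup>2) \<le> 1 * 2"
          by (intro mult_mono) auto
        also have "\<dots> \<le> K" using c by (simp add: K_def)
        finally show ?thesis .
      next
        case False
        define z where "z = c * \<bar>x\<bar> powr a"
        have z: "0 < z" using c False by (auto simp: z_def)
        have x2: "1 \<le> x\<^sup>2" using False by (simp add: abs_square_less_1 linorder_not_less[symmetric])
        have "x\<^sup>2 = \<bar>x\<bar> powr 2" using False by (simp add: powr_numeral)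
        also have "\<dots> \<le> \<bar>x\<bar> powr (a * k)" using False k by (intro powr_mono) auto
        also have "\<dots> = (\<bar>x\<bar> powr a) ^ k" using False by (simp add: powr_powr[symmetric] powr_realpow)
        finally have "c ^ k * x\<^sup>2 \<le> z ^ k"
          using c by (simp add: z_def power_mult_distrib)
        also have "\<dots> \<le> fact k * exp z"
        proof -
          have "(\<Sum>n\<in>{k}. z ^ n /\<^sub>R fact n) \<le> (\<Sum>n. z ^ n /\<^sub>R fact n)"
            using z by (intro sum_le_suminf summable_exp_generic) auto
          then show ?thesis by (simp add: exp_def field_simps)
        qed
        finally have "x\<^sup>2 \<le> fact k * exp z / c ^ k" using c by (simp add: field_simps)
        then have "exp (- z) * (2 * x\<^sup>2) \<le> exp (- z) * (2 * (fact k * exp z / c ^ k))"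
          by (intro mult_left_mono) auto
        also have "\<dots> = 2 * fact k / c ^ k" by (simp add: exp_minus field_simps)
        also have "\<dots> \<le> K" by (simp add: K_def)
        finally have A: "exp (- z) * (2 * x\<^sup>2) \<le> K" .
        have "exp (- z) * (1 + x\<^sup>2) \<le> exp (- z) * (2 * x\<^sup>2)" using x2 by (intro mult_left_mono) auto
        from order_trans[OF this A] show ?thesis by (simp add: z_def)
      qed
      moreover have "0 < 1 + x\<^sup>2" by (simp add: add_pos_nonneg)
      ultimately have "exp (- c * \<bar>x\<bar> powr a) \<le> K * inverse (1 + x\<^sup>2)"
        by (simp add: field_simps)
      then show "norm (exp (- c * \<bar>x\<bar> powr a)) \<le> norm (K * inverse (1 + x\<^sup>2))"
        by (simp add: abs_of_nonneg)
    qed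
  qed measurable
qed

lemma integrable_exp_norm_powr:
  fixes c a :: real
  assumes c: "0 < c" and a: "0 < a"
  shows "integrable lborel (\<lambda>x::'a::euclidean_space. exp (- c * norm x powr a))"
proof (rule Bochner_Integration.integrable_bound)
  \<comment> \<open>A coordinate is at most the norm; giving each one an equal share of c in the
    exponent dominates the integrand by a product of functions of one variable.\<close>
  have "0 < c / DIM('a)" using c by simp
  then show "integrable lborel (\<lambda>x::'a. \<Prod>b\<in>Basis. exp (- (c / DIM('a)) * \<bar>x \<bullet> b\<bar> powr a))"
    by (intro integrable_prod_Basis integrable_exp_norm_powr_real a)
  show "AE x::'a in lborel. norm (exp (- c * norm x powr a)) \<le> norm (\<Prod>b\<in>Basis. exp (- (c / DIM('a)) * \<bar>x \<bullet> b\<bar> powr a))"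
  proof (intro AE_I2)
    fix x :: 'a
    have "(\<Sum>b\<in>Basis. (c / DIM('a)) * \<bar>x \<bullet> b\<bar> powr a) \<le> (\<Sum>b\<in>(Basis::'a set). (c / DIM('a)) * norm x powr a)"
      using c a by (intro sum_mono mult_left_mono powr_mono2 Basis_le_norm) auto
    also have "\<dots> = c * norm x powr a" by simp
    finally have "exp (- (c * norm x powr a)) \<le> exp (- (\<Sum>b\<in>Basis. (c / DIM('a)) * \<bar>x \<bullet> b\<bar> powr a))" by simp
    also have "\<dots> = (\<Prod>b\<in>Basis. exp (- (c / DIM('a)) * \<bar>x \<bullet> b\<bar> powr a))"
      by (simp add: sum_negf flip: exp_sum)
    finally show "norm (exp (- c * norm x powr a)) \<le> norm (\<Prod>b\<in>Basis. exp (- (c / DIM('a)) * \<bar>x \<bullet> b\<bar> powr a))"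
      by (simp add: prod_nonneg)
  qed
qed measurable

definition fheat :: "real \<Rightarrow> real \<Rightarrow> ('a::euclidean_space \<Rightarrow> complex) \<Rightarrow> 'a \<Rightarrow> complex" where
  "fheat \<alpha> t f = ift (\<lambda>\<xi>. exp (- t * norm \<xi> powr (2 * \<alpha>)) * ft f \<xi>)"

text \<open>With s = \<open>t powr (1 / \<alpha>)\<close>, the Laplace transform of the subordinator
  at s times the squared norm of \<open>\<xi>\<close> is the fractional symbol at time t. Fubini's
  theorem exchanges this average with the inverse transform.\<close>

lemma fheat_subordination:
  fixes f :: "'a::euclidean_space \<Rightarrow> complex"
  assumes \<alpha>: "0 < \<alpha>" "\<alpha> < 1" and t: "0 < t" and f: "integrable lborel f"
    and \<mu>: "real_distribution \<mu>" "AE w in \<mu>. 0 < w"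
    and lap: "\<And>l. 0 \<le> l \<Longrightarrow> (\<integral>w. exp (- l * w) \<partial>\<mu>) = exp (- (l powr \<alpha>))"
  shows "fheat \<alpha> t f x = (\<integral>w. heat (t powr (1 / \<alpha>) * w) f x \<partial>\<mu>)"
proof -
  interpret \<mu>: real_distribution \<mu> by (rule \<mu>)
  interpret pair_sigma_finite \<mu> "lborel :: 'a measure" by standard
  have [measurable]: "f \<in> borel_measurable borel" using f by auto
  define s where "s = t powr (1 / \<alpha>)"
  have s: "0 < s" using t by (simp add: s_def)
  have e: "(\<integral>w. exp (- (s * max w 0) * (norm \<xi>)\<^sup>2) \<partial>\<mu>) = exp (- t * norm \<xi> powr (2 * \<alpha>))" for \<xi> :: 'a
  proof -
    have "(\<integral>w. exp (- (s * max w 0) * (norm \<xi>)\<^sup>2) \<partial>\<mu>) = (\<integral>w. exp (- (s * (norm \<xi>)\<^sup>2) * w) \<partial>\<mu>)"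
    proof (rule integral_cong_AE)
      show "AE w in \<mu>. exp (- (s * max w 0) * (norm \<xi>)\<^sup>2) = exp (- (s * (norm \<xi>)\<^sup>2) * w)"
        using \<mu>(2) by eventually_elim simp
    qed measurable
    also have "\<dots> = exp (- ((s * (norm \<xi>)\<^sup>2) powr \<alpha>))"
      using s by (intro lap) simp
    also have "(s * (norm \<xi>)\<^sup>2) powr \<alpha> = t * norm \<xi> powr (2 * \<alpha>)"
    proof -
      have "(norm \<xi>)\<^sup>2 powr \<alpha> = norm \<xi> powr (2 * \<alpha>)"
        by (cases "\<xi> = 0") (simp_all add: powr_powr flip: powr_numeral)
      then show ?thesis using \<alpha> t by (simp add: s_def powr_mult powr_powr)
    qed
    finally show ?thesis by simp
  qed
  have ei: "integrable \<mu> (\<lambda>w. exp (- (s * max w 0) * (norm \<xi>)\<^sup>2))" for \<xi> :: 'a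
    using s by (intro \<mu>.integrable_const_bound[of _ 1]) (auto intro!: AE_I2 mult_nonneg_nonneg)
  \<comment> \<open>Writing \<open>max w 0\<close> keeps the exponential at most 1 for every w and
    not merely almost every one; it changes the integrand on a null set only.\<close>
  let ?F = "\<lambda>w \<xi>. cis (x \<bullet> \<xi>) * (complex_of_real (exp (- (s * max w 0) * (norm \<xi>)\<^sup>2)) * ft f \<xi>)"
  have int: "integrable (lborel \<Otimes>\<^sub>M \<mu>) (\<lambda>(\<xi>, w). ?F w \<xi>)"
  proof (rule pair_sigma_finite.Fubini_integrable)
    show "pair_sigma_finite (lborel :: 'a measure) \<mu>" by standard
    show "(\<lambda>(\<xi>, w). ?F w \<xi>) \<in> borel_measurable (lborel \<Otimes>\<^sub>M \<mu>)" by measurable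
    have "(\<integral>w. norm (?F w \<xi>) \<partial>\<mu>) = exp (- t * norm \<xi> powr (2 * \<alpha>)) * norm (ft f \<xi>)" for \<xi>
    proof -
      have "norm (?F w \<xi>) = exp (- (s * max w 0) * (norm \<xi>)\<^sup>2) * norm (ft f \<xi>)" for w
        by (simp add: norm_mult)
      then show ?thesis by (simp only: integral_mult_left_zero e)
    qed
    moreover have "integrable lborel (\<lambda>\<xi>::'a. exp (- t * norm \<xi> powr (2 * \<alpha>)) * norm (ft f \<xi>))"
    proof (rule Bochner_Integration.integrable_bound)
      show "integrable lborel (\<lambda>\<xi>::'a. exp (- t * norm \<xi> powr (2 * \<alpha>)) * (\<integral>x. norm (f x) \<partial>lborel))"
        using t \<alpha> by (intro integrable_mult_left integrable_exp_norm_powr) auto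
    qed (auto simp: norm_ft_le f abs_mult intro!: mult_left_mono order_trans[OF norm_ft_le[OF f]])
    ultimately show "integrable lborel (\<lambda>\<xi>. \<integral>w. norm (case (\<xi>, w) of (\<xi>, w) \<Rightarrow> ?F w \<xi>) \<partial>\<mu>)"
      by simp
    show "AE \<xi> in lborel. integrable \<mu> (\<lambda>w. case (\<xi>, w) of (\<xi>, w) \<Rightarrow> ?F w \<xi>)"
      using ei by (intro AE_I2) (simp only: prod.case integrable_mult_right integrable_mult_left integrable_of_real)
  qed
  have "(\<integral>w. heat (s * w) f x \<partial>\<mu>) = (\<integral>w. (\<integral>\<xi>. ?F w \<xi> \<partial>lborel) / (2 * pi) ^ DIM('a) \<partial>\<mu>)"
  proof (rule integral_cong_AE)
    show "(\<lambda>w. heat (s * w) f x) \<in> borel_measurable \<mu>"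
      using heat_measurable[of f x] by measurable
    show "(\<lambda>w. (\<integral>\<xi>. ?F w \<xi> \<partial>lborel) / (2 * pi) ^ DIM('a)) \<in> borel_measurable \<mu>"
      by measurable
    show "AE w in \<mu>. heat (s * w) f x = (\<integral>\<xi>. ?F w \<xi> \<partial>lborel) / (2 * pi) ^ DIM('a)"
      using \<mu>(2)
    proof eventually_elim
      case (elim w)
      then show ?case using s by (subst heat_eq_ift) (auto simp: f ift_def)
    qed
  qed
  also have "\<dots> = (\<integral>w. (\<integral>\<xi>. ?F w \<xi> \<partial>lborel) \<partial>\<mu>) / (2 * pi) ^ DIM('a)"
    by simp
  also have "(\<integral>w. (\<integral>\<xi>. ?F w \<xi> \<partial>lborel) \<partial>\<mu>) = (\<integral>\<xi>. (\<integral>w. ?F w \<xi> \<partial>\<mu>) \<partial>lborel)"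
    using pair_sigma_finite.Fubini_integral[OF _ int] by (simp add: pair_sigma_finite_def \<mu>.sigma_finite_measure_axioms sigma_finite_lborel)
  also have "\<dots> = (\<integral>\<xi>. cis (x \<bullet> \<xi>) * (exp (- t * norm \<xi> powr (2 * \<alpha>)) * ft f \<xi>) \<partial>lborel)"
  proof (intro Bochner_Integration.integral_cong refl)
    fix \<xi> :: 'a
    show "(\<integral>w. ?F w \<xi> \<partial>\<mu>) = cis (x \<bullet> \<xi>) * (exp (- t * norm \<xi> powr (2 * \<alpha>)) * ft f \<xi>)"
      unfolding integral_mult_right_zero integral_mult_left_zero integral_complex_of_real e ..
  qed
  finally show ?thesis by (simp add: fheat_def ift_def s_def)
qed

text \<open>The weighted mean inequality for \<open>x powr b\<close> and 1 with the weights
  \<open>1 / b\<close> and \<open>1 - 1 / b\<close>. It allows relative gaps of times to be compared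
  with relative gaps of powers of the times.\<close>

lemma one_minus_powr_le:
  fixes x b :: real
  assumes "0 < x" "1 \<le> b"
  shows "1 - x powr b \<le> b * (1 - x)"
proof -
  have "(x powr b) powr (1 / b) * 1 powr (1 - 1 / b) \<le> (1 / b) * (x powr b) + (1 - 1 / b) * 1"
    using assms by (intro Youngs_inequality_0) auto
  then have "b * x \<le> b * (1 / b * (x powr b) + (1 - 1 / b))"
    using assms by (intro mult_left_mono) (auto simp: powr_powr)
  also have "\<dots> = x powr b + (b - 1)"
    using assms by (simp add: distrib_left right_diff_distrib)
  finally show ?thesis by (simp add: right_diff_distrib)
qed

text \<open>The relative gap of two subordinated times does not depend on w, so the first Gaussian
  bound survives averaging unchanged. In the second one the factor with the exponential averages to
  \<open>1 - exp (- (t' / \<rho> powr (2 * \<alpha>)))\<close>, which is at most the exponent;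
  multiplying t' by the relative gap then leaves \<open>t' - t\<close>.\<close>

lemma
  fixes f :: "'a::euclidean_space \<Rightarrow> complex"
  assumes \<alpha>: "0 < \<alpha>" "\<alpha> < 1" and t: "0 < t" "t \<le> t'" and f: "integrable lborel f" and M: "\<And>y. norm (f y) \<le> M"
  shows norm_fheat_diff_le: "norm (fheat \<alpha> t' f x - fheat \<alpha> t f x) \<le> heat_const TYPE('a) * M / \<alpha> * (1 - t / t')" (is ?A)
    and norm_fheat_diff_le_off_diagonal: "0 < \<rho> \<and> (\<forall>y. norm (y - x) < \<rho> \<longrightarrow> f y = 0) \<longrightarrow>
      norm (fheat \<alpha> t' f x - fheat \<alpha> t f x) \<le> 2 * heat_const TYPE('a) * M / \<alpha> * (t' - t) / \<rho> powr (2 * \<alpha>)" (is "?P \<longrightarrow> ?B")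
proof -
  obtain \<mu> where \<mu>: "real_distribution \<mu>" "AE w in \<mu>. 0 < w"
    and lap: "\<And>l. 0 \<le> l \<Longrightarrow> (\<integral>w. exp (- l * w) \<partial>\<mu>) = exp (- (l powr \<alpha>))"
    using ex_stable_subordinator[OF \<alpha>] by blast
  interpret \<mu>: real_distribution \<mu> by (rule \<mu>)
  have [measurable]: "f \<in> borel_measurable borel" using f by auto
  have t': "0 < t'" using t by simp
  define s s' where "s = t powr (1 / \<alpha>)" and "s' = t' powr (1 / \<alpha>)"
  have s: "0 < s" "s \<le> s'" "0 < s'" using t t' \<alpha> by (auto simp: s_def s'_def intro: powr_mono2)
  have M0: "0 \<le> M" using M[of 0] norm_ge_zero order_trans by blast
  let ?c = "heat_const TYPE('a) * M"
  have c0: "0 \<le> ?c" using M0 by (simp add: heat_const_def)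
  have ratio: "1 - s / s' \<le> (1 - t / t') / \<alpha>"
  proof -
    have "s / s' = (t / t') powr (1 / \<alpha>)" using t by (simp add: s_def s'_def powr_divide)
    then show ?thesis using one_minus_powr_le[of "t / t'" "1 / \<alpha>"] t \<alpha> by simp
  qed
  have meas: "(\<lambda>w. heat (r * w) f x) \<in> borel_measurable \<mu>" for r
    using heat_measurable[of f x] by measurable
  have bound: "AE w in \<mu>. norm (heat (r * w) f x) \<le> M" if r: "0 < r" for r
    using \<mu>(2)
  proof eventually_elim
    case (elim w)
    have "ennreal (norm (heat (r * w) f x)) \<le> (\<integral>\<^sup>+y. norm (gauss_kernel (r * w) (x - y) * f y) \<partial>lborel)"
      unfolding heat_def by (rule norm_integral_le_nn_integral)
    also have "\<dots> \<le> (\<integral>\<^sup>+y. ennreal M * gauss_kernel (r * w) (x - y) \<partial>lborel)"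
      using M elim r M0 by (intro nn_integral_mono) (auto simp: norm_mult mult.commute mult_right_mono intro!: ennreal_leI simp flip: ennreal_mult)
    also have "\<dots> = ennreal M" using elim r by (simp add: nn_integral_cmult nn_integral_gauss_kernel)
    finally show ?case using M0 by simp
  qed
  have int: "integrable \<mu> (\<lambda>w. heat (r * w) f x)" if r: "0 < r" for r
    using bound[OF r] meas by (intro \<mu>.integrable_const_bound)
  have eq: "fheat \<alpha> t' f x - fheat \<alpha> t f x = (\<integral>w. heat (s' * w) f x - heat (s * w) f x \<partial>\<mu>)"
    using int s unfolding s_def s'_def
    by (simp add: fheat_subordination[OF \<alpha> t(1) f \<mu> lap] fheat_subordination[OF \<alpha> t' f \<mu> lap])
  have "norm (fheat \<alpha> t' f x - fheat \<alpha> t f x) \<le> (\<integral>w. norm (heat (s' * w) f x - heat (s * w) f x) \<partial>\<mu>)"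
    unfolding eq by (rule integral_norm_bound)
  also have "\<dots> \<le> (\<integral>w. ?c * (1 - s / s') \<partial>\<mu>)"
  proof (intro integral_mono_AE)
    show "AE w in \<mu>. norm (heat (s' * w) f x - heat (s * w) f x) \<le> ?c * (1 - s / s')"
      using \<mu>(2)
    proof eventually_elim
      case (elim w)
      then show ?case using norm_heat_diff_le_bounded[of "s * w" "s' * w" f M x] s f M by simp
    qed
  qed (use int s in auto)
  also have "\<dots> = ?c * (1 - s / s')" using \<mu>.prob_space by simp
  also have "\<dots> \<le> ?c * ((1 - t / t') / \<alpha>)" by (intro mult_left_mono ratio c0)
  finally show ?A by simp
  show "?P \<longrightarrow> ?B"
  proof
    assume ?P
    then have \<rho>: "0 < \<rho>" and f0: "\<And>y. norm (y - x) < \<rho> \<Longrightarrow> f y = 0" by auto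
    have expint: "integrable \<mu> (\<lambda>w. exp (- (s' / \<rho>\<^sup>2) * w))"
      using \<mu>(2) s \<rho> by (intro \<mu>.integrable_const_bound[of _ 1]) (auto elim!: eventually_mono)
    have "norm (fheat \<alpha> t' f x - fheat \<alpha> t f x) \<le> (\<integral>w. norm (heat (s' * w) f x - heat (s * w) f x) \<partial>\<mu>)"
      unfolding eq by (rule integral_norm_bound)
    also have "\<dots> \<le> (\<integral>w. ?c * (1 - s / s') * (2 * (1 - exp (- (s' / \<rho>\<^sup>2) * w))) \<partial>\<mu>)"
    proof (intro integral_mono_AE)
      show "AE w in \<mu>. norm (heat (s' * w) f x - heat (s * w) f x) \<le> ?c * (1 - s / s') * (2 * (1 - exp (- (s' / \<rho>\<^sup>2) * w)))"
        using \<mu>(2)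
      proof eventually_elim
        case (elim w)
        then show ?case using norm_heat_diff_le_off_diagonal[of "s * w" "s' * w" f M \<rho> x] s f M f0 \<rho> by simp
      qed
    qed (use int s expint in auto)
    also have "\<dots> = ?c * (1 - s / s') * (2 * (1 - exp (- ((s' / \<rho>\<^sup>2) powr \<alpha>))))"
      using expint s lap[of "s' / \<rho>\<^sup>2"] \<mu>.prob_space by simp
    also have "(s' / \<rho>\<^sup>2) powr \<alpha> = t' / \<rho> powr (2 * \<alpha>)"
      using \<rho> t' \<alpha> by (simp add: s'_def powr_divide powr_powr flip: powr_numeral)
    also have "?c * (1 - s / s') * (2 * (1 - exp (- (t' / \<rho> powr (2 * \<alpha>))))) \<le> ?c * ((1 - t / t') / \<alpha>) * (2 * (t' / \<rho> powr (2 * \<alpha>)))"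
      using exp_ge_add_one_self[of "- (t' / \<rho> powr (2 * \<alpha>))"] c0 t t' s \<rho> \<alpha>
      by (intro mult_mono mult_left_mono ratio) auto
    also have "\<dots> = 2 * heat_const TYPE('a) * M / \<alpha> * (t' - t) / \<rho> powr (2 * \<alpha>)"
      using t' \<alpha> \<rho> by (simp add: field_simps)
    finally show ?B .
  qed
qed

section \<open>Maximal function of the heat semigroup\<close>

lemma cnj_ift: "cnj (ift g x) = ft (\<lambda>\<xi>. cnj (g \<xi>)) x / (2 * pi) ^ DIM('a)" for x :: "'a::euclidean_space"
  unfolding ift_def ft_def
  by (simp flip: Bochner_Integration.integral_cnj) (simp add: inner_commute cis_cnj)

lemma norm_ift: "norm (ift g x) = norm (ft (\<lambda>\<xi>. cnj (g \<xi>)) x) / (2 * pi) ^ DIM('a)" for x :: "'a::euclidean_space"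
  by (subst complex_mod_cnj[symmetric], subst cnj_ift) (simp add: norm_divide norm_power norm_mult)

lemma ift_measurable [measurable]:
  assumes [measurable]: "g \<in> borel_measurable borel"
  shows "ift g \<in> borel_measurable borel"
  unfolding ift_def by measurable

lemma ift_diff:
  assumes "integrable lborel g" "integrable lborel h"
  shows "ift (\<lambda>\<xi>. g \<xi> - h \<xi>) x = ift g x - ift h x"
  unfolding ift_def right_diff_distrib
  by (subst Bochner_Integration.integral_diff) (auto intro!: integrable_cis_mult assms simp: diff_divide_distrib)

lemma nn_integral_norm_ift_power2_le:
  fixes g :: "'a::euclidean_space \<Rightarrow> complex"
  assumes g: "integrable lborel g"
  shows "(\<integral>\<^sup>+x. (norm (ift g x))\<^sup>2 \<partial>lborel) \<le> ennreal (1 / (2 * pi) ^ DIM('a)) * (\<integral>\<^sup>+\<xi>. (norm (g \<xi>))\<^sup>2 \<partial>lborel)"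
proof -
  have [measurable]: "g \<in> borel_measurable borel" using g by auto
  let ?c = "(2 * pi) ^ DIM('a)"
  have g': "integrable lborel (\<lambda>\<xi>. cnj (g \<xi>))" using g by simp
  have "(\<integral>\<^sup>+x. (norm (ift g x))\<^sup>2 \<partial>lborel) = (\<integral>\<^sup>+x. ennreal (1 / ?c\<^sup>2) * ennreal ((norm (ft (\<lambda>\<xi>. cnj (g \<xi>)) x))\<^sup>2) \<partial>lborel)"
    by (intro nn_integral_cong) (simp add: norm_ift power_divide flip: ennreal_mult)
  also have "\<dots> = ennreal (1 / ?c\<^sup>2) * (\<integral>\<^sup>+x. ennreal ((norm (ft (\<lambda>\<xi>. cnj (g \<xi>)) x))\<^sup>2) \<partial>lborel)"
    by (intro nn_integral_cmult) measurable
  also have "(\<integral>\<^sup>+x. ennreal ((norm (ft (\<lambda>\<xi>. cnj (g \<xi>)) x))\<^sup>2) \<partial>lborel) \<le> ennreal ?c * (\<integral>\<^sup>+\<xi>. (norm (g \<xi>))\<^sup>2 \<partial>lborel)"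
    using nn_integral_norm_ft_power2_le[OF g'] by simp
  also have "ennreal (1 / ?c\<^sup>2) * (ennreal ?c * (\<integral>\<^sup>+\<xi>. (norm (g \<xi>))\<^sup>2 \<partial>lborel)) =
    ennreal (1 / ?c) * (\<integral>\<^sup>+\<xi>. (norm (g \<xi>))\<^sup>2 \<partial>lborel)"
    unfolding mult.assoc[symmetric] by (subst ennreal_mult[symmetric]) (auto simp: power2_eq_square)
  finally show ?thesis by (simp add: mult_left_mono)
qed

text \<open>This stands in for the Cauchy-Schwarz inequality: it can be integrated without taking
  roots of integrals, and the weight is fixed once the sizes of both sides are known.\<close>

lemma mult_le_weighted_squares:
  fixes a b k :: real
  assumes "0 < k"
  shows "a * b \<le> a\<^sup>2 / (2 * k) + k * b\<^sup>2 / 2"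
proof -
  have "0 \<le> (a - k * b)\<^sup>2 / (2 * k)" using assms by simp
  also have "\<dots> = a\<^sup>2 / (2 * k) + k * b\<^sup>2 / 2 - a * b"
    using assms by (simp add: power2_eq_square field_simps)
  finally show ?thesis by simp
qed

lemma norm_ift_le:
  fixes g :: "'a::euclidean_space \<Rightarrow> complex"
  assumes "integrable lborel g"
  shows "norm (ift g x) \<le> (\<integral>\<xi>. norm (g \<xi>) \<partial>lborel) / (2 * pi) ^ DIM('a)"
  using norm_ft_le[of "\<lambda>\<xi>. cnj (g \<xi>)" x] assms by (simp add: norm_ift divide_right_mono)

lemma ennreal_lincomb:
  "0 \<le> p \<Longrightarrow> 0 \<le> a \<Longrightarrow> 0 \<le> q \<Longrightarrow> 0 \<le> b \<Longrightarrow>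
    ennreal (p * a + q * b) = ennreal p * ennreal a + ennreal q * ennreal b"
  by (simp add: ennreal_mult)

text \<open>The maximum is linearised: A is cut into pieces on which a given m attains it, each with
  a phase that turns the value into its modulus. The linear expression so obtained is moved to the
  frequency side, where the weight \<open>\<kappa>\<close> separates k from a superposition of
  Gaussian multipliers that \<open>nn_integral_sum_exp_ft_power2_le\<close> controls.\<close>

lemma nn_integral_max_gaussian_multiplier_le:
  fixes k :: "'a::euclidean_space \<Rightarrow> complex" and u :: "nat \<Rightarrow> real"
  assumes k: "integrable lborel k" and u: "\<And>m. m \<le> n \<Longrightarrow> 0 < u m"
    and A: "A \<in> sets borel" "emeasure lborel A < \<infinity>" and \<kappa>: "0 < \<kappa>"
  defines "W \<equiv> \<lambda>m. ift (\<lambda>\<xi>. exp (- u m * (norm \<xi>)\<^sup>2) * k \<xi>)"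
  shows "(\<integral>\<^sup>+x\<in>A. (SUP m\<in>{..n}. ennreal (norm (W m x))) \<partial>lborel)
    \<le> ennreal (1 / (2 * \<kappa> * (2 * pi) ^ DIM('a))) * (\<integral>\<^sup>+\<xi>. (norm (k \<xi>))\<^sup>2 \<partial>lborel) + ennreal (\<kappa> * sqrt 2 ^ DIM('a)) * emeasure lborel A"
proof -
  have [measurable]: "A \<in> sets borel" by (rule A)
  have [measurable]: "k \<in> borel_measurable borel" using k by auto
  have [measurable]: "W m \<in> borel_measurable borel" for m unfolding W_def by measurable
  let ?c = "(2 * pi) ^ DIM('a)"
  let ?e = "\<lambda>m \<xi>. complex_of_real (exp (- u m * (norm (\<xi>::'a))\<^sup>2))"
  have ek: "integrable lborel (\<lambda>\<xi>. ?e m \<xi> * k \<xi>)" if "m \<le> n" for m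
    by (rule Bochner_Integration.integrable_bound[OF k]) (use u[OF that] in \<open>auto simp: norm_mult intro!: AE_I2 mult_left_le_one_le\<close>)
  then have ekc: "integrable lborel (\<lambda>\<xi>. ?e m \<xi> * cnj (k \<xi>))" if "m \<le> n" for m
    using integrable_cnj[of lborel "\<lambda>\<xi>. ?e m \<xi> * k \<xi>"] that by simp
  \<comment> \<open>The part of A on which the index m attains the maximum. Ties are settled by
    \<open>disjointed\<close>, which keeps the least such index.\<close>
  define F where "F m = (\<Inter>j\<in>{..n}. {x\<in>A. norm (W j x) \<le> norm (W m x)})" for m
  have F_meas: "F m \<in> sets borel" for m unfolding F_def by measurable
  define E where "E = disjointed F"
  have E_meas[measurable]: "E m \<in> sets borel" for m
    using F_meas unfolding E_def disjointed_def by (auto intro!: sets.Diff sets.finite_UN)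
  have E_A: "E m \<subseteq> A" for m using disjointed_subset[of F m] unfolding E_def F_def by auto
  have E_disj: "disjoint_family_on E {..n}"
    using disjoint_family_disjointed[of F] unfolding E_def by (rule disjoint_family_on_mono[rotated]) auto
  \<comment> \<open>The phase makes the product with the conjugate of \<open>W m x\<close> equal to
    the modulus on \<open>E m\<close>; as these sets are disjoint, the norms of all
    \<open>\<phi> m\<close> add up to at most the indicator of A.\<close>
  define \<phi> where "\<phi> m x = indicator (E m) x * sgn (W m x)" for m x
  have sgn_meas: "(\<lambda>x. sgn (W m x)) \<in> borel_measurable borel" for m unfolding sgn_div_norm by measurable
  have \<phi>_meas[measurable]: "\<phi> m \<in> borel_measurable borel" for m
    unfolding \<phi>_def using sgn_meas by measurable
  let ?\<Psi> = "\<lambda>\<xi>. \<Sum>m\<le>n. ?e m \<xi> * ft (\<phi> m) \<xi>"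
  let ?R = "\<lambda>x. \<Sum>m\<le>n. indicator (E m) x * norm (W m x)"
  have \<phi>_le: "norm (\<phi> m x) \<le> indicator (E m) x" for m x
    by (simp add: \<phi>_def norm_mult norm_sgn indicator_def)
  have sumE: "(\<Sum>m\<le>n. indicator (E m) x :: real) = indicator (\<Union>m\<le>n. E m) x" for x
    by (rule indicator_UN_disjoint[symmetric]) (auto simp: E_disj)
  have \<phi>_sum: "(\<Sum>m\<le>n. norm (\<phi> m x)) \<le> indicator A x" for x
  proof -
    have "(\<Sum>m\<le>n. norm (\<phi> m x)) \<le> indicator (\<Union>m\<le>n. E m) x"
      unfolding sumE[symmetric] by (intro sum_mono \<phi>_le)
    also have "\<dots> \<le> indicator A x" using E_A by (auto simp: indicator_def)
    finally show ?thesis .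
  qed
  have intA: "integrable lborel (indicator A :: 'a \<Rightarrow> real)" using A by simp
  have \<phi>_int: "integrable lborel (\<phi> m)" for m
  proof (rule Bochner_Integration.integrable_bound[OF intA])
    have "norm (\<phi> m x) \<le> indicator A x" for x
      using \<phi>_le[of m x] E_A[of m] by (cases "x \<in> E m") (auto simp: indicator_def)
    then show "AE x in lborel. norm (\<phi> m x) \<le> norm (indicator A x :: real)"
      by (intro AE_I2) simp
  qed measurable
  have \<phi>W: "\<phi> m x * cnj (W m x) = complex_of_real (indicator (E m) x * norm (W m x))" for m x
  proof -
    have "sgn (W m x) * cnj (W m x) = complex_of_real (norm (W m x))"
      by (cases "W m x = 0")
        (auto simp: sgn_div_norm scaleR_conv_of_real divide_simps mult.assoc complex_norm_square[symmetric] power2_eq_square)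
    then show ?thesis by (simp add: \<phi>_def mult.assoc) (simp add: indicator_def)
  qed
  have W_le: "norm (W m x) \<le> (\<integral>\<xi>. norm (?e m \<xi> * k \<xi>) \<partial>lborel) / ?c" if "m \<le> n" for m x
    unfolding W_def by (rule norm_ift_le[OF ek[OF that]])
  have EW_int: "integrable lborel (\<lambda>x. indicator (E m) x * norm (W m x))" if "m \<le> n" for m
  proof (rule Bochner_Integration.integrable_bound)
    show "integrable lborel (\<lambda>x. indicator A x * ((\<integral>\<xi>. norm (?e m \<xi> * k \<xi>) \<partial>lborel) / ?c))"
      using intA by (rule integrable_mult_left)
    show "AE x in lborel. norm (indicator (E m) x * norm (W m x)) \<le> norm (indicator A x * ((\<integral>\<xi>. norm (?e m \<xi> * k \<xi>) \<partial>lborel) / ?c))"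
      using W_le[OF that] E_A[of m] by (intro AE_I2) (auto simp: indicator_def intro!: order_trans[OF _ abs_ge_self])
  qed measurable
  have "(\<integral>\<^sup>+x\<in>A. (SUP m\<in>{..n}. ennreal (norm (W m x))) \<partial>lborel) \<le> (\<integral>\<^sup>+x. ennreal (?R x) \<partial>lborel)"
  proof (intro nn_integral_mono)
    fix x
    show "(SUP m\<in>{..n}. ennreal (norm (W m x))) * indicator A x \<le> ennreal (?R x)"
    proof (cases "x \<in> A")
      case True
      have "\<exists>m\<in>{..n}. \<forall>j\<in>{..n}. norm (W j x) \<le> norm (W m x)"
      proof -
        obtain m where "m \<in> {..n}" "norm (W m x) = Max ((\<lambda>j. norm (W j x)) ` {..n})"
          using Max_in[of "(\<lambda>j. norm (W j x)) ` {..n}"] by fastforce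
        then show ?thesis by (intro bexI[of _ m]) auto
      qed
      then have ex: "\<exists>m. m \<le> n \<and> x \<in> F m" using True by (auto simp: F_def)
      define m where "m = (LEAST m. x \<in> F m)"
      have m: "x \<in> F m" "m \<le> n" "\<And>j. j < m \<Longrightarrow> x \<notin> F j"
        using ex unfolding m_def by (auto intro: LeastI dest: not_less_Least) (meson Least_le order_trans)
      then have xE: "x \<in> E m" unfolding E_def disjointed_def by auto
      have "(SUP m\<in>{..n}. ennreal (norm (W m x))) \<le> ennreal (norm (W m x))"
        using m(1) by (intro SUP_least ennreal_leI) (auto simp: F_def)
      also have "norm (W m x) = indicator (E m) x * norm (W m x)" using xE by simp
      also have "\<dots> \<le> ?R x"
        using m(2) by (intro member_le_sum) auto
      finally show ?thesis using True by (simp add: ennreal_leI)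
    qed simp
  qed
  also have "\<dots> = ennreal (\<integral>x. ?R x \<partial>lborel)"
    using EW_int by (intro nn_integral_eq_integral Bochner_Integration.integrable_sum) (auto intro!: AE_I2 sum_nonneg)
  also have "(\<integral>x. ?R x \<partial>lborel) = norm (\<integral>\<xi>. cnj (k \<xi>) * ?\<Psi> \<xi> \<partial>lborel) / ?c"
  proof -
    have "complex_of_real (\<integral>x. indicator (E m) x * norm (W m x) \<partial>lborel) = (\<integral>\<xi>. cnj (k \<xi>) * (?e m \<xi> * ft (\<phi> m) \<xi>) \<partial>lborel) / ?c" if m: "m \<le> n" for m
    proof -
      have cW: "cnj (W m x) = ft (\<lambda>\<xi>. ?e m \<xi> * cnj (k \<xi>)) x / ?c" for x
        unfolding W_def cnj_ift by simp
      have "complex_of_real (\<integral>x. indicator (E m) x * norm (W m x) \<partial>lborel) = (\<integral>x. \<phi> m x * cnj (W m x) \<partial>lborel)"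
        unfolding \<phi>W integral_complex_of_real ..
      also have "\<dots> = (\<integral>x. \<phi> m x * ft (\<lambda>\<xi>. ?e m \<xi> * cnj (k \<xi>)) x \<partial>lborel) / ?c"
        unfolding cW by simp
      also have "(\<integral>x. \<phi> m x * ft (\<lambda>\<xi>. ?e m \<xi> * cnj (k \<xi>)) x \<partial>lborel) = (\<integral>\<xi>. (?e m \<xi> * cnj (k \<xi>)) * ft (\<phi> m) \<xi> \<partial>lborel)"
        by (rule integral_mult_ft[symmetric, OF ekc[OF m] \<phi>_int])
      finally show ?thesis by (simp add: ac_simps)
    qed
    note 1 = this
    have 2: "integrable lborel (\<lambda>\<xi>. cnj (k \<xi>) * (?e m \<xi> * ft (\<phi> m) \<xi>))" if m: "m \<le> n" for m
    proof (rule Bochner_Integration.integrable_bound)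
      show "integrable lborel (\<lambda>\<xi>. norm (k \<xi>) * (\<integral>x. norm (\<phi> m x) \<partial>lborel))"
        using k by auto
      show "AE \<xi> in lborel. norm (cnj (k \<xi>) * (?e m \<xi> * ft (\<phi> m) \<xi>)) \<le> norm (norm (k \<xi>) * (\<integral>x. norm (\<phi> m x) \<partial>lborel))"
      proof (intro AE_I2)
        fix \<xi> :: 'a
        have "norm (?e m \<xi>) * norm (ft (\<phi> m) \<xi>) \<le> 1 * (\<integral>x. norm (\<phi> m x) \<partial>lborel)"
          using u[OF m] by (intro mult_mono norm_ft_le \<phi>_int) auto
        then show "norm (cnj (k \<xi>) * (?e m \<xi> * ft (\<phi> m) \<xi>)) \<le> norm (norm (k \<xi>) * (\<integral>x. norm (\<phi> m x) \<partial>lborel))"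
          unfolding norm_mult by (simp add: mult_left_mono)
      qed
    qed measurable
    have "complex_of_real (\<integral>x. ?R x \<partial>lborel) = (\<Sum>m\<le>n. complex_of_real (\<integral>x. indicator (E m) x * norm (W m x) \<partial>lborel))"
      using EW_int by (subst Bochner_Integration.integral_sum) auto
    also have "\<dots> = (\<Sum>m\<le>n. (\<integral>\<xi>. cnj (k \<xi>) * (?e m \<xi> * ft (\<phi> m) \<xi>) \<partial>lborel)) / ?c"
      unfolding sum_divide_distrib by (intro sum.cong refl 1) auto
    also have "(\<Sum>m\<le>n. (\<integral>\<xi>. cnj (k \<xi>) * (?e m \<xi> * ft (\<phi> m) \<xi>) \<partial>lborel)) = (\<integral>\<xi>. (\<Sum>m\<le>n. cnj (k \<xi>) * (?e m \<xi> * ft (\<phi> m) \<xi>)) \<partial>lborel)"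
      by (intro Bochner_Integration.integral_sum[symmetric] 2) auto
    finally have "complex_of_real (\<integral>x. ?R x \<partial>lborel) =
       (\<integral>\<xi>. cnj (k \<xi>) * ?\<Psi> \<xi> \<partial>lborel) / ?c"
      by (simp only: sum_distrib_left)
    then have "norm (complex_of_real (\<integral>x. ?R x \<partial>lborel)) = norm (\<integral>\<xi>. cnj (k \<xi>) * ?\<Psi> \<xi> \<partial>lborel) / ?c"
      by (simp only: norm_divide) (simp add: norm_power norm_mult)
    moreover have "0 \<le> (\<integral>x. ?R x \<partial>lborel)"
      by (intro integral_nonneg_AE AE_I2 sum_nonneg) auto
    ultimately show ?thesis by (simp only: norm_of_real abs_of_nonneg)
  qed
  also have "ennreal \<dots> = ennreal (1 / ?c) * ennreal (norm (\<integral>\<xi>. cnj (k \<xi>) * ?\<Psi> \<xi> \<partial>lborel))"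
    by (subst ennreal_mult[symmetric]) auto
  also have "\<dots> \<le> ennreal (1 / ?c) * (\<integral>\<^sup>+\<xi>. norm (cnj (k \<xi>) * ?\<Psi> \<xi>) \<partial>lborel)"
    by (intro mult_left_mono norm_integral_le_nn_integral) auto
  also have "\<dots> \<le> ennreal (1 / ?c) * (\<integral>\<^sup>+\<xi>. ennreal (1 / (2 * \<kappa>)) * ennreal ((norm (k \<xi>))\<^sup>2) + ennreal (\<kappa> / 2) * ennreal ((norm (?\<Psi> \<xi>))\<^sup>2) \<partial>lborel)"
  proof (intro mult_left_mono nn_integral_mono)
    fix \<xi>
    let ?a = "norm (k \<xi>)" and ?b = "norm (?\<Psi> \<xi>)"
    have "norm (cnj (k \<xi>) * ?\<Psi> \<xi>) = ?a * ?b" by (simp only: norm_mult complex_mod_cnj)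
    also have "\<dots> \<le> 1 / (2 * \<kappa>) * ?a\<^sup>2 + \<kappa> / 2 * ?b\<^sup>2" using mult_le_weighted_squares[OF \<kappa>, of ?a ?b] by simp
    also have "ennreal \<dots> = ennreal (1 / (2 * \<kappa>)) * ennreal (?a\<^sup>2) + ennreal (\<kappa> / 2) * ennreal (?b\<^sup>2)"
      using \<kappa> by (intro ennreal_lincomb) auto
    finally show "ennreal (norm (cnj (k \<xi>) * ?\<Psi> \<xi>)) \<le> ennreal (1 / (2 * \<kappa>)) * ennreal (?a\<^sup>2) + ennreal (\<kappa> / 2) * ennreal (?b\<^sup>2)"
      by (simp add: ennreal_leI)
  qed auto
  also have "\<dots> = ennreal (1 / ?c) * (ennreal (1 / (2 * \<kappa>)) * (\<integral>\<^sup>+\<xi>. (norm (k \<xi>))\<^sup>2 \<partial>lborel) + ennreal (\<kappa> / 2) * (\<integral>\<^sup>+\<xi>. (norm (?\<Psi> \<xi>))\<^sup>2 \<partial>lborel))"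
    by (subst nn_integral_add) (simp_all add: nn_integral_cmult)
  also have "\<dots> \<le> ennreal (1 / ?c) * (ennreal (1 / (2 * \<kappa>)) * (\<integral>\<^sup>+\<xi>. (norm (k \<xi>))\<^sup>2 \<partial>lborel) + ennreal (\<kappa> / 2) * (ennreal (2 * ?c * sqrt 2 ^ DIM('a)) * emeasure lborel A))"
    using nn_integral_sum_exp_ft_power2_le[of "{..n}" u \<phi> A] u \<phi>_sum A
    by (intro mult_left_mono add_left_mono) auto
  also have "\<dots> = ennreal (1 / (2 * \<kappa> * ?c)) * (\<integral>\<^sup>+\<xi>. (norm (k \<xi>))\<^sup>2 \<partial>lborel) + ennreal (\<kappa> * sqrt 2 ^ DIM('a)) * emeasure lborel A"
  proof -
    have "ennreal (1 / ?c) * ennreal (1 / (2 * \<kappa>)) = ennreal (1 / (2 * \<kappa> * ?c))"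
      using \<kappa> by (subst ennreal_mult[symmetric]) (auto simp: mult.commute)
    moreover have "ennreal (1 / ?c) * (ennreal (\<kappa> / 2) * ennreal (2 * ?c * sqrt 2 ^ DIM('a))) = ennreal (\<kappa> * sqrt 2 ^ DIM('a))"
      using \<kappa> by (subst ennreal_mult[symmetric], simp, simp, subst ennreal_mult[symmetric]) auto
    ultimately show ?thesis by (simp only: distrib_left mult.assoc[symmetric])
  qed
  finally show ?thesis .
qed

section \<open>Symbols of the tails\<close>

text \<open>
  In terms of \<open>l = norm \<xi> powr (2 * \<alpha>)\<close>, the first symbol belongs to the tail of the sum that starts at
  \<open>m\<close>, and the second one, for \<open>b = 1 / \<alpha>\<close>, to the difference between this tail and the heat semigroup
  at time \<open>a m powr b\<close> applied to the full sum.
\<close>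

definition tail_symbol :: "(nat \<Rightarrow> real) \<Rightarrow> (nat \<Rightarrow> real) \<Rightarrow> nat \<Rightarrow> nat \<Rightarrow> real \<Rightarrow> real" where
  "tail_symbol v a n m l = (\<Sum>j=m..<n. v j * (exp (- (a (Suc j) * l)) - exp (- (a j * l))))"

definition tail_gap_symbol :: "real \<Rightarrow> (nat \<Rightarrow> real) \<Rightarrow> (nat \<Rightarrow> real) \<Rightarrow> nat \<Rightarrow> nat \<Rightarrow> real \<Rightarrow> real" where
  "tail_gap_symbol b v a n m l = tail_symbol v a n m l - exp (- ((a m * l) powr b)) * tail_symbol v a n 0 l"

text \<open>For x = \<open>a m * l\<close> and y = \<open>a (Suc m) * l\<close> the right side is
  the relative gap of the times, whatever the frequency. The decay of \<open>exp (- x)\<close> is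
  needed when \<open>y - x\<close> exceeds 1.\<close>

lemma exp_minus_diff_le:
  fixes x y :: real
  assumes "0 \<le> x" "x \<le> y"
  shows "exp (- x) - exp (- y) \<le> 1 - x / y"
proof (cases "y = 0")
  case False
  then have y: "0 < y" using assms by simp
  have "exp (- x) - exp (- y) = exp (- x) * (1 - exp (- (y - x)))"
    by (simp add: algebra_simps flip: exp_add)
  also have "\<dots> \<le> 1 / (1 + x) * min 1 (y - x)"
  proof (intro mult_mono)
    show "exp (- x) \<le> 1 / (1 + x)"
      using exp_ge_add_one_self[of x] assms by (simp add: exp_minus divide_simps)
    show "1 - exp (- (y - x)) \<le> min 1 (y - x)"
    proof (rule min.boundedI)
      have "1 + - (y - x) \<le> exp (- (y - x))" by (rule exp_ge_add_one_self)
      then show "1 - exp (- (y - x)) \<le> y - x" by linarith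
    qed simp
  qed (use assms in auto)
  also have "\<dots> \<le> (y - x) / y"
  proof (cases "y - x \<le> 1")
    case True
    have "(y - x) / (1 + x) \<le> (y - x) / y" using assms y True by (intro divide_left_mono) auto
    then show ?thesis using True by simp
  next
    case False
    have "0 \<le> x * (y - x - 1)" using False assms by simp
    then have "y \<le> (y - x) * (1 + x)" by (simp add: algebra_simps)
    then have "1 / (1 + x) \<le> (y - x) / y" using assms y by (simp add: divide_simps mult.commute)
    then show ?thesis using False by simp
  qed
  also have "\<dots> = 1 - x / y" using y by (simp add: diff_divide_distrib)
  finally show ?thesis .
qed (use assms in auto)

text \<open>The assumptions bound g by the minimum of x and 1 / x up to a constant. One power is
  given away at each end in order to reach x times the derivative of \<open>x / (1 + x)\<close>, a
  form whose sums against relative gaps telescope.\<close>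

lemma power2_min_le:
  fixes g V x :: real
  assumes "0 \<le> x" "\<bar>g\<bar> \<le> 2 * V * x" "\<bar>g\<bar> * x \<le> 2 * V" "0 \<le> V"
  shows "g\<^sup>2 \<le> 16 * V\<^sup>2 * (x / (1 + x)\<^sup>2)"
proof (cases "x \<le> 1")
  case True
  have "g\<^sup>2 \<le> (2 * V * x)\<^sup>2" using assms by (intro power2_le_iff_abs_le[THEN iffD2]) auto
  also have "\<dots> = 4 * V\<^sup>2 * (x * x)" by (simp add: power2_eq_square)
  also have "\<dots> \<le> 4 * V\<^sup>2 * (x * (4 / (1 + x)\<^sup>2))"
  proof (intro mult_left_mono)
    have "(1 + x)\<^sup>2 \<le> 2\<^sup>2" using True assms by (intro power_mono) auto
    then have "1 \<le> 4 / (1 + x)\<^sup>2" using assms by (simp add: field_simps)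
    then show "x \<le> 4 / (1 + x)\<^sup>2" using True by linarith
  qed (use assms in auto)
  finally show ?thesis by simp
next
  case False
  then have x: "1 < x" by simp
  have "(\<bar>g\<bar> * x)\<^sup>2 \<le> (2 * V)\<^sup>2" using assms by (intro power_mono) auto
  then have "g\<^sup>2 * x\<^sup>2 \<le> 4 * V\<^sup>2" by (simp add: power_mult_distrib)
  then have "g\<^sup>2 \<le> 4 * V\<^sup>2 / x\<^sup>2" using x by (simp add: pos_le_divide_eq)
  also have "\<dots> = 4 * V\<^sup>2 * (1 / x\<^sup>2)" by simp
  also have "\<dots> \<le> 4 * V\<^sup>2 * (4 * x / (1 + x)\<^sup>2)"
  proof (intro mult_left_mono)
    have "(1 + x)\<^sup>2 \<le> (2 * x)\<^sup>2" using x by (intro power_mono) auto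
    also have "\<dots> = 4 * x\<^sup>2" by (simp add: power_mult_distrib)
    also have "\<dots> \<le> 4 * x\<^sup>2 * x" using x by (simp add: mult_le_cancel_left1)
    finally show "1 / x\<^sup>2 \<le> 4 * x / (1 + x)\<^sup>2" using x by (simp add: divide_simps ac_simps)
  qed auto
  finally show ?thesis by simp
qed

context
  fixes v a :: "nat \<Rightarrow> real" and V b :: real and n :: nat
  assumes a: "\<And>j. 0 < a j" "mono a" and v: "\<And>j. \<bar>v j\<bar> \<le> V" and b: "1 \<le> b"
begin

lemma coefficient_bound_nonneg: "0 \<le> V"
  using v[of 0] by linarith

lemma times_mult_mono: "m \<le> k \<Longrightarrow> 0 \<le> l \<Longrightarrow> a m * l \<le> a k * l"
  using a(2) by (simp add: mult_right_mono monoD)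

text \<open>The exponentials decrease in j, so their absolute increments telescope and only the
  supremum of the coefficients enters.\<close>

lemma abs_sum_exp_diff_le:
  assumes "m \<le> k" "0 \<le> l"
  shows "\<bar>\<Sum>j=m..<k. v j * (exp (- (a (Suc j) * l)) - exp (- (a j * l)))\<bar> \<le> V * (exp (- (a m * l)) - exp (- (a k * l)))"
proof -
  have "\<bar>\<Sum>j=m..<k. v j * (exp (- (a (Suc j) * l)) - exp (- (a j * l)))\<bar> \<le>
    (\<Sum>j=m..<k. \<bar>v j * (exp (- (a (Suc j) * l)) - exp (- (a j * l)))\<bar>)"
    by (rule sum_abs)
  also have "\<dots> \<le> (\<Sum>j=m..<k. V * (- exp (- (a (Suc j) * l)) - - exp (- (a j * l))))"
  proof (intro sum_mono)
    fix j
    have "exp (- (a (Suc j) * l)) \<le> exp (- (a j * l))" using times_mult_mono[of j "Suc j" l] assms by simp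
    then have "\<bar>v j * (exp (- (a (Suc j) * l)) - exp (- (a j * l)))\<bar> = \<bar>v j\<bar> * (- exp (- (a (Suc j) * l)) - - exp (- (a j * l)))"
      by (simp add: abs_mult)
    also have "\<dots> \<le> V * (- exp (- (a (Suc j) * l)) - - exp (- (a j * l)))"
      using \<open>exp (- (a (Suc j) * l)) \<le> exp (- (a j * l))\<close> by (intro mult_right_mono v) auto
    finally show "\<bar>v j * (exp (- (a (Suc j) * l)) - exp (- (a j * l)))\<bar> \<le> \<dots>" .
  qed
  also have "\<dots> = V * (exp (- (a m * l)) - exp (- (a k * l)))"
    unfolding sum_distrib_left[symmetric] using assms by (subst sum_Suc_diff') auto
  finally show ?thesis .
qed

lemma abs_tail_symbol_le:
  assumes "m \<le> n" "0 \<le> l"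
  shows "\<bar>tail_symbol v a n m l\<bar> \<le> V * exp (- (a m * l))"
proof -
  have "V * (exp (- (a m * l)) - exp (- (a n * l))) \<le> V * exp (- (a m * l))"
    using coefficient_bound_nonneg by (intro mult_left_mono) auto
  then show ?thesis using abs_sum_exp_diff_le[OF assms] unfolding tail_symbol_def by linarith
qed

lemma abs_tail_symbol_le_V:
  assumes "m \<le> n" "0 \<le> l"
  shows "\<bar>tail_symbol v a n m l\<bar> \<le> V"
proof -
  have "V * exp (- (a m * l)) \<le> V * 1"
    using coefficient_bound_nonneg a(1)[of m] assms by (intro mult_left_mono) auto
  then show ?thesis using abs_tail_symbol_le[OF assms] by linarith
qed

text \<open>For small \<open>a m * l\<close> the terms before m contribute little to the full sum
  and the exponential factor is close to 1, so the two terms of the gap nearly cancel. For large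
  \<open>a m * l\<close> each of them is small by itself. As b is at least 1, the power b only helps
  in both ranges.\<close>

lemma tail_gap_symbol_power2_le:
  assumes m: "m \<le> n" and l: "0 \<le> l"
  shows "(tail_gap_symbol b v a n m l)\<^sup>2 \<le> 16 * V\<^sup>2 * (a m * l / (1 + a m * l)\<^sup>2)"
proof (rule power2_min_le)
  let ?x = "a m * l"
  let ?e = "exp (- (?x powr b))"
  show x0: "0 \<le> ?x" using a(1)[of m] l by simp
  have q0: "\<bar>tail_symbol v a n 0 l\<bar> \<le> V" by (rule abs_tail_symbol_le_V) (use l in auto)
  have e1: "1 - ?e \<le> ?x"
  proof (cases "?x \<le> 1")
    case True
    have "1 - ?e \<le> ?x powr b" using exp_ge_add_one_self[of "- (?x powr b)"] by simp
    also have "\<dots> \<le> ?x powr 1" by (rule powr_mono') (use True x0 b in auto)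
    finally show ?thesis using x0 by simp
  next
    case False
    moreover have "0 < ?e" by simp
    ultimately show ?thesis by linarith
  qed
  have e2: "?e * ?x \<le> 1"
  proof (cases "?x \<le> 1")
    case True
    have "?e * ?x \<le> 1 * 1" using True x0 by (intro mult_mono) auto
    then show ?thesis by simp
  next
    case False
    then have "?x powr 1 \<le> ?x powr b" using b by (intro powr_mono) auto
    then have "?x \<le> ?x powr b" using False by simp
    then have "?x \<le> exp (?x powr b)" using exp_ge_add_one_self[of "?x powr b"] by linarith
    then show ?thesis by (simp add: exp_minus divide_simps)
  qed
  have e3: "exp (- ?x) * ?x \<le> 1"
  proof -
    have "1 + ?x \<le> exp ?x" by (rule exp_ge_add_one_self)
    then have "?x \<le> exp ?x" by linarith
    then show ?thesis by (simp add: exp_minus divide_simps)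
  qed
  have q_diff: "tail_symbol v a n 0 l - tail_symbol v a n m l = (\<Sum>j=0..<m. v j * (exp (- (a (Suc j) * l)) - exp (- (a j * l))))"
    unfolding tail_symbol_def using m by (subst sum.atLeastLessThan_concat[of 0 m n, symmetric]) auto
  have "\<bar>tail_symbol v a n 0 l - tail_symbol v a n m l\<bar> \<le> V * (exp (- (a 0 * l)) - exp (- ?x))"
    unfolding q_diff by (rule abs_sum_exp_diff_le) (use l in auto)
  also have "\<dots> \<le> V * ?x"
  proof (intro mult_left_mono coefficient_bound_nonneg)
    have "exp (- (a 0 * l)) \<le> 1" using a(1)[of 0] l by simp
    moreover have "1 - ?x \<le> exp (- ?x)" using exp_ge_add_one_self[of "- ?x"] by simp
    ultimately show "exp (- (a 0 * l)) - exp (- ?x) \<le> ?x" by linarith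
  qed
  finally have A: "\<bar>tail_symbol v a n 0 l - tail_symbol v a n m l\<bar> \<le> V * ?x" .
  have B: "\<bar>(1 - ?e) * tail_symbol v a n 0 l\<bar> \<le> V * ?x"
  proof -
    have "\<bar>(1 - ?e) * tail_symbol v a n 0 l\<bar> = (1 - ?e) * \<bar>tail_symbol v a n 0 l\<bar>" by (simp add: abs_mult)
    also have "\<dots> \<le> ?x * V" using e1 q0 x0 by (intro mult_mono) auto
    finally show ?thesis by (simp add: mult.commute)
  qed
  have "tail_gap_symbol b v a n m l = (1 - ?e) * tail_symbol v a n 0 l - (tail_symbol v a n 0 l - tail_symbol v a n m l)"
    by (simp add: tail_gap_symbol_def algebra_simps)
  then show "\<bar>tail_gap_symbol b v a n m l\<bar> \<le> 2 * V * ?x" using A B by linarith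
  have "\<bar>tail_gap_symbol b v a n m l\<bar> * ?x \<le> (V * exp (- ?x) + ?e * V) * ?x"
  proof (intro mult_right_mono x0)
    have "\<bar>?e * tail_symbol v a n 0 l\<bar> \<le> ?e * V" using q0 by (simp add: abs_mult)
    then show "\<bar>tail_gap_symbol b v a n m l\<bar> \<le> V * exp (- ?x) + ?e * V"
      using abs_tail_symbol_le[OF m l] unfolding tail_gap_symbol_def by linarith
  qed
  also have "\<dots> = V * (exp (- ?x) * ?x) + V * (?e * ?x)" by (simp add: algebra_simps)
  also have "\<dots> \<le> V * 1 + V * 1" using e2 e3 coefficient_bound_nonneg by (intro add_mono mult_left_mono)
  finally show "\<bar>tail_gap_symbol b v a n m l\<bar> * ?x \<le> 2 * V" by simp
qed (rule coefficient_bound_nonneg)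

text \<open>
  With the weights \<open>1 - a m / a (Suc m)\<close> both halves of the square function telescope, whatever the
  gaps of the sequence are.
\<close>

lemma sum_tail_gap_symbol_power2_le:
  assumes l: "0 \<le> l"
  shows "(\<Sum>m<n. (1 - a m / a (Suc m)) * (tail_gap_symbol b v a n m l)\<^sup>2) \<le> 16 * V\<^sup>2"
proof -
  \<comment> \<open>With x and y as the values at m and \<open>Suc m\<close>, the increment of
    \<open>\<theta>\<close> is \<open>(y - x) / ((1 + x) * (1 + y))\<close>. It dominates
    \<open>(1 - x / y) * (x / (1 + x)^2)\<close>, and \<open>\<theta>\<close> stays between 0 and
    1.\<close>
  define \<theta> where "\<theta> m = a m * l / (1 + a m * l)" for m
  have pos: "0 < 1 + a m * l" for m using a(1)[of m] l by (simp add: add_pos_nonneg)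
  have "(\<Sum>m<n. (1 - a m / a (Suc m)) * (tail_gap_symbol b v a n m l)\<^sup>2) \<le> (\<Sum>m<n. 16 * V\<^sup>2 * (\<theta> (Suc m) - \<theta> m))"
  proof (intro sum_mono)
    fix m assume "m \<in> {..<n}"
    then have m: "m \<le> n" by simp
    let ?x = "a m * l" and ?y = "a (Suc m) * l"
    have am: "a m \<le> a (Suc m)" using a(2) by (simp add: monoD)
    have w: "0 \<le> 1 - a m / a (Suc m)" using am a(1)[of "Suc m"] by simp
    have "(1 - a m / a (Suc m)) * (?x / (1 + ?x)\<^sup>2) \<le> \<theta> (Suc m) - \<theta> m"
    proof (cases "l = 0")
      case False
      then have l: "0 < l" using l by simp
      have x: "0 < ?x" "?x \<le> ?y" "0 < ?y" using a(1) am l by auto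
      have "1 - a m / a (Suc m) = (?y - ?x) / ?y" using l a(1)[of "Suc m"] by (simp add: field_simps)
      then have "(1 - a m / a (Suc m)) * (?x / (1 + ?x)\<^sup>2) = (?y - ?x) / (1 + ?x) * (?x / (?y * (1 + ?x)))"
        by (simp add: power2_eq_square)
      also have "\<dots> \<le> (?y - ?x) / (1 + ?x) * (1 / (1 + ?y))"
      proof (rule mult_left_mono)
        have "X / (Y * (1 + X)) \<le> 1 / (1 + Y)" if "0 < X" "X \<le> Y" for X Y :: real
          using that by (simp add: divide_simps add_pos_pos) (simp add: algebra_simps)
        then show "?x / (?y * (1 + ?x)) \<le> 1 / (1 + ?y)"
          using x by blast
      qed (use x in auto)
      also have "\<dots> = \<theta> (Suc m) - \<theta> m"
        using pos[of m] pos[of "Suc m"] unfolding \<theta>_def by (simp add: divide_simps) (simp add: algebra_simps)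
      finally show ?thesis .
    qed (simp add: \<theta>_def)
    then have "16 * V\<^sup>2 * ((1 - a m / a (Suc m)) * (?x / (1 + ?x)\<^sup>2)) \<le> 16 * V\<^sup>2 * (\<theta> (Suc m) - \<theta> m)"
      by (intro mult_left_mono) auto
    moreover have "(1 - a m / a (Suc m)) * (tail_gap_symbol b v a n m l)\<^sup>2 \<le> (1 - a m / a (Suc m)) * (16 * V\<^sup>2 * (?x / (1 + ?x)\<^sup>2))"
      by (intro mult_left_mono tail_gap_symbol_power2_le m l w)
    ultimately show "(1 - a m / a (Suc m)) * (tail_gap_symbol b v a n m l)\<^sup>2 \<le> 16 * V\<^sup>2 * (\<theta> (Suc m) - \<theta> m)"
      by (simp add: ac_simps)
  qed
  also have "\<dots> = 16 * V\<^sup>2 * (\<theta> n - \<theta> 0)"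
    by (simp add: sum_distrib_left[symmetric] sum_lessThan_telescope)
  also have "\<dots> \<le> 16 * V\<^sup>2 * 1"
  proof (intro mult_left_mono)
    have "\<theta> n \<le> 1" using pos[of n] by (simp add: \<theta>_def)
    moreover have "0 \<le> \<theta> 0" using pos[of 0] a(1)[of 0] l by (simp add: \<theta>_def)
    ultimately show "\<theta> n - \<theta> 0 \<le> 1" by simp
  qed auto
  finally show ?thesis by simp
qed

text \<open>The gap symbol changes by an increment of the exponential and one of the Gaussian
  factor. Of the two factors in the square, one is bounded by the weight, with \<open>1 + b\<close>
  coming from the relative gaps of the times and of their powers; the other is left as an increment,
  so that it telescopes.\<close>

lemma tail_gap_symbol_diff_power2_le:
  assumes m: "m < n" and l: "0 \<le> l"
  shows "(tail_gap_symbol b v a n m l - tail_gap_symbol b v a n (Suc m) l)\<^sup>2 \<le> (1 - a m / a (Suc m)) * ((1 + b) * V\<^sup>2 *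
     ((exp (- (a m * l)) - exp (- (a (Suc m) * l))) + (exp (- ((a m * l) powr b)) - exp (- ((a (Suc m) * l) powr b)))))"
proof -
  let ?x = "a m * l" and ?y = "a (Suc m) * l"
  let ?w = "1 - a m / a (Suc m)"
  define d1 where "d1 = exp (- ?x) - exp (- ?y)"
  define d2 where "d2 = exp (- (?x powr b)) - exp (- (?y powr b))"
  have am: "a m \<le> a (Suc m)" using a(2) by (simp add: monoD)
  have w: "0 \<le> ?w" using am a(1)[of "Suc m"] by simp
  have x: "0 \<le> ?x" "?x \<le> ?y" using a(1)[of m] l times_mult_mono[of m "Suc m" l] by auto
  then have xb: "?x powr b \<le> ?y powr b" using b by (intro powr_mono2) auto
  have d1: "0 \<le> d1" "d1 \<le> ?w"
  proof -
    show "0 \<le> d1" using x by (simp add: d1_def)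
    show "d1 \<le> ?w"
    proof (cases "l = 0")
      case False
      then show ?thesis using exp_minus_diff_le[OF x] by (simp add: d1_def)
    qed (use w in \<open>simp add: d1_def\<close>)
  qed
  have d2: "0 \<le> d2" "d2 \<le> b * ?w"
  proof -
    show "0 \<le> d2" using xb by (simp add: d2_def)
    show "d2 \<le> b * ?w"
    proof (cases "l = 0")
      case False
      then have l: "0 < l" using l by simp
      have "d2 \<le> 1 - ?x powr b / ?y powr b"
        unfolding d2_def by (rule exp_minus_diff_le[OF _ xb]) simp
      also have "?x powr b / ?y powr b = (a m / a (Suc m)) powr b"
        using l a(1)[of m] a(1)[of "Suc m"] by (simp add: powr_mult powr_divide)
      also have "1 - (a m / a (Suc m)) powr b \<le> b * ?w"
        using a(1)[of m] a(1)[of "Suc m"] b by (intro one_minus_powr_le) auto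
      finally show ?thesis .
    qed (use w b in \<open>simp add: d2_def\<close>)
  qed
  have q0: "\<bar>tail_symbol v a n 0 l\<bar> \<le> V" by (rule abs_tail_symbol_le_V) (use l in auto)
  have "tail_symbol v a n m l = v m * (exp (- ?y) - exp (- ?x)) + tail_symbol v a n (Suc m) l"
    unfolding tail_symbol_def using m by (rule sum.atLeast_Suc_lessThan)
  then have "tail_gap_symbol b v a n m l - tail_gap_symbol b v a n (Suc m) l = - (v m * d1) - d2 * tail_symbol v a n 0 l"
    by (simp add: tail_gap_symbol_def d1_def d2_def algebra_simps)
  also have "\<bar>\<dots>\<bar> \<le> V * d1 + V * d2"
  proof -
    have "\<bar>v m * d1\<bar> \<le> V * d1" unfolding abs_mult using d1 v[of m] by (intro mult_mono) auto
    moreover have "\<bar>d2 * tail_symbol v a n 0 l\<bar> \<le> d2 * V" unfolding abs_mult using d2 q0 by (intro mult_mono) auto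
    ultimately show ?thesis by (simp add: mult.commute)
  qed
  finally have "(tail_gap_symbol b v a n m l - tail_gap_symbol b v a n (Suc m) l)\<^sup>2 \<le> (V * (d1 + d2))\<^sup>2"
    using d1 d2 coefficient_bound_nonneg by (intro power2_le_iff_abs_le[THEN iffD2]) (auto simp: distrib_left)
  also have "\<dots> = (d1 + d2) * (V\<^sup>2 * (d1 + d2))" by (simp add: power2_eq_square)
  also have "\<dots> \<le> ((1 + b) * ?w) * (V\<^sup>2 * (d1 + d2))"
  proof (intro mult_right_mono)
    show "d1 + d2 \<le> (1 + b) * ?w" unfolding distrib_right mult_1 using d1 d2 by linarith
  qed (use d1 d2 in auto)
  finally show ?thesis by (simp add: d1_def d2_def ac_simps)
qed

lemma sum_tail_gap_symbol_diff_power2_le: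
  assumes l: "0 \<le> l"
  shows "(\<Sum>m<n. (tail_gap_symbol b v a n m l - tail_gap_symbol b v a n (Suc m) l)\<^sup>2 / (1 - a m / a (Suc m))) \<le> 2 * (1 + b) * V\<^sup>2"
proof -
  \<comment> \<open>This function increases in m from at least -2 to at most 0, so its increments
    add up to at most 2.\<close>
  let ?f = "\<lambda>m. - exp (- (a m * l)) - exp (- ((a m * l) powr b))"
  have "(\<Sum>m<n. (tail_gap_symbol b v a n m l - tail_gap_symbol b v a n (Suc m) l)\<^sup>2 / (1 - a m / a (Suc m))) \<le> (\<Sum>m<n. (1 + b) * V\<^sup>2 * (?f (Suc m) - ?f m))"
  proof (intro sum_mono)
    fix m assume "m \<in> {..<n}"
    then have m: "m < n" by simp
    let ?w = "1 - a m / a (Suc m)"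
    have am: "a m \<le> a (Suc m)" using a(2) by (simp add: monoD)
    have w: "0 \<le> ?w" using am a(1)[of "Suc m"] by simp
    have x: "0 \<le> a m * l" "a m * l \<le> a (Suc m) * l" using a(1)[of m] l times_mult_mono[of m "Suc m" l] by auto
    then have xb: "(a m * l) powr b \<le> (a (Suc m) * l) powr b" using b by (intro powr_mono2) auto
    have eq: "?f (Suc m) - ?f m = (exp (- (a m * l)) - exp (- (a (Suc m) * l))) + (exp (- ((a m * l) powr b)) - exp (- ((a (Suc m) * l) powr b)))"
      by simp
    have nn: "0 \<le> ?f (Suc m) - ?f m" unfolding eq using x xb by (intro add_nonneg_nonneg) auto
    show "(tail_gap_symbol b v a n m l - tail_gap_symbol b v a n (Suc m) l)\<^sup>2 / ?w \<le> (1 + b) * V\<^sup>2 * (?f (Suc m) - ?f m)"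
    \<comment> \<open>When the two times coincide, the quotient is 0 by the convention for division,
      and the increment on the right is nonnegative.\<close>
    proof (cases "?w = 0")
      case True
      then show ?thesis using nn b by (simp only: True) (simp)
    next
      case False
      then have "0 < ?w" using w by (metis less_le)
      then show ?thesis
        using tail_gap_symbol_diff_power2_le[OF m l] unfolding eq by (simp only: pos_divide_le_eq) (simp only: mult.commute[of ?w])
    qed
  qed
  also have "\<dots> = (1 + b) * V\<^sup>2 * (?f n - ?f 0)"
    unfolding sum_distrib_left[symmetric] by (subst sum_lessThan_telescope) simp
  also have "\<dots> \<le> (1 + b) * V\<^sup>2 * 2"
  proof (rule mult_left_mono)
    have "exp (- (a 0 * l)) \<le> 1" "exp (- ((a 0 * l) powr b)) \<le> 1" using a(1)[of 0] l by auto
    moreover have "0 < exp (- (a n * l))" "0 < exp (- ((a n * l) powr b))" by auto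
    ultimately show "?f n - ?f 0 \<le> 2" by linarith
  qed (use b in auto)
  finally show ?thesis by (simp only: ac_simps)
qed

text \<open>The tail from n on is empty, so only the Gaussian part remains. This is the end term
  when maxima over m are replaced by sums of differences.\<close>

lemma tail_gap_symbol_n_power2_le:
  assumes l: "0 \<le> l"
  shows "(tail_gap_symbol b v a n n l)\<^sup>2 \<le> V\<^sup>2"
proof -
  have "\<bar>exp (- ((a n * l) powr b)) * tail_symbol v a n 0 l\<bar> \<le> 1 * V"
    unfolding abs_mult using abs_tail_symbol_le_V[of 0 l] l by (intro mult_mono) auto
  then show ?thesis
    using coefficient_bound_nonneg by (intro power2_le_iff_abs_le[THEN iffD2]) (auto simp: tail_gap_symbol_def tail_symbol_def)
qed

end

section \<open>The square function estimate for the tails\<close>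

definition fmult :: "real \<Rightarrow> (real \<Rightarrow> real) \<Rightarrow> ('a::euclidean_space \<Rightarrow> complex) \<Rightarrow> 'a \<Rightarrow> complex" where
  "fmult \<alpha> q f = ift (\<lambda>\<xi>. complex_of_real (q (norm \<xi> powr (2 * \<alpha>))) * ft f \<xi>)"

lemma integrable_fmult:
  fixes f :: "'a::euclidean_space \<Rightarrow> complex"
  assumes \<alpha>: "0 < \<alpha>" and f: "integrable lborel f" and [measurable]: "q \<in> borel_measurable borel"
    and c: "0 < c" and q: "\<And>l. 0 \<le> l \<Longrightarrow> \<bar>q l\<bar> \<le> K * exp (- (c * l))"
  shows "integrable lborel (\<lambda>\<xi>::'a. complex_of_real (q (norm \<xi> powr (2 * \<alpha>))) * ft f \<xi>)"
proof (rule Bochner_Integration.integrable_bound)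
  have [measurable]: "f \<in> borel_measurable borel" using f by auto
  show "integrable lborel (\<lambda>\<xi>::'a. K * (\<integral>x. norm (f x) \<partial>lborel) * exp (- c * norm \<xi> powr (2 * \<alpha>)))"
    using \<alpha> c by (intro integrable_mult_right integrable_exp_norm_powr) auto
  show "AE \<xi>::'a in lborel. norm (complex_of_real (q (norm \<xi> powr (2 * \<alpha>))) * ft f \<xi>) \<le>
     norm (K * (\<integral>x. norm (f x) \<partial>lborel) * exp (- c * norm \<xi> powr (2 * \<alpha>)))"
  proof (intro AE_I2)
    fix \<xi> :: 'a
    have "\<bar>q (norm \<xi> powr (2 * \<alpha>))\<bar> * norm (ft f \<xi>) \<le> (K * exp (- (c * norm \<xi> powr (2 * \<alpha>)))) * (\<integral>x. norm (f x) \<partial>lborel)"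
      using q[of "norm \<xi> powr (2 * \<alpha>)"] by (intro mult_mono norm_ft_le f) auto
    also have "\<dots> = K * (\<integral>x. norm (f x) \<partial>lborel) * exp (- c * norm \<xi> powr (2 * \<alpha>))" by simp
    finally have "norm (complex_of_real (q (norm \<xi> powr (2 * \<alpha>))) * ft f \<xi>) \<le>
     K * (\<integral>x. norm (f x) \<partial>lborel) * exp (- c * norm \<xi> powr (2 * \<alpha>))"
      by (simp add: norm_mult)
    then show "norm (complex_of_real (q (norm \<xi> powr (2 * \<alpha>))) * ft f \<xi>) \<le>
     norm (K * (\<integral>x. norm (f x) \<partial>lborel) * exp (- c * norm \<xi> powr (2 * \<alpha>)))"
      unfolding real_norm_def by (rule order_trans[OF _ abs_ge_self])
  qed
  show "(\<lambda>\<xi>. complex_of_real (q (norm \<xi> powr (2 * \<alpha>))) * ft f \<xi>) \<in> borel_measurable lborel"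
    by measurable
qed

lemma fmult_measurable [measurable]:
  assumes [measurable]: "f \<in> borel_measurable borel" "q \<in> borel_measurable borel"
  shows "fmult \<alpha> q f \<in> borel_measurable borel"
  unfolding fmult_def by measurable

lemma nn_integral_weighted_sum:
  assumes "\<And>i. i \<in> I \<Longrightarrow> h i \<in> borel_measurable M"
  shows "(\<integral>\<^sup>+x. (\<Sum>i\<in>I. c i * h i x) \<partial>M) = (\<Sum>i\<in>I. c i * (\<integral>\<^sup>+x. h i x \<partial>M))"
  using assms by (subst nn_integral_sum) (simp_all add: nn_integral_cmult)

text \<open>Plancherel's inequality is applied to the inverse transforms and to f, with cancelling
  powers of \<open>2 * pi\<close>; in between, the bound B holds pointwise in the frequency. The
  common decay rate c makes every inverse transform absolutely convergent.\<close>

lemma square_function_le: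
  fixes f :: "'a::euclidean_space \<Rightarrow> complex" and s :: "'i \<Rightarrow> real \<Rightarrow> real"
  assumes \<alpha>: "0 < \<alpha>" and f: "integrable lborel f" and I: "finite I"
    and s_meas: "\<And>i. i \<in> I \<Longrightarrow> s i \<in> borel_measurable borel"
    and s: "\<And>i l. i \<in> I \<Longrightarrow> 0 \<le> l \<Longrightarrow> \<bar>s i l\<bar> \<le> K * exp (- (c * l))" and c: "0 < c"
    and w: "\<And>i. i \<in> I \<Longrightarrow> 0 \<le> w i" and B: "\<And>l. 0 \<le> l \<Longrightarrow> (\<Sum>i\<in>I. w i * (s i l)\<^sup>2) \<le> B"
  shows "(\<integral>\<^sup>+x. ennreal (\<Sum>i\<in>I. w i * (norm (fmult \<alpha> (s i) f x))\<^sup>2) \<partial>lborel) \<le> ennreal B * (\<integral>\<^sup>+x. (norm (f x))\<^sup>2 \<partial>lborel)"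
proof -
  have [measurable]: "f \<in> borel_measurable borel" using f by auto
  have [measurable]: "s i \<in> borel_measurable borel" if "i \<in> I" for i by (rule s_meas[OF that])
  let ?d = "ennreal (1 / (2 * pi) ^ DIM('a))"
  let ?k = "\<lambda>i \<xi>. complex_of_real (s i (norm (\<xi>::'a) powr (2 * \<alpha>))) * ft f \<xi>"
  have k: "integrable lborel (?k i)" if "i \<in> I" for i
    by (rule integrable_fmult[OF \<alpha> f s_meas[OF that] c s[OF that]])
  have B0: "0 \<le> B"
  proof -
    have "0 \<le> (\<Sum>i\<in>I. w i * (s i 0)\<^sup>2)" by (intro sum_nonneg mult_nonneg_nonneg w) auto
    also have "\<dots> \<le> B" by (rule B) simp
    finally show ?thesis .
  qed
  have "(\<integral>\<^sup>+x. ennreal (\<Sum>i\<in>I. w i * (norm (fmult \<alpha> (s i) f x))\<^sup>2) \<partial>lborel) = (\<integral>\<^sup>+x. (\<Sum>i\<in>I. ennreal (w i) * ennreal ((norm (fmult \<alpha> (s i) f x))\<^sup>2)) \<partial>lborel)"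
    using w by (intro nn_integral_cong) (simp add: ennreal_mult[symmetric])
  also have "\<dots> = (\<Sum>i\<in>I. ennreal (w i) * (\<integral>\<^sup>+x. ennreal ((norm (fmult \<alpha> (s i) f x))\<^sup>2) \<partial>lborel))"
    by (rule nn_integral_weighted_sum) measurable
  also have "\<dots> \<le> (\<Sum>i\<in>I. ennreal (w i) * (?d * (\<integral>\<^sup>+\<xi>. (norm (?k i \<xi>))\<^sup>2 \<partial>lborel)))"
    unfolding fmult_def by (intro sum_mono mult_left_mono nn_integral_norm_ift_power2_le k) auto
  also have "\<dots> = ?d * (\<Sum>i\<in>I. ennreal (w i) * (\<integral>\<^sup>+\<xi>. (norm (?k i \<xi>))\<^sup>2 \<partial>lborel))"
    unfolding sum_distrib_left by (simp only: mult.left_commute)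
  also have "(\<Sum>i\<in>I. ennreal (w i) * (\<integral>\<^sup>+\<xi>. (norm (?k i \<xi>))\<^sup>2 \<partial>lborel)) = (\<integral>\<^sup>+\<xi>. (\<Sum>i\<in>I. ennreal (w i) * ennreal ((norm (?k i \<xi>))\<^sup>2)) \<partial>lborel)"
    by (rule nn_integral_weighted_sum[symmetric]) measurable
  also have "\<dots> \<le> (\<integral>\<^sup>+\<xi>. ennreal B * ennreal ((norm (ft f \<xi>))\<^sup>2) \<partial>lborel)"
  proof (intro nn_integral_mono)
    fix \<xi> :: 'a
    let ?l = "norm \<xi> powr (2 * \<alpha>)"
    have "(\<Sum>i\<in>I. ennreal (w i) * ennreal ((norm (?k i \<xi>))\<^sup>2)) = (\<Sum>i\<in>I. ennreal (w i * (norm (?k i \<xi>))\<^sup>2))"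
      using w by (intro sum.cong refl) (simp add: ennreal_mult)
    also have "\<dots> = ennreal (\<Sum>i\<in>I. w i * (norm (?k i \<xi>))\<^sup>2)"
      using w by (intro sum_ennreal) auto
    also have "(\<Sum>i\<in>I. w i * (norm (?k i \<xi>))\<^sup>2) = (\<Sum>i\<in>I. w i * (s i ?l)\<^sup>2) * (norm (ft f \<xi>))\<^sup>2"
      unfolding sum_distrib_right by (intro sum.cong refl) (simp add: norm_mult power_mult_distrib)
    also have "ennreal \<dots> \<le> ennreal (B * (norm (ft f \<xi>))\<^sup>2)"
      by (intro ennreal_leI mult_right_mono B) auto
    also have "\<dots> = ennreal B * ennreal ((norm (ft f \<xi>))\<^sup>2)"
      using B0 by (simp add: ennreal_mult)
    finally show "(\<Sum>i\<in>I. ennreal (w i) * ennreal ((norm (?k i \<xi>))\<^sup>2)) \<le> \<dots>" .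
  qed
  also have "\<dots> = ennreal B * (\<integral>\<^sup>+\<xi>. (norm (ft f \<xi>))\<^sup>2 \<partial>lborel)"
    by (rule nn_integral_cmult) measurable
  also have "\<dots> \<le> ennreal B * (ennreal ((2 * pi) ^ DIM('a)) * (\<integral>\<^sup>+x. (norm (f x))\<^sup>2 \<partial>lborel))"
    by (intro mult_left_mono nn_integral_norm_ft_power2_le f) auto
  also have "?d * (ennreal B * (ennreal ((2 * pi) ^ DIM('a)) * (\<integral>\<^sup>+x. (norm (f x))\<^sup>2 \<partial>lborel)))
     = (?d * ennreal ((2 * pi) ^ DIM('a))) * (ennreal B * (\<integral>\<^sup>+x. (norm (f x))\<^sup>2 \<partial>lborel))"
    by (simp only: ac_simps)
  also have "?d * ennreal ((2 * pi) ^ DIM('a)) = 1"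
    by (subst ennreal_mult[symmetric]) auto
  finally show ?thesis by (simp add: mult_left_mono)
qed

text \<open>A discrete Sobolev inequality: a squared norm exceeds the next one by at most twice the
  product of value and increment, which the weighted mean inequality splits into a difference term
  and a mass term. It trades a maximum over m for sums of squares, which Plancherel's inequality can
  handle.\<close>

lemma norm_power2_chain_le:
  fixes z :: "nat \<Rightarrow> complex" and w :: "nat \<Rightarrow> real"
  assumes w: "\<And>j. 0 \<le> w j" "\<And>j. w j = 0 \<Longrightarrow> z j = z (Suc j)" and m: "m \<le> n"
  shows "(norm (z m))\<^sup>2 \<le> (norm (z n))\<^sup>2 + (\<Sum>j<n. (norm (z j - z (Suc j)))\<^sup>2 / w j) + (\<Sum>j<n. w j * (norm (z j))\<^sup>2)"
proof -
  let ?t = "\<lambda>j. (norm (z j - z (Suc j)))\<^sup>2 / w j + w j * (norm (z j))\<^sup>2"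
  have step: "(norm (z j))\<^sup>2 \<le> (norm (z (Suc j)))\<^sup>2 + ?t j" for j
  proof (cases "w j = 0")
    case False
    then have wj: "0 < w j" using w(1)[of j] by simp
    define x y d where "x = norm (z j)" and "y = norm (z (Suc j))" and "d = norm (z j - z (Suc j))"
    have nn: "0 \<le> x" "0 \<le> y" "0 \<le> d" "x \<le> y + d"
      using norm_triangle_sub[of "z j" "z (Suc j)"] by (auto simp: x_def y_def d_def)
    have "x\<^sup>2 \<le> y\<^sup>2 + 2 * x * d"
    proof (cases "d \<le> x")
      case True
      have "(x - d)\<^sup>2 \<le> y\<^sup>2" using nn True by (intro power_mono) auto
      then have "x\<^sup>2 + d\<^sup>2 - 2 * x * d \<le> y\<^sup>2" by (simp add: power2_diff)
      moreover have "0 \<le> d\<^sup>2" by simp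
      ultimately show ?thesis by linarith
    next
      case False
      then have "x * x \<le> x * d" using nn by (intro mult_left_mono) auto
      moreover have "0 \<le> x * d" using nn by simp
      moreover have "0 \<le> y * y" by simp
      ultimately show ?thesis unfolding power2_eq_square mult.assoc by linarith
    qed
    also have "2 * x * d \<le> d\<^sup>2 / w j + w j * x\<^sup>2"
      using mult_le_weighted_squares[OF wj, of d x] wj by (simp add: field_simps)
    finally show ?thesis by (simp add: x_def y_def d_def)
  qed (use w in simp)
  have "(norm (z m))\<^sup>2 \<le> (norm (z n))\<^sup>2 + (\<Sum>j=m..<n. ?t j)"
    using m
  proof (induction n rule: dec_induct)
    case (step k)
    then show ?case using \<open>\<And>j. (norm (z j))\<^sup>2 \<le> (norm (z (Suc j)))\<^sup>2 + ?t j\<close>[of k] by simp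
  qed simp
  also have "(\<Sum>j=m..<n. ?t j) \<le> (\<Sum>j<n. ?t j)"
    using w(1) by (intro sum_mono2) auto
  finally show ?thesis by (simp add: sum.distrib)
qed

lemma mult_indicator_le_add:
  fixes a b c :: ennreal
  assumes "a \<le> b + c"
  shows "a * indicator A x \<le> b + c * indicator A x"
    and "a * indicator A x \<le> b * indicator A x + c * indicator A x"
  using assms by (auto split: split_indicator)

lemma ennreal_mult_add_collect:
  assumes "0 \<le> p" "0 \<le> q" "0 \<le> r" "0 \<le> t"
  shows "ennreal p * (ennreal q * (ennreal r * x)) + ennreal t * x = ennreal (p * (q * r) + t) * x"
  using assms by (simp add: ennreal_mult distrib_right mult.assoc)

text \<open>Assumption \<open>f2\<close> has the form satisfied by a function bounded by M on a set
  of B times the measure of A, so all contributions are multiples of that measure. Tails with a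
  common end n suffice, as a sum over a window is the difference of two of them.\<close>

theorem nn_integral_max_tail_le:
  fixes f :: "'a::euclidean_space \<Rightarrow> complex" and v a :: "nat \<Rightarrow> real"
  assumes \<alpha>: "0 < \<alpha>" "\<alpha> < 1" and f: "integrable lborel f"
    and a: "\<And>j. 0 < a j" "mono a" and v: "\<And>j. \<bar>v j\<bar> \<le> V" and V: "0 < V" and M: "0 < M" and B: "0 \<le> B"
    and A: "A \<in> sets borel" "emeasure lborel A < \<infinity>"
    and f2: "(\<integral>\<^sup>+x. (norm (f x))\<^sup>2 \<partial>lborel) \<le> ennreal (B * M\<^sup>2) * emeasure lborel A"
  shows "(\<integral>\<^sup>+x\<in>A. (SUP m\<in>{..n}. ennreal (norm (\<Sum>j=m..<n. v j * (fheat \<alpha> (a (Suc j)) f x - fheat \<alpha> (a j) f x)))) \<partial>lborel)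
    \<le> ennreal (V * M * ((19 + 2 / \<alpha>) * B / 2 + 1 / 2 + B / 2 + sqrt 2 ^ DIM('a))) * emeasure lborel A"
proof -
  let ?T = "\<lambda>m x. \<Sum>j=m..<n. v j * (fheat \<alpha> (a (Suc j)) f x - fheat \<alpha> (a j) f x)"
  have [measurable]: "f \<in> borel_measurable borel" using f by auto
  have [measurable]: "A \<in> sets borel" by (rule A)
  define b where "b = 1 / \<alpha>"
  have b: "1 \<le> b" using \<alpha> by (simp add: b_def)
  note ctx = a v b
  let ?q = "\<lambda>m. tail_symbol v a n m" and ?g = "\<lambda>m. tail_gap_symbol b v a n m"
  let ?p = "\<lambda>\<xi>::'a. norm \<xi> powr (2 * \<alpha>)"
  have q_meas[measurable]: "?q m \<in> borel_measurable borel" for m unfolding tail_symbol_def by measurable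
  have g_meas[measurable]: "?g m \<in> borel_measurable borel" for m unfolding tail_gap_symbol_def by measurable
  have am: "a 0 \<le> a m" for m using a(2) by (simp add: monoD)
  have q_le: "\<bar>?q m l\<bar> \<le> V * exp (- (a 0 * l))" if "m \<le> n" "0 \<le> l" for m l
  proof -
    have "V * exp (- (a m * l)) \<le> V * exp (- (a 0 * l))" using am[of m] that V by (simp add: mult_right_mono)
    then show ?thesis using abs_tail_symbol_le[where a = a and v = v, OF ctx that] by linarith
  qed
  have g_le: "\<bar>?g m l\<bar> \<le> (2 * V) * exp (- (a 0 * l))" if "m \<le> n" "0 \<le> l" for m l
  proof -
    have "\<bar>exp (- ((a m * l) powr b)) * ?q 0 l\<bar> \<le> 1 * (V * exp (- (a 0 * l)))"
      unfolding abs_mult using q_le[of 0 l] that by (intro mult_mono) auto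
    then show ?thesis using q_le[OF that] unfolding tail_gap_symbol_def by linarith
  qed
  define S where "S m = fmult \<alpha> (?q m) f" for m
  define G where "G m = fmult \<alpha> (?g m) f" for m
  let ?k = "\<lambda>\<xi>::'a. complex_of_real (?q 0 (?p \<xi>)) * ft f \<xi>"
  define W where "W m = ift (\<lambda>\<xi>. exp (- (a m powr b) * (norm \<xi>)\<^sup>2) * ?k \<xi>)" for m
  have [measurable]: "S m \<in> borel_measurable borel" "G m \<in> borel_measurable borel" "W m \<in> borel_measurable borel" for m
    unfolding S_def G_def W_def by measurable
  have S_int: "integrable lborel (\<lambda>\<xi>::'a. complex_of_real (?q m (?p \<xi>)) * ft f \<xi>)" if "m \<le> n" for m
    by (rule integrable_fmult[OF \<alpha>(1) f q_meas a(1)[of 0] q_le[OF that]])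
  have G_int: "integrable lborel (\<lambda>\<xi>::'a. complex_of_real (?g m (?p \<xi>)) * ft f \<xi>)" if "m \<le> n" for m
    by (rule integrable_fmult[OF \<alpha>(1) f g_meas a(1)[of 0] g_le[OF that]])
  have SGW: "S m x = G m x + W m x" if m: "m \<le> n" for m x
  proof -
    have "W m x = ift (\<lambda>\<xi>. complex_of_real (?q m (?p \<xi>)) * ft f \<xi> - complex_of_real (?g m (?p \<xi>)) * ft f \<xi>) x"
      unfolding W_def
    proof (rule arg_cong[where f = "\<lambda>h. ift h x"], rule ext)
      fix \<xi> :: 'a
      \<comment> \<open>The exponents \<open>2 * \<alpha>\<close> and
        \<open>b = 1 / \<alpha>\<close> combine to 2; this is what makes the comparison factor a
        genuine Gaussian in \<open>\<xi>\<close>.\<close>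
      have "(a m * ?p \<xi>) powr b = a m powr b * (norm \<xi>)\<^sup>2"
      proof -
        have "(?p \<xi>) powr b = (norm \<xi>)\<^sup>2"
          using \<alpha> by (cases "\<xi> = 0") (simp_all add: powr_powr b_def powr_numeral)
        then show ?thesis using a(1)[of m] by (simp add: powr_mult)
      qed
      then show "exp (- (a m powr b) * (norm \<xi>)\<^sup>2) * ?k \<xi> =
        complex_of_real (?q m (?p \<xi>)) * ft f \<xi> - complex_of_real (?g m (?p \<xi>)) * ft f \<xi>"
        by (simp add: tail_gap_symbol_def algebra_simps)
    qed
    also have "\<dots> = S m x - G m x"
      unfolding S_def G_def fmult_def by (rule ift_diff[OF S_int[OF m] G_int[OF m]])
    finally show ?thesis by simp
  qed
  have S_eq: "(?T m x) = S m x" if "m \<le> n" for m x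
  proof -
    have e: "integrable lborel (\<lambda>\<xi>::'a. complex_of_real (exp (- (a j * ?p \<xi>))) * ft f \<xi>)" for j
      by (rule integrable_fmult[OF \<alpha>(1) f _ a(1)[of j], where K = 1]) auto
    define h where "h j \<xi> = cis (x \<bullet> \<xi>) * (complex_of_real (exp (- (a j * ?p \<xi>))) * ft f \<xi>)" for j \<xi>
    have h: "integrable lborel (h j)" for j
      unfolding h_def by (intro integrable_cis_mult e) measurable
    have fh: "fheat \<alpha> (a j) f x = (\<integral>\<xi>. h j \<xi> \<partial>lborel) / (2 * pi) ^ DIM('a)" for j
      by (simp add: fheat_def ift_def h_def)
    have "S m x = (\<integral>\<xi>. (\<Sum>j=m..<n. v j * (h (Suc j) \<xi> - h j \<xi>)) \<partial>lborel) / (2 * pi) ^ DIM('a)"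
      unfolding S_def fmult_def ift_def tail_symbol_def h_def
      by (simp add: sum_distrib_left sum_distrib_right algebra_simps)
    also have "(\<integral>\<xi>. (\<Sum>j=m..<n. v j * (h (Suc j) \<xi> - h j \<xi>)) \<partial>lborel) = (\<Sum>j=m..<n. \<integral>\<xi>. v j * (h (Suc j) \<xi> - h j \<xi>) \<partial>lborel)"
      by (intro Bochner_Integration.integral_sum integrable_mult_right Bochner_Integration.integrable_diff h)
    also have "\<dots> = (\<Sum>j=m..<n. v j * ((\<integral>\<xi>. h (Suc j) \<xi> \<partial>lborel) - (\<integral>\<xi>. h j \<xi> \<partial>lborel)))"
      by (intro sum.cong refl) (simp add: Bochner_Integration.integral_diff h)
    also have "\<dots> / (2 * pi) ^ DIM('a) = (?T m x)"
      unfolding fh sum_divide_distrib by (simp flip: diff_divide_distrib)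
    finally show ?thesis by simp
  qed
  define w where "w j = 1 - a j / a (Suc j)" for j
  have w: "0 \<le> w j" "w j \<le> 1" for j
    using a(1)[of j] a(1)[of "Suc j"] a(2) by (auto simp: w_def monoD)
  have w0: "w j = 0 \<Longrightarrow> a j = a (Suc j)" for j
    using a(1)[of "Suc j"] by (simp add: w_def)
  have g_w0: "?g j l = ?g (Suc j) l" if "w j = 0" "j < n" for j l
  proof -
    have "?q j l = v j * (exp (- (a (Suc j) * l)) - exp (- (a j * l))) + ?q (Suc j) l"
      unfolding tail_symbol_def using that(2) by (rule sum.atLeast_Suc_lessThan)
    then show ?thesis using w0[OF that(1)] by (simp add: tail_gap_symbol_def)
  qed
  have D_eq: "G j x - G (Suc j) x = fmult \<alpha> (\<lambda>l. ?g j l - ?g (Suc j) l) f x" if "j < n" for j x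
    unfolding G_def fmult_def using that
    by (subst ift_diff[symmetric]) (simp_all add: G_int left_diff_distrib)
  \<comment> \<open>A majorant for the squares of all \<open>G m\<close> at once: the right side of
    the chain inequality, with the relative gaps as weights.\<close>
  define Q where "Q x = (norm (G n x))\<^sup>2 + (\<Sum>j<n. (1 / w j) * (norm (fmult \<alpha> (\<lambda>l. ?g j l - ?g (Suc j) l) f x))\<^sup>2) + (\<Sum>j<n. w j * (norm (G j x))\<^sup>2)" for x
  have Q_nonneg: "0 \<le> Q x" for x
    unfolding Q_def using w by (intro add_nonneg_nonneg sum_nonneg mult_nonneg_nonneg) auto
  have Q_meas[measurable]: "Q \<in> borel_measurable borel"
    unfolding Q_def by measurable
  have G_Q: "(norm (G m x))\<^sup>2 \<le> Q x" if m: "m \<le> n" for m x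
  proof -
    \<comment> \<open>The chain inequality asks for equal neighbours at vanishing weights for every
      index; a sequence that is constant from n on satisfies this beyond n as well.\<close>
    define z where "z j = (if j \<le> n then G j x else G n x)" for j
    have z: "z j = z (Suc j)" if "w j = 0" for j
    proof (cases "j < n")
      case True
      then have "?g j = ?g (Suc j)" using g_w0[OF that True] by (intro ext)
      then show ?thesis using True by (simp add: z_def G_def)
    qed (auto simp: z_def)
    have "(norm (z m))\<^sup>2 \<le> (norm (z n))\<^sup>2 + (\<Sum>j<n. (norm (z j - z (Suc j)))\<^sup>2 / w j) + (\<Sum>j<n. w j * (norm (z j))\<^sup>2)"
      by (rule norm_power2_chain_le[where z = z and w = w, OF w(1) z m])
    also have "(\<Sum>j<n. (norm (z j - z (Suc j)))\<^sup>2 / w j) = (\<Sum>j<n. (1 / w j) * (norm (fmult \<alpha> (\<lambda>l. ?g j l - ?g (Suc j) l) f x))\<^sup>2)"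
      by (intro sum.cong refl) (simp add: z_def D_eq)
    also have "(\<Sum>j<n. w j * (norm (z j))\<^sup>2) = (\<Sum>j<n. w j * (norm (G j x))\<^sup>2)"
      by (intro sum.cong refl) (simp add: z_def)
    finally show ?thesis using m by (simp add: Q_def z_def)
  qed
  let ?f2 = "\<integral>\<^sup>+x. (norm (f x))\<^sup>2 \<partial>lborel"
  \<comment> \<open>The constant collects 1 from the end term, \<open>2 * (1 + b)\<close> from the
    differences and 16 from the weighted squares.\<close>
  have Q_int: "(\<integral>\<^sup>+x. ennreal (Q x) \<partial>lborel) \<le> ennreal ((19 + 2 * b) * V\<^sup>2) * ?f2"
  proof -
    have 1: "(\<integral>\<^sup>+x. ennreal (\<Sum>i\<in>{n}. 1 * (norm (fmult \<alpha> (?g i) f x))\<^sup>2) \<partial>lborel) \<le> ennreal (V\<^sup>2) * ?f2"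
      by (rule square_function_le[OF \<alpha>(1) f _ g_meas g_le a(1)[of 0]]) (auto intro: tail_gap_symbol_n_power2_le[where a = a and v = v, OF ctx])
    have 2: "(\<integral>\<^sup>+x. ennreal (\<Sum>j\<in>{..<n}. (1 / w j) * (norm (fmult \<alpha> (\<lambda>l. ?g j l - ?g (Suc j) l) f x))\<^sup>2) \<partial>lborel) \<le> ennreal (2 * (1 + b) * V\<^sup>2) * ?f2"
    proof (rule square_function_le[OF \<alpha>(1) f, where c = "a 0" and K = "4 * V"])
      show "\<bar>?g j l - ?g (Suc j) l\<bar> \<le> 4 * V * exp (- (a 0 * l))" if "j \<in> {..<n}" "0 \<le> l" for j l
        using g_le[of j l] g_le[of "Suc j" l] that by auto
      show "(\<Sum>j\<in>{..<n}. (1 / w j) * (?g j l - ?g (Suc j) l)\<^sup>2) \<le> 2 * (1 + b) * V\<^sup>2" if "0 \<le> l" for l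
        using sum_tail_gap_symbol_diff_power2_le[where a = a and v = v, OF ctx that, of n] by (simp add: w_def)
    qed (use w a in auto)
    have 3: "(\<integral>\<^sup>+x. ennreal (\<Sum>j\<in>{..<n}. w j * (norm (fmult \<alpha> (?g j) f x))\<^sup>2) \<partial>lborel) \<le> ennreal (16 * V\<^sup>2) * ?f2"
      using sum_tail_gap_symbol_power2_le[where a = a and v = v, OF ctx, of _ n] w
      by (intro square_function_le[OF \<alpha>(1) f _ g_meas g_le a(1)[of 0]]) (auto simp: w_def)
    have "(\<integral>\<^sup>+x. ennreal (Q x) \<partial>lborel) = (\<integral>\<^sup>+x. ennreal (\<Sum>i\<in>{n}. 1 * (norm (fmult \<alpha> (?g i) f x))\<^sup>2)
      + ennreal (\<Sum>j\<in>{..<n}. (1 / w j) * (norm (fmult \<alpha> (\<lambda>l. ?g j l - ?g (Suc j) l) f x))\<^sup>2)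
      + ennreal (\<Sum>j\<in>{..<n}. w j * (norm (fmult \<alpha> (?g j) f x))\<^sup>2) \<partial>lborel)"
      using w by (intro nn_integral_cong) (simp add: Q_def G_def sum_nonneg flip: ennreal_plus)
    also have "\<dots> \<le> ennreal (V\<^sup>2) * ?f2 + ennreal (2 * (1 + b) * V\<^sup>2) * ?f2 + ennreal (16 * V\<^sup>2) * ?f2"
      using 1 2 3 by (subst nn_integral_add, measurable, subst nn_integral_add, measurable) (intro add_mono; simp)
    also have "\<dots> = ennreal (V\<^sup>2 + 2 * (1 + b) * V\<^sup>2 + 16 * V\<^sup>2) * ?f2"
      using b by (simp add: distrib_right[symmetric] flip: ennreal_plus)
    also have "V\<^sup>2 + 2 * (1 + b) * V\<^sup>2 + 16 * V\<^sup>2 = (19 + 2 * b) * V\<^sup>2" by (simp add: algebra_simps)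
    finally show ?thesis .
  qed
  \<comment> \<open>This weight balances the two terms of the mean inequality: the squared side is
    of size \<open>(V * M)^2\<close> times the measure of A, so that after division by
    \<open>\<kappa>\<close> both terms are linear in \<open>V * M\<close>.\<close>
  define \<kappa> where "\<kappa> = V * M"
  have \<kappa>: "0 < \<kappa>" using V M by (simp add: \<kappa>_def)
  let ?A = "emeasure lborel A"
  let ?SG = "\<lambda>x. SUP m\<in>{..n}. ennreal (norm (G m x))"
  have G_part: "(\<integral>\<^sup>+x\<in>A. ?SG x \<partial>lborel) \<le> ennreal (\<kappa> * ((19 + 2 * b) * B / 2 + 1 / 2)) * ?A"
  proof -
    have "(\<integral>\<^sup>+x\<in>A. ?SG x \<partial>lborel) \<le> (\<integral>\<^sup>+x. ennreal (1 / (2 * \<kappa>)) * ennreal (Q x) + ennreal (\<kappa> / 2) * indicator A x \<partial>lborel)"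
    proof (intro nn_integral_mono)
      fix x
      have "?SG x \<le> ennreal (1 / (2 * \<kappa>)) * ennreal (Q x) + ennreal (\<kappa> / 2)"
      proof (intro SUP_least)
        fix m assume "m \<in> {..n}"
        then have "(norm (G m x))\<^sup>2 / (2 * \<kappa>) \<le> Q x / (2 * \<kappa>)"
          using G_Q[of m x] \<kappa> by (intro divide_right_mono) auto
        then have "norm (G m x) \<le> 1 / (2 * \<kappa>) * Q x + \<kappa> / 2 * 1"
          using mult_le_weighted_squares[OF \<kappa>, of "norm (G m x)" 1] by simp
        also have "ennreal \<dots> = ennreal (1 / (2 * \<kappa>)) * ennreal (Q x) + ennreal (\<kappa> / 2) * ennreal 1"
          using \<kappa> Q_nonneg[of x] by (intro ennreal_lincomb) auto
        finally show "ennreal (norm (G m x)) \<le> ennreal (1 / (2 * \<kappa>)) * ennreal (Q x) + ennreal (\<kappa> / 2)"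
          by (simp add: ennreal_leI)
      qed
      then show "?SG x * indicator A x \<le> ennreal (1 / (2 * \<kappa>)) * ennreal (Q x) + ennreal (\<kappa> / 2) * indicator A x"
        by (rule mult_indicator_le_add)
    qed
    also have "\<dots> = ennreal (1 / (2 * \<kappa>)) * (\<integral>\<^sup>+x. ennreal (Q x) \<partial>lborel) + ennreal (\<kappa> / 2) * ?A"
      by (subst nn_integral_add) (simp_all add: nn_integral_cmult)
    also have "\<dots> \<le> ennreal (1 / (2 * \<kappa>)) * (ennreal ((19 + 2 * b) * V\<^sup>2) * (ennreal (B * M\<^sup>2) * ?A)) + ennreal (\<kappa> / 2) * ?A"
      by (intro add_right_mono mult_left_mono order_trans[OF Q_int] f2) auto
    also have "\<dots> = ennreal (1 / (2 * \<kappa>) * ((19 + 2 * b) * V\<^sup>2 * (B * M\<^sup>2)) + \<kappa> / 2) * ?A"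
      using \<kappa> b B by (intro ennreal_mult_add_collect) auto
    also have "(19 + 2 * b) * V\<^sup>2 * (B * M\<^sup>2) = \<kappa>\<^sup>2 * ((19 + 2 * b) * B)"
      by (simp only: \<kappa>_def power_mult_distrib ac_simps)
    also have "1 / (2 * \<kappa>) * (\<kappa>\<^sup>2 * ((19 + 2 * b) * B)) + \<kappa> / 2 = \<kappa> * ((19 + 2 * b) * B / 2 + 1 / 2)"
      using \<kappa> unfolding distrib_left by (simp add: power2_eq_square)
    finally show ?thesis .
  qed
  let ?SW = "\<lambda>x. SUP m\<in>{..n}. ennreal (norm (W m x))"
  have W_part: "(\<integral>\<^sup>+x\<in>A. ?SW x \<partial>lborel) \<le> ennreal (\<kappa> * (B / 2 + sqrt 2 ^ DIM('a))) * ?A"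
  proof -
    let ?c = "(2 * pi) ^ DIM('a)"
    have "(\<integral>\<^sup>+x\<in>A. ?SW x \<partial>lborel) \<le>
      ennreal (1 / (2 * \<kappa> * ?c)) * (\<integral>\<^sup>+\<xi>. (norm (?k \<xi>))\<^sup>2 \<partial>lborel) + ennreal (\<kappa> * sqrt 2 ^ DIM('a)) * ?A"
    proof -
      have "a m \<noteq> 0" for m using a(1)[of m] by simp
      then show ?thesis
        unfolding W_def by (intro nn_integral_max_gaussian_multiplier_le S_int[of 0] A \<kappa>) simp_all
    qed
    also have "(\<integral>\<^sup>+\<xi>. (norm (?k \<xi>))\<^sup>2 \<partial>lborel) \<le> (\<integral>\<^sup>+\<xi>. ennreal (V\<^sup>2) * ennreal ((norm (ft f \<xi>))\<^sup>2) \<partial>lborel)"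
    proof (intro nn_integral_mono)
      fix \<xi> :: 'a
      have "(?q 0 (?p \<xi>))\<^sup>2 \<le> V\<^sup>2"
        using abs_tail_symbol_le_V[where a = a and v = v, OF ctx, of 0 n "?p \<xi>"] V by (intro power2_le_iff_abs_le[THEN iffD2]) auto
      then have "(norm (?k \<xi>))\<^sup>2 \<le> V\<^sup>2 * (norm (ft f \<xi>))\<^sup>2"
        by (simp add: norm_mult power_mult_distrib mult_right_mono)
      then show "ennreal ((norm (?k \<xi>))\<^sup>2) \<le> ennreal (V\<^sup>2) * ennreal ((norm (ft f \<xi>))\<^sup>2)"
        by (simp add: ennreal_leI flip: ennreal_mult)
    qed
    also have "\<dots> = ennreal (V\<^sup>2) * (\<integral>\<^sup>+\<xi>. ennreal ((norm (ft f \<xi>))\<^sup>2) \<partial>lborel)"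
      by (rule nn_integral_cmult) measurable
    also have "\<dots> \<le> ennreal (V\<^sup>2) * (ennreal ?c * (ennreal (B * M\<^sup>2) * ?A))"
      by (intro mult_left_mono order_trans[OF nn_integral_norm_ft_power2_le[OF f]] f2) auto
    also have "ennreal (1 / (2 * \<kappa> * ?c)) * \<dots> + ennreal (\<kappa> * sqrt 2 ^ DIM('a)) * ?A
       = ennreal (1 / (2 * \<kappa> * ?c)) * (ennreal (V\<^sup>2 * ?c) * (ennreal (B * M\<^sup>2) * ?A)) + ennreal (\<kappa> * sqrt 2 ^ DIM('a)) * ?A"
      by (simp add: ennreal_mult mult.assoc)
    also have "\<dots> = ennreal (1 / (2 * \<kappa> * ?c) * (V\<^sup>2 * ?c * (B * M\<^sup>2)) + \<kappa> * sqrt 2 ^ DIM('a)) * ?A"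
      using \<kappa> B by (intro ennreal_mult_add_collect) auto
    also have "V\<^sup>2 * ?c * (B * M\<^sup>2) = \<kappa>\<^sup>2 * ?c * B"
      by (simp only: \<kappa>_def power_mult_distrib ac_simps)
    also have "1 / (2 * \<kappa> * ?c) * (\<kappa>\<^sup>2 * ?c * B) + \<kappa> * sqrt 2 ^ DIM('a) = \<kappa> * (B / 2 + sqrt 2 ^ DIM('a))"
      using \<kappa> unfolding distrib_left by (simp add: power2_eq_square)
    finally show ?thesis by (simp add: mult_left_mono add_right_mono)
  qed
  have "(\<integral>\<^sup>+x\<in>A. (SUP m\<in>{..n}. ennreal (norm (?T m x))) \<partial>lborel)
    \<le> (\<integral>\<^sup>+x. ?SG x * indicator A x + ?SW x * indicator A x \<partial>lborel)"
  proof (intro nn_integral_mono)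
    fix x
    have "(SUP m\<in>{..n}. ennreal (norm (?T m x))) \<le>
      ?SG x + ?SW x"
    proof (intro SUP_least)
      fix m assume m: "m \<in> {..n}"
      have "ennreal (norm (?T m x)) \<le> ennreal (norm (G m x)) + ennreal (norm (W m x))"
        using m by (simp add: S_eq SGW norm_triangle_ineq ennreal_leI flip: ennreal_plus)
      also have "\<dots> \<le> ?SG x + ?SW x"
        by (intro add_mono SUP_upper m)
      finally show "ennreal (norm (?T m x)) \<le> \<dots>" .
    qed
    then show "(SUP m\<in>{..n}. ennreal (norm (?T m x))) * indicator A x \<le>
      ?SG x * indicator A x + ?SW x * indicator A x"
      by (rule mult_indicator_le_add)
  qed
  also have "\<dots> \<le> ennreal (\<kappa> * ((19 + 2 * b) * B / 2 + 1 / 2)) * ?A + ennreal (\<kappa> * (B / 2 + sqrt 2 ^ DIM('a))) * ?A"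
    using G_part W_part by (subst nn_integral_add) (auto intro: add_mono)
  also have "\<dots> = ennreal (\<kappa> * ((19 + 2 * b) * B / 2 + 1 / 2) + \<kappa> * (B / 2 + sqrt 2 ^ DIM('a))) * ?A"
    using \<kappa> b B by (subst ennreal_plus) (auto simp: distrib_right)
  also have "\<kappa> * ((19 + 2 * b) * B / 2 + 1 / 2) + \<kappa> * (B / 2 + sqrt 2 ^ DIM('a)) = V * M * ((19 + 2 / \<alpha>) * B / 2 + 1 / 2 + B / 2 + sqrt 2 ^ DIM('a))"
    by (simp add: \<kappa>_def b_def algebra_simps)
  finally show ?thesis .
qed

section \<open>Far and near contributions\<close>

lemma sum_telescope_int:
  fixes g :: "int \<Rightarrow> 'b::ab_group_add"
  assumes "l \<le> u + 1"
  shows "(\<Sum>j=l..u. g (j + 1) - g j) = g (u + 1) - g l"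
proof -
  have "l - 1 \<le> u" using assms by simp
  then show ?thesis
  proof (induction u rule: int_ge_induct)
    case (step i)
    have "{l..i + 1} = insert (i + 1) {l..i}" using step.hyps by auto
    then show ?case using step.IH by simp
  qed simp
qed

lemma integrable_exp_ft:
  fixes f :: "'a::euclidean_space \<Rightarrow> complex"
  assumes "0 < \<alpha>" "0 < t" "integrable lborel f"
  shows "integrable lborel (\<lambda>\<xi>::'a. complex_of_real (exp (- t * norm \<xi> powr (2 * \<alpha>))) * ft f \<xi>)"
  using integrable_fmult[OF assms(1,3) _ assms(2), of "\<lambda>l. exp (- (t * l))" 1] by simp

lemma ft_add:
  assumes "integrable lborel f" "integrable lborel g"
  shows "ft (\<lambda>x. f x + g x) \<xi> = ft f \<xi> + ft g \<xi>"
  unfolding ft_def distrib_left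
  by (intro Bochner_Integration.integral_add integrable_cis_mult assms) measurable

lemma fheat_add:
  fixes f g :: "'a::euclidean_space \<Rightarrow> complex"
  assumes "0 < \<alpha>" "0 < t" "integrable lborel f" "integrable lborel g"
  shows "fheat \<alpha> t (\<lambda>x. f x + g x) x = fheat \<alpha> t f x + fheat \<alpha> t g x"
  unfolding fheat_def ift_def ft_add[OF assms(3,4)] distrib_left
  by (subst Bochner_Integration.integral_add)
     (auto intro!: integrable_cis_mult integrable_exp_ft[OF assms(1,2,3), simplified] integrable_exp_ft[OF assms(1,2,4), simplified] simp: add_divide_distrib)

text \<open>Relative gaps sum to a logarithm, which is unbounded over all large times. For
  integrable f the increments are instead dominated by those of a decreasing function of t, whose
  sum stays finite.\<close>

lemma norm_fheat_diff_le_large: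
  fixes f :: "'a::euclidean_space \<Rightarrow> complex"
  assumes \<alpha>: "0 < \<alpha>" and t: "0 < t" "t \<le> t'" and f: "integrable lborel f"
  shows "norm (fheat \<alpha> t' f x - fheat \<alpha> t f x) \<le> (\<integral>y. norm (f y) \<partial>lborel) / (2 * pi) ^ DIM('a) *
    ((\<integral>(\<xi>::'a). exp (- t * norm \<xi> powr (2 * \<alpha>)) \<partial>lborel) - (\<integral>(\<xi>::'a). exp (- t' * norm \<xi> powr (2 * \<alpha>)) \<partial>lborel))"
proof -
  let ?e = "\<lambda>t (\<xi>::'a). exp (- t * norm \<xi> powr (2 * \<alpha>))"
  have t': "0 < t'" using t by simp
  let ?I = "\<integral>y. norm (f y) \<partial>lborel"
  let ?c = "(2 * pi) ^ DIM('a)"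
  let ?k = "\<lambda>t \<xi>::'a. complex_of_real (?e t \<xi>) * ft f \<xi>"
  have E: "integrable lborel (\<lambda>\<xi>::'a. exp (- s * norm \<xi> powr (2 * \<alpha>)))" if "0 < s" for s
    using \<alpha> that by (intro integrable_exp_norm_powr) auto
  have int: "integrable lborel (?k t)" "integrable lborel (?k t')"
    using integrable_exp_ft[OF \<alpha> _ f] t t' by blast+
  have "norm (fheat \<alpha> t' f x - fheat \<alpha> t f x) = norm (ift (\<lambda>\<xi>. ?k t' \<xi> - ?k t \<xi>) x)"
    unfolding fheat_def by (subst ift_diff) (use int in simp_all)
  also have "\<dots> \<le> (\<integral>\<xi>. norm (?k t' \<xi> - ?k t \<xi>) \<partial>lborel) / ?c"
    using int by (intro norm_ift_le Bochner_Integration.integrable_diff)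
  also have "(\<integral>\<xi>. norm (?k t' \<xi> - ?k t \<xi>) \<partial>lborel) \<le> (\<integral>(\<xi>::'a). ?I * (?e t \<xi> - ?e t' \<xi>) \<partial>lborel)"
  proof (intro integral_mono)
    fix \<xi> :: 'a
    have le: "?e t' \<xi> \<le> ?e t \<xi>"
      using t by (simp add: mult_right_mono)
    have "?k t' \<xi> - ?k t \<xi> = complex_of_real (?e t' \<xi> - ?e t \<xi>) * ft f \<xi>"
      by (simp add: algebra_simps)
    then have "norm (?k t' \<xi> - ?k t \<xi>) = (?e t \<xi> - ?e t' \<xi>) * norm (ft f \<xi>)"
      using le by (simp only: norm_mult norm_of_real) simp
    also have "\<dots> \<le> (?e t \<xi> - ?e t' \<xi>) * ?I"
      using le by (intro mult_left_mono norm_ft_le f) auto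
    finally show "norm (?k t' \<xi> - ?k t \<xi>) \<le> ?I * (?e t \<xi> - ?e t' \<xi>)"
      by (simp only: mult.commute)
  qed (use int E t t' in \<open>auto intro!: integrable_mult_right Bochner_Integration.integrable_diff integrable_norm\<close>)
  also have "\<dots> = ?I * ((\<integral>(\<xi>::'a). ?e t \<xi> \<partial>lborel) - (\<integral>(\<xi>::'a). ?e t' \<xi> \<partial>lborel))"
    unfolding integral_mult_right_zero by (subst Bochner_Integration.integral_diff) (use E t t' in auto)
  finally show ?thesis by (simp add: divide_right_mono)
qed

section \<open>Weighted sums of coefficients in lp\<close>

lemma in_lp_abs_le_lp_norm:
  assumes p: "1 \<le> p" and v: "in_lp p v"
  shows "\<bar>v j\<bar> \<le> lp_norm p v"
proof (cases "p = \<infinity>")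
  case True
  then have "bdd_above (range (\<lambda>j. \<bar>v j\<bar>))"
    using v by (auto simp: in_lp_def bounded_iff bdd_above_def)
  then show ?thesis using True by (auto simp: lp_norm_def intro: cSUP_upper)
next
  case False
  define q where "q = real_of_ereal p"
  have q: "1 \<le> q" using p False unfolding q_def by (cases p) auto
  have "\<bar>v j\<bar> powr q = (\<Sum>i\<in>{j}. \<bar>v i\<bar> powr q)" by simp
  also have "\<dots> \<le> (\<Sum>\<^sub>\<infinity>i. \<bar>v i\<bar> powr q)"
    using v False by (intro finite_sum_le_infsum) (auto simp: in_lp_def q_def)
  finally have "(\<bar>v j\<bar> powr q) powr (1 / q) \<le> (\<Sum>\<^sub>\<infinity>i. \<bar>v i\<bar> powr q) powr (1 / q)"
    using q by (intro powr_mono2) auto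
  then show ?thesis using q False by (simp add: lp_norm_def q_def[symmetric] powr_powr)
qed

lemma sum_powr_le_lp_norm:
  assumes p: "1 \<le> p" "p \<noteq> \<infinity>" and v: "in_lp p v" and I: "finite I"
  shows "(\<Sum>j\<in>I. \<bar>v j\<bar> powr real_of_ereal p) \<le> lp_norm p v powr real_of_ereal p"
proof -
  define q where "q = real_of_ereal p"
  have q: "1 \<le> q" using p unfolding q_def by (cases p) auto
  have "(\<Sum>j\<in>I. \<bar>v j\<bar> powr q) \<le> (\<Sum>\<^sub>\<infinity>i. \<bar>v i\<bar> powr q)"
    using v p I by (intro finite_sum_le_infsum) (auto simp: in_lp_def q_def)
  also have "\<dots> = lp_norm p v powr q"
  proof -
    have "0 \<le> (\<Sum>\<^sub>\<infinity>i. \<bar>v i\<bar> powr q)" by (intro infsum_nonneg) auto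
    then show ?thesis using q p by (simp add: lp_norm_def q_def[symmetric] powr_powr)
  qed
  finally show ?thesis by (simp add: q_def)
qed

lemma conj_exponent_eq:
  assumes "1 \<le> p"
  shows "real_of_ereal (1 / conj_exponent p) = (if p = \<infinity> then 1 else 1 - 1 / real_of_ereal p)"
proof (cases p)
  case (real q)
  then have q: "1 \<le> q" using assms by simp
  show ?thesis
  proof (cases "q = 1")
    case False
    then have "p / (p - 1) = ereal (q / (q - 1))" using q real by (simp add: one_ereal_def)
    moreover have "p \<noteq> 1" using False real by (simp add: one_ereal_def)
    moreover have "1 / ereal (q / (q - 1)) = ereal (1 / (q / (q - 1)))" using q False by (simp add: one_ereal_def)
    ultimately show ?thesis using real q False by (simp add: conj_exponent_def field_simps)
  qed (use real in \<open>simp add: conj_exponent_def one_ereal_def[symmetric]\<close>)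
qed (use assms in \<open>auto simp: conj_exponent_def\<close>)

text \<open>Hoelder's inequality for weights known only through their supremum and their sum, whose
  norm for the conjugate exponent is then at most K times \<open>L powr (1 / p')\<close>. For finite
  p, cutting the coefficients at a threshold gives this with the factor 2; for infinite p the
  supremum can be taken out of the sum.\<close>

lemma sum_mult_le_lp_norm:
  fixes v b :: "int \<Rightarrow> real"
  assumes p: "1 \<le> p" and v: "in_lp p v" and I: "finite I"
    and b: "\<And>j. 0 \<le> b j" "\<And>j. b j \<le> K" "(\<Sum>j\<in>I. b j) \<le> K * L" and L: "1 \<le> L"
  shows "(\<Sum>j\<in>I. \<bar>v j\<bar> * b j) \<le> 2 * K * lp_norm p v * L powr real_of_ereal (1 / conj_exponent p)"
proof -
  let ?N = "lp_norm p v"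
  have K: "0 \<le> K" using b(1,2)[of 0] by linarith
  have vN: "\<bar>v j\<bar> \<le> ?N" for j by (rule in_lp_abs_le_lp_norm[OF p v])
  have N: "0 \<le> ?N" using vN[of 0] by linarith
  show ?thesis
  proof (cases "p = \<infinity>")
    case True
    have "(\<Sum>j\<in>I. \<bar>v j\<bar> * b j) \<le> (\<Sum>j\<in>I. ?N * b j)" by (intro sum_mono mult_right_mono vN b)
    also have "\<dots> \<le> ?N * (K * L)" unfolding sum_distrib_left[symmetric] by (intro mult_left_mono b N)
    also have "\<dots> \<le> 2 * (?N * (K * L))" using N K L by simp
    finally have le: "(\<Sum>j\<in>I. \<bar>v j\<bar> * b j) \<le> 2 * (?N * (K * L))" .
    have e: "real_of_ereal (1 / conj_exponent p) = 1" using True conj_exponent_eq[OF p] by simp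
    show ?thesis unfolding e using le L by (simp add: ac_simps)
  next
    case False
    define q where "q = real_of_ereal p"
    have q: "1 \<le> q" using p False unfolding q_def by (cases p) auto
    show ?thesis
    proof (cases "?N = 0")
      case True
      then have "v j = 0" for j using vN[of j] by simp
      then show ?thesis using True by simp
    next
      case False
      then have N: "0 < ?N" using N by simp
      \<comment> \<open>The threshold balances the contributions of the small and of the large coefficients.\<close>
      define A where "A = ?N * L powr (- (1 / q))"
      have A: "0 < A" using N L by (simp add: A_def)
      have v_le: "\<bar>v j\<bar> \<le> A + A powr (1 - q) * \<bar>v j\<bar> powr q" for j
      proof (cases "\<bar>v j\<bar> \<le> A")
        case True
        then show ?thesis by (smt (verit) mult_nonneg_nonneg powr_ge_zero)
      next
        case False
        then have vA: "A < \<bar>v j\<bar>" by simp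
        have "\<bar>v j\<bar> = \<bar>v j\<bar> powr (1 - q) * \<bar>v j\<bar> powr q" using vA A by (simp flip: powr_add)
        also have "\<dots> \<le> A powr (1 - q) * \<bar>v j\<bar> powr q"
          using vA A q by (intro mult_right_mono powr_mono2') auto
        finally show ?thesis using A by linarith
      qed
      have "(\<Sum>j\<in>I. \<bar>v j\<bar> * b j) \<le> (\<Sum>j\<in>I. A * b j + A powr (1 - q) * \<bar>v j\<bar> powr q * K)"
      proof (intro sum_mono)
        fix j
        have "\<bar>v j\<bar> * b j \<le> (A + A powr (1 - q) * \<bar>v j\<bar> powr q) * b j"
          by (intro mult_right_mono v_le b)
        also have "\<dots> = A * b j + A powr (1 - q) * \<bar>v j\<bar> powr q * b j" by (rule distrib_right)
        also have "\<dots> \<le> A * b j + A powr (1 - q) * \<bar>v j\<bar> powr q * K"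
          by (intro add_left_mono mult_left_mono b) auto
        finally show "\<bar>v j\<bar> * b j \<le> \<dots>" .
      qed
      also have "\<dots> = A * (\<Sum>j\<in>I. b j) + A powr (1 - q) * (\<Sum>j\<in>I. \<bar>v j\<bar> powr q) * K"
        by (simp add: sum.distrib sum_distrib_left sum_distrib_right)
      also have "\<dots> \<le> A * (K * L) + A powr (1 - q) * (?N powr q) * K"
        using A K b(3) sum_powr_le_lp_norm[OF p \<open>p \<noteq> \<infinity>\<close> v I]
        by (intro add_mono mult_left_mono mult_right_mono) (auto simp: q_def)
      also have "A * (K * L) = K * ?N * L powr (1 - 1 / q)"
        using L by (simp add: A_def powr_diff powr_minus_divide)
      also have "A powr (1 - q) * (?N powr q) = ?N * L powr (1 - 1 / q)"
      proof -
        have "A powr (1 - q) = ?N powr (1 - q) * L powr (- (1 / q) * (1 - q))"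
          using N L by (simp add: A_def powr_mult powr_powr)
        moreover have "?N powr (1 - q) * ?N powr q = ?N" using N by (simp flip: powr_add)
        moreover have "- (1 / q) * (1 - q) = 1 - 1 / q" using q by (simp add: field_simps)
        ultimately show ?thesis by (simp add: ac_simps)
      qed
      finally show ?thesis
        using \<open>p \<noteq> \<infinity>\<close> by (simp add: conj_exponent_eq[OF p] q_def[symmetric] ac_simps)
    qed
  qed
qed

section \<open>Passage to Borel representatives\<close>

lemma ex_borel_representative:
  fixes f :: "real ^ 'n \<Rightarrow> complex"
  assumes f: "in_linfty f" and supp: "AE x in lebesgue. x \<notin> ball 0 1 \<longrightarrow> f x = 0"
  obtains g where "g \<in> borel_measurable borel" "\<And>x. norm (g x) \<le> linfty_norm f" "\<And>x. x \<notin> ball 0 1 \<Longrightarrow> g x = 0"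
    "AE x in lebesgue. f x = g x" "0 \<le> linfty_norm f"
proof -
  have f_meas: "f \<in> borel_measurable lebesgue" and fin: "esssup lebesgue (\<lambda>x. ereal (norm (f x))) < \<infinity>"
    using f by (auto simp: in_linfty_def)
  let ?E = "esssup lebesgue (\<lambda>x. ereal (norm (f x)))"
  have "(0::ereal) = esssup (lebesgue :: (real ^ 'n) measure) (\<lambda>x. 0)"
    by (rule esssup_const[symmetric]) simp
  also have "\<dots> \<le> ?E" by (rule esssup_mono) auto
  finally have E0: "0 \<le> ?E" .
  then have E: "?E = ereal (linfty_norm f)" using fin by (cases ?E) (auto simp: linfty_norm_def)
  have M0: "0 \<le> linfty_norm f" using E0 unfolding E by simp
  have bd: "AE x in lebesgue. norm (f x) \<le> linfty_norm f"
    using esssup_AE[of "\<lambda>x. ereal (norm (f x))" lebesgue] unfolding E by simp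
  have "(\<lambda>x. Re (f x)) \<in> borel_measurable lebesgue" "(\<lambda>x. Im (f x)) \<in> borel_measurable lebesgue"
    using f_meas by measurable
  from this[THEN completion_ex_borel_measurable_real] obtain g1 g2
    where g: "g1 \<in> borel_measurable lborel" "AE x in lborel. Re (f x) = g1 x"
      "g2 \<in> borel_measurable lborel" "AE x in lborel. Im (f x) = g2 x"
    by blast
  define g0 where "g0 x = Complex (g1 x) (g2 x)" for x
  have g0_meas: "g0 \<in> borel_measurable borel"
    using g unfolding g0_def complex_eq_iff Complex_eq by measurable
  have ae: "AE x in lebesgue. f x = g0 x"
  proof (rule AE_completion)
    show "AE x in lborel. f x = g0 x" using g(2,4) by eventually_elim (simp add: g0_def complex_eq_iff)
  qed
  \<comment> \<open>Setting the function to 0 where the essential bound or the support condition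
    fails changes it on a null set only, and makes both conditions true at every point.\<close>
  define h where "h x = (if norm (g0 x) \<le> linfty_norm f \<and> norm x < 1 then g0 x else 0)" for x
  show ?thesis
  proof
    show "h \<in> borel_measurable borel" unfolding h_def using g0_meas by measurable
    show "AE x in lebesgue. f x = h x"
      using ae bd supp by eventually_elim (auto simp: h_def)
  qed (use M0 in \<open>auto simp: h_def\<close>)
qed

lemma fourier_eq_ft:
  assumes "f \<in> borel_measurable lebesgue" "g \<in> borel_measurable borel" "AE x in lebesgue. f x = g x"
  shows "fourier f \<xi> = ft g \<xi>"
proof -
  have [measurable]: "f \<in> borel_measurable lebesgue" by (rule assms)
  have [measurable]: "g \<in> borel_measurable borel" by (rule assms)
  have c: "(\<lambda>x. cis (- (x \<bullet> \<xi>))) \<in> borel_measurable lebesgue" by (rule measurable_completion) measurable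
  have gl: "(\<lambda>x. cis (- (x \<bullet> \<xi>)) * g x) \<in> borel_measurable lborel" by measurable
  have "fourier f \<xi> = (LINT x|lebesgue. cis (- (x \<bullet> \<xi>)) * g x)"
    unfolding fourier_def
  proof (rule integral_cong_AE)
    show "(\<lambda>x. cis (- (x \<bullet> \<xi>)) * f x) \<in> borel_measurable lebesgue" using c by measurable
    show "(\<lambda>x. cis (- (x \<bullet> \<xi>)) * g x) \<in> borel_measurable lebesgue" using gl by (rule measurable_completion)
    show "AE x in lebesgue. cis (- (x \<bullet> \<xi>)) * f x = cis (- (x \<bullet> \<xi>)) * g x" using assms(3) by eventually_elim simp
  qed
  also have "\<dots> = ft g \<xi>" unfolding ft_def by (rule integral_completion[OF gl])
  finally show ?thesis .
qed

text \<open>Equality holds at every point, although f and g agree only almost everywhere, because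
  the function enters through its Fourier transform alone.\<close>

lemma frac_heat_eq_fheat:
  fixes f g :: "real ^ 'n \<Rightarrow> complex"
  assumes f: "f \<in> borel_measurable lebesgue" and g[measurable]: "g \<in> borel_measurable borel" and ae: "AE x in lebesgue. f x = g x"
  shows "frac_heat \<alpha> t f = fheat \<alpha> t g"
proof (rule ext)
  fix x
  have "(LINT \<xi>|lebesgue. cis (x \<bullet> \<xi>) * (of_real (exp (- t * norm \<xi> powr (2 * \<alpha>))) * ft g \<xi>)) =
    (LINT \<xi>|lborel. cis (x \<bullet> \<xi>) * (of_real (exp (- t * norm \<xi> powr (2 * \<alpha>))) * ft g \<xi>))"
    by (rule integral_completion) measurable
  then show "frac_heat \<alpha> t f x = fheat \<alpha> t g x"
    by (simp add: frac_heat_def fourier_multiplier_def inverse_fourier_def fheat_def ift_def fourier_eq_ft[OF f g ae])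
qed

section \<open>Late times, and early times away from the ball\<close>

lemma one_le_ln_two_div:
  fixes r :: real
  assumes "0 < r" "2 * r < 1"
  shows "1 \<le> ln (2 / r)"
proof -
  have "exp 1 \<le> (3::real)" using exp_le by simp
  also have "3 \<le> 2 / r" using assms by (simp add: field_simps)
  finally show ?thesis using assms by (simp add: ln_ge_iff)
qed

text \<open>The first summand bounds a single increment. The second one is the variation from
  \<open>r powr (2 * \<alpha>)\<close> to 1, where \<open>\<alpha>\<close> cancels since the
  logarithm of the starting time contains the factor \<open>2 * \<alpha>\<close>. The third one is
  the variation beyond time 1 of a function on the unit ball.\<close>

definition far_const :: "'a::euclidean_space itself \<Rightarrow> real \<Rightarrow> real" where
  "far_const _ \<alpha> = heat_const TYPE('a) / \<alpha> + 2 * heat_const TYPE('a) +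
     measure lborel (ball (0::'a) 1) / (2 * pi) ^ DIM('a) * (\<integral>(\<xi>::'a). exp (- 1 * norm \<xi> powr (2 * \<alpha>)) \<partial>lborel)"

lemma heat_const_nonneg [simp]: "0 \<le> heat_const TYPE('a::euclidean_space)"
  by (simp add: heat_const_def)

text \<open>Taking the maximum with \<open>r powr (2 * \<alpha>)\<close> freezes the early times.
  The individual bounds and the bound for the sum are the two inputs of
  \<open>sum_mult_le_lp_norm\<close>, with L = \<open>ln (2 / r)\<close>.\<close>

lemma
  fixes g :: "'a::euclidean_space \<Rightarrow> complex" and a :: "int \<Rightarrow> real" and x :: 'a
  assumes \<alpha>: "0 < \<alpha>" "\<alpha> < 1" and g: "integrable lborel g" and M: "\<And>y. norm (g y) \<le> M"
    and supp: "\<And>y. y \<notin> ball 0 1 \<Longrightarrow> g y = 0" and a: "\<And>j. 0 < a j" "mono a" and r: "0 < r" "2 * r < 1"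
  defines "b \<equiv> \<lambda>j. norm (fheat \<alpha> (max (a (j + 1)) (r powr (2 * \<alpha>))) g x - fheat \<alpha> (max (a j) (r powr (2 * \<alpha>))) g x)"
  shows far_le: "b j \<le> M * far_const TYPE('a) \<alpha>"
    and sum_far_le: "l \<le> u + 1 \<Longrightarrow> (\<Sum>j=l..u. b j) \<le> M * far_const TYPE('a) \<alpha> * ln (2 / r)"
proof -
  define s where "s = r powr (2 * \<alpha>)"
  have s: "0 < s" "s \<le> 1" using r \<alpha> by (auto simp: s_def powr_le1)
  have M0: "0 \<le> M" using M[of 0] norm_ge_zero order_trans by blast
  let ?H = "heat_const TYPE('a)"
  define \<Phi> where "\<Phi> t = (\<integral>(\<xi>::'a). exp (- t * norm \<xi> powr (2 * \<alpha>)) \<partial>lborel)" for t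
  have \<Phi>0: "0 \<le> \<Phi> t" for t unfolding \<Phi>_def by (intro integral_nonneg_AE) auto
  have \<Phi>_mono: "\<Phi> t' \<le> \<Phi> t" if "0 < t" "t \<le> t'" for t t'
  proof -
    have E: "integrable lborel (\<lambda>\<xi>::'a. exp (- u * norm \<xi> powr (2 * \<alpha>)))" if "0 < u" for u
      using \<alpha> that by (intro integrable_exp_norm_powr) auto
    show ?thesis
      unfolding \<Phi>_def using that by (intro integral_mono E) (auto simp: mult_right_mono)
  qed
  define K where "K = measure lborel (ball (0::'a) 1) / (2 * pi) ^ DIM('a)"
  have K: "0 \<le> K" by (simp add: K_def)
  have fc: "far_const TYPE('a) \<alpha> = ?H / \<alpha> + 2 * ?H + K * \<Phi> 1"
    by (simp add: far_const_def K_def \<Phi>_def)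
  have fc': "?H / \<alpha> \<le> far_const TYPE('a) \<alpha>" using K \<Phi>0[of 1] by (simp add: fc)
  let ?F = "\<lambda>t. fheat \<alpha> t g x"
  have small: "norm (?F t' - ?F t) \<le> ?H * M / \<alpha> * (1 - t / t')" if "0 < t" "t \<le> t'" for t t'
    by (rule norm_fheat_diff_le[OF \<alpha> that g M])
  have mono_max: "max (a j) s \<le> max (a (j + 1)) s" for j
    using a(2) by (intro max.mono) (auto simp: monoD)
  have pos_max: "0 < max (a j) s" for j using s by auto
  have b_eq: "b j = norm (?F (max (a (j + 1)) s) - ?F (max (a j) s))" for j by (simp add: b_def s_def)
  have "?H * M / \<alpha> * (1 - t / t') \<le> M * far_const TYPE('a) \<alpha>" if "0 < t" "t \<le> t'" for t t'
  proof -
    have "?H * M / \<alpha> * (1 - t / t') \<le> ?H * M / \<alpha> * 1"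
      using that M0 \<alpha> by (intro mult_left_mono) auto
    also have "\<dots> = M * (?H / \<alpha>)" by simp
    also have "\<dots> \<le> M * far_const TYPE('a) \<alpha>" by (intro mult_left_mono fc' M0)
    finally show ?thesis .
  qed
  then show "b j \<le> M * far_const TYPE('a) \<alpha>"
    unfolding b_eq using small[OF pos_max mono_max] pos_max mono_max by (meson order_trans)
  have intg: "(\<integral>y. norm (g y) \<partial>lborel) \<le> M * measure lborel (ball (0::'a) 1)"
  proof -
    have "(\<integral>y. norm (g y) \<partial>lborel) \<le> (\<integral>(y::'a). M * indicator (ball 0 1) y \<partial>lborel)"
    proof (rule integral_mono)
      show "integrable lborel (\<lambda>y::'a. M * indicator (ball 0 1) y)"
        using emeasure_lborel_ball_finite[of "0::'a" 1] by (intro integrable_mult_right) simp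
    qed (use g M supp in \<open>auto simp: indicator_def\<close>)
    then show ?thesis by simp
  qed
  \<comment> \<open>A potential whose increments dominate those of the semigroup: up to time 1 it is
    a multiple of the logarithm, as \<open>1 - t / t'\<close> is at most
    \<open>ln t' - ln t\<close>; beyond time 1 it follows the decreasing integral of the symbol and
    stays bounded.\<close>
  define \<psi> where "\<psi> t = ?H * M / \<alpha> * ln (min t 1) - M * K * \<Phi> (max t 1)" for t
  have step: "norm (?F t' - ?F t) \<le> \<psi> t' - \<psi> t" if t: "0 < t" "t \<le> t'" for t t'
  proof -
    have "?F t' - ?F t = (?F (min t' 1) - ?F (min t 1)) + (?F (max t' 1) - ?F (max t 1))"
      using t by (auto simp: min_def max_def)
    then have "norm (?F t' - ?F t) \<le> norm (?F (min t' 1) - ?F (min t 1)) + norm (?F (max t' 1) - ?F (max t 1))"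
      by (simp add: norm_triangle_ineq)
    also have "norm (?F (min t' 1) - ?F (min t 1)) \<le> ?H * M / \<alpha> * (ln (min t' 1) - ln (min t 1))"
    proof -
      have p: "0 < min t 1" "min t 1 \<le> min t' 1" "0 < min t' 1" using t by auto
      have "ln (min t 1 / min t' 1) \<le> min t 1 / min t' 1 - 1" using p by (intro ln_le_minus_one) auto
      then have "1 - min t 1 / min t' 1 \<le> ln (min t' 1) - ln (min t 1)"
        using p by (simp add: ln_div)
      then have "?H * M / \<alpha> * (1 - min t 1 / min t' 1) \<le> ?H * M / \<alpha> * (ln (min t' 1) - ln (min t 1))"
        using M0 \<alpha> by (intro mult_left_mono) auto
      then show ?thesis using small[OF p(1,2)] by linarith
    qed
    also have "norm (?F (max t' 1) - ?F (max t 1)) \<le> M * K * (\<Phi> (max t 1) - \<Phi> (max t' 1))"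
    proof -
      have p: "0 < max t 1" "max t 1 \<le> max t' 1" using t by auto
      have le: "norm (?F (max t' 1) - ?F (max t 1)) \<le> (\<integral>y. norm (g y) \<partial>lborel) / (2 * pi) ^ DIM('a) * (\<Phi> (max t 1) - \<Phi> (max t' 1))"
        unfolding \<Phi>_def by (rule norm_fheat_diff_le_large[OF \<alpha>(1) p g])
      have "\<Phi> (max t' 1) \<le> \<Phi> (max t 1)"
        by (rule \<Phi>_mono[OF p])
      moreover have "(\<integral>y. norm (g y) \<partial>lborel) / (2 * pi) ^ DIM('a) \<le> M * K"
        using intg by (simp add: K_def divide_right_mono)
      ultimately have "(\<integral>y. norm (g y) \<partial>lborel) / (2 * pi) ^ DIM('a) * (\<Phi> (max t 1) - \<Phi> (max t' 1)) \<le> M * K * (\<Phi> (max t 1) - \<Phi> (max t' 1))"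
        by (intro mult_right_mono) auto
      then show ?thesis using le by linarith
    qed
    finally show ?thesis by (simp add: \<psi>_def right_diff_distrib)
  qed
  assume lu: "l \<le> u + 1"
  have "(\<Sum>j=l..u. b j) \<le> (\<Sum>j=l..u. \<psi> (max (a (j + 1)) s) - \<psi> (max (a j) s))"
    unfolding b_eq by (intro sum_mono step pos_max mono_max)
  also have "\<dots> = \<psi> (max (a (u + 1)) s) - \<psi> (max (a l) s)"
    by (rule sum_telescope_int[OF lu])
  also have "\<dots> \<le> M * (?H / \<alpha> * ln (1 / s) + K * \<Phi> 1)"
  proof -
    have "ln (min (max (a (u + 1)) s) 1) \<le> 0" using s by (subst ln_le_zero_iff) auto
    then have "?H * M / \<alpha> * ln (min (max (a (u + 1)) s) 1) \<le> 0"
      using M0 \<alpha> by (intro mult_nonneg_nonpos) auto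
    moreover have "0 \<le> M * K * \<Phi> (max (max (a (u + 1)) s) 1)"
      using M0 K \<Phi>0 by (intro mult_nonneg_nonneg) auto
    ultimately have 1: "\<psi> (max (a (u + 1)) s) \<le> 0" by (simp add: \<psi>_def)
    have "ln s \<le> ln (min (max (a l) s) 1)" using s by (subst ln_le_cancel_iff) auto
    then have 2: "?H * M / \<alpha> * ln s \<le> ?H * M / \<alpha> * ln (min (max (a l) s) 1)"
      using M0 \<alpha> by (intro mult_left_mono) auto
    have "\<Phi> (max (max (a l) s) 1) \<le> \<Phi> 1"
      by (rule \<Phi>_mono) auto
    then have 3: "M * K * \<Phi> (max (max (a l) s) 1) \<le> M * K * \<Phi> 1"
      using M0 K by (intro mult_left_mono) auto
    have "- \<psi> (max (a l) s) \<le> M * K * \<Phi> 1 - ?H * M / \<alpha> * ln s"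
      using 2 3 unfolding \<psi>_def by linarith
    also have "\<dots> = M * (?H / \<alpha> * ln (1 / s) + K * \<Phi> 1)"
      using s by (simp add: ln_div algebra_simps)
    finally show ?thesis using 1 by linarith
  qed
  also have "\<dots> \<le> M * (far_const TYPE('a) \<alpha> * ln (2 / r))"
  proof (intro mult_left_mono M0)
    have L: "ln (1 / r) \<le> ln (2 / r)" using r by (subst ln_le_cancel_iff) (auto simp: divide_right_mono)
    have L1: "1 \<le> ln (2 / r)" using one_le_ln_two_div[OF r] .
    have "?H / \<alpha> * ln (1 / s) = 2 * ?H * ln (1 / r)"
      using \<alpha> r by (simp add: s_def ln_div ln_powr)
    also have "\<dots> \<le> 2 * ?H * ln (2 / r)" by (intro mult_left_mono L) simp
    finally have A: "?H / \<alpha> * ln (1 / s) \<le> 2 * ?H * ln (2 / r)" .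
    have B: "K * \<Phi> 1 * 1 \<le> K * \<Phi> 1 * ln (2 / r)" using K \<Phi>0 L1 by (intro mult_left_mono mult_nonneg_nonneg)
    have C: "0 \<le> ?H / \<alpha> * ln (2 / r)" using \<alpha> L1 by (intro mult_nonneg_nonneg) auto
    show "?H / \<alpha> * ln (1 / s) + K * \<Phi> 1 \<le> far_const TYPE('a) \<alpha> * ln (2 / r)"
      unfolding fc distrib_right using A B C by linarith
  qed
  finally show "(\<Sum>j=l..u. b j) \<le> M * far_const TYPE('a) \<alpha> * ln (2 / r)" by (simp add: mult.assoc)
qed

text \<open>Where the function vanishes within distance r of x, an increment is at most a multiple
  of the time difference divided by \<open>r powr (2 * \<alpha>)\<close>. The times are stopped at
  that same scale, so the sum is bounded without any logarithm.\<close>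

lemma sum_near_off_diagonal_le:
  fixes g :: "'a::euclidean_space \<Rightarrow> complex" and v a :: "int \<Rightarrow> real"
  assumes \<alpha>: "0 < \<alpha>" "\<alpha> < 1" and g: "integrable lborel g" and M: "\<And>y. norm (g y) \<le> M"
    and g0: "\<And>y. norm (y - x) < r \<Longrightarrow> g y = 0" and a: "\<And>j. 0 < a j" "mono a" and r: "0 < r"
    and v: "\<And>j. \<bar>v j\<bar> \<le> V" and lu: "l \<le> u + 1"
  shows "(\<Sum>j=l..u. \<bar>v j\<bar> * norm (fheat \<alpha> (min (a (j + 1)) (r powr (2 * \<alpha>))) g x - fheat \<alpha> (min (a j) (r powr (2 * \<alpha>))) g x))
    \<le> V * (2 * heat_const TYPE('a) * M / \<alpha>)"
proof -
  define s where "s = r powr (2 * \<alpha>)"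
  let ?d = "\<lambda>j. fheat \<alpha> (min (a (j + 1)) s) g x - fheat \<alpha> (min (a j) s) g x"
  have s: "0 < s" using r by (simp add: s_def)
  have M0: "0 \<le> M" using M[of 0] norm_ge_zero order_trans by blast
  have V0: "0 \<le> V" using v[of 0] by linarith
  let ?c = "2 * heat_const TYPE('a) * M / \<alpha>"
  have c: "0 \<le> ?c" using M0 \<alpha> by simp
  have "(\<Sum>j=l..u. \<bar>v j\<bar> * norm (?d j))
    \<le> (\<Sum>j=l..u. V * (?c / s) * (min (a (j + 1)) s - min (a j) s))"
  proof (intro sum_mono)
    fix j
    have p: "0 < min (a j) s" "min (a j) s \<le> min (a (j + 1)) s"
      using a(1)[of j] monoD[OF a(2), of j "j + 1"] s by auto
    have "norm (?d j) \<le> ?c * (min (a (j + 1)) s - min (a j) s) / s"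
      using norm_fheat_diff_le_off_diagonal[OF \<alpha> p g M, where \<rho> = r and x = x] r g0 by (simp add: s_def)
    then have "\<bar>v j\<bar> * norm (?d j) \<le> V * (?c * (min (a (j + 1)) s - min (a j) s) / s)"
      using v V0 by (intro mult_mono) auto
    then show "\<bar>v j\<bar> * norm (?d j) \<le> V * (?c / s) * (min (a (j + 1)) s - min (a j) s)"
      by simp
  qed
  also have "\<dots> = V * (?c / s) * (min (a (u + 1)) s - min (a l) s)"
    unfolding sum_distrib_left[symmetric] by (subst sum_telescope_int[OF lu, of "\<lambda>j. min (a j) s"]) simp
  also have "\<dots> \<le> V * (?c / s) * s"
    using V0 c s a(1)[of l] M0 \<alpha> by (intro mult_left_mono mult_nonneg_nonneg divide_nonneg_pos) auto
  finally show ?thesis using s by (simp add: s_def)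
qed

section \<open>The logarithmic bound\<close>

text \<open>An exhaustion by finite sets of index pairs: for each of them the estimate concerns a
  finite maximum, and monotone convergence passes to the supremum over all pairs.\<close>

definition windows :: "nat \<Rightarrow> (int \<times> int) set" where
  "windows J = {N. - int J \<le> fst N \<and> fst N < snd N \<and> snd N \<le> int J}"

lemma finite_windows: "finite (windows J)"
  by (rule finite_subset[of _ "{- int J..int J} \<times> {- int J..int J}"]) (auto simp: windows_def)

lemma incseq_windows: "J \<le> J' \<Longrightarrow> windows J \<subseteq> windows J'"
  by (auto simp: windows_def)

lemma UN_windows: "(\<Union>J. windows J) = {N. fst N < snd N}"
proof (intro equalityI subsetI)
  fix N :: "int \<times> int" assume "N \<in> {N. fst N < snd N}"
  then have "N \<in> windows (nat (max \<bar>fst N\<bar> \<bar>snd N\<bar>))" by (auto simp: windows_def)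
  then show "N \<in> (\<Union>J. windows J)" by blast
qed (auto simp: windows_def)

text \<open>The constant of \<open>nn_integral_max_tail_le\<close> for B =
  \<open>2 ^ DIM('a)\<close>, the ratio of the measures of the doubled ball and the ball.\<close>

definition local_const :: "'a::euclidean_space itself \<Rightarrow> real \<Rightarrow> real" where
  "local_const _ \<alpha> = (19 + 2 / \<alpha>) * 2 ^ DIM('a) / 2 + 1 / 2 + 2 ^ DIM('a) / 2 + sqrt 2 ^ DIM('a)"

text \<open>After a shift of the indices to the natural numbers, a sum over a window is the
  difference of two tails with the same end; this explains the factor 2.\<close>

lemma nn_integral_max_windows_le:
  fixes f :: "'a::euclidean_space \<Rightarrow> complex" and v a :: "int \<Rightarrow> real"
  assumes \<alpha>: "0 < \<alpha>" "\<alpha> < 1" and f: "integrable lborel f"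
    and a: "\<And>j. 0 < a j" "mono a" and v: "\<And>j. \<bar>v j\<bar> \<le> V" and V: "0 < V" and M: "0 < M"
    and A: "A \<in> sets borel" "emeasure lborel A < \<infinity>"
    and f2: "(\<integral>\<^sup>+x. (norm (f x))\<^sup>2 \<partial>lborel) \<le> ennreal (2 ^ DIM('a) * M\<^sup>2) * emeasure lborel A"
  shows "(\<integral>\<^sup>+x\<in>A. (SUP N\<in>windows J. ennreal (norm (\<Sum>j=fst N..snd N. v j * (fheat \<alpha> (a (j + 1)) f x - fheat \<alpha> (a j) f x)))) \<partial>lborel)
    \<le> ennreal (2 * V * M * local_const TYPE('a) \<alpha>) * emeasure lborel A"
proof -
  let ?T = "\<lambda>N x. \<Sum>j=fst N..snd N. v j * (fheat \<alpha> (a (j + 1)) f x - fheat \<alpha> (a j) f x)"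
  define an where "an i = a (int i - int J)" for i :: nat
  define vn where "vn i = v (int i - int J)" for i :: nat
  define n where "n = Suc (2 * J)"
  define U where "U m x = (\<Sum>i=m..<n. vn i * (fheat \<alpha> (an (Suc i)) f x - fheat \<alpha> (an i) f x))" for m x
  have an: "0 < an i" "mono an" for i
    using a by (auto simp: an_def mono_def)
  let ?SU = "\<lambda>x. SUP m\<in>{..n}. ennreal (norm (U m x))"
  let ?ST = "\<lambda>x. SUP N\<in>windows J. ennreal (norm (?T N x))"
  have T_eq: "(?T N x) = U (nat (fst N + int J)) x - U (nat (snd N + 1 + int J)) x"
    if N: "N \<in> windows J" for N x
  proof -
    let ?m = "nat (fst N + int J)" and ?k = "nat (snd N + 1 + int J)"
    have mk: "?m \<le> ?k" "?k \<le> n" using N by (auto simp: windows_def n_def)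
    have "U ?m x = (\<Sum>i=?m..<?k. vn i * (fheat \<alpha> (an (Suc i)) f x - fheat \<alpha> (an i) f x)) + U ?k x"
      unfolding U_def using mk by (intro sum.atLeastLessThan_concat[symmetric]) auto
    moreover have "(\<Sum>i=?m..<?k. vn i * (fheat \<alpha> (an (Suc i)) f x - fheat \<alpha> (an i) f x)) = (?T N x)"
      by (rule sum.reindex_bij_witness[of _ "\<lambda>j. nat (j + int J)" "\<lambda>i. int i - int J"])
         (use N in \<open>auto simp: windows_def vn_def an_def algebra_simps\<close>)
    ultimately show ?thesis by simp
  qed
  have "(\<integral>\<^sup>+x\<in>A. ?ST x \<partial>lborel)
    \<le> (\<integral>\<^sup>+x. 2 * (?SU x * indicator A x) \<partial>lborel)"
  proof (intro nn_integral_mono)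
    fix x
    have "?ST x
      \<le> 2 * ?SU x"
    proof (intro SUP_least)
      fix N assume N: "N \<in> windows J"
      let ?m = "nat (fst N + int J)" and ?k = "nat (snd N + 1 + int J)"
      have mk: "?m \<in> {..n}" "?k \<in> {..n}" using N by (auto simp: windows_def n_def)
      have "ennreal (norm (U ?m x - U ?k x)) \<le> ennreal (norm (U ?m x)) + ennreal (norm (U ?k x))"
        by (simp add: norm_triangle_ineq4 ennreal_leI flip: ennreal_plus)
      also have "\<dots> \<le> 2 * ?SU x"
        unfolding mult_2 by (intro add_mono SUP_upper mk)
      finally show "ennreal (norm (?T N x)) \<le> 2 * ?SU x"
        unfolding T_eq[OF N] .
    qed
    then show "?ST x * indicator A x
      \<le> 2 * (?SU x * indicator A x)"
      unfolding mult.assoc[symmetric] by (rule mult_right_mono) simp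
  qed
  also have "\<dots> = 2 * (\<integral>\<^sup>+x\<in>A. ?SU x \<partial>lborel)"
  proof (rule nn_integral_cmult)
    have [measurable]: "f \<in> borel_measurable borel" using f by auto
    have "(\<lambda>x. fheat \<alpha> t f x) \<in> borel_measurable borel" for t
      unfolding fheat_def by measurable
    then have [measurable]: "U m \<in> borel_measurable borel" for m unfolding U_def by measurable
    show "(\<lambda>x. ?SU x * indicator A x) \<in> borel_measurable lborel"
      using A by measurable
  qed
  also have "\<dots> \<le> 2 * (ennreal (V * M * ((19 + 2 / \<alpha>) * 2 ^ DIM('a) / 2 + 1 / 2 + 2 ^ DIM('a) / 2 + sqrt 2 ^ DIM('a))) * emeasure lborel A)"
    unfolding U_def
    by (intro mult_left_mono nn_integral_max_tail_le[OF \<alpha> f an _ V M _ A f2]) (auto simp: vn_def v)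
  also have "\<dots> = ennreal (2 * V * M * local_const TYPE('a) \<alpha>) * emeasure lborel A"
    using V M \<alpha> by (simp add: local_const_def ennreal_mult mult.assoc)
  finally show ?thesis .
qed

lemma emeasure_ball_double:
  fixes c :: "'a::euclidean_space"
  assumes "0 < r"
  shows "emeasure lborel (ball c (2 * r)) = ennreal (2 ^ DIM('a)) * emeasure lborel (ball c r)"
  using emeasure_lebesgue_ball_conv_unit_ball[of "2 * r" c] emeasure_lebesgue_ball_conv_unit_ball[of r c] assms
  by (simp add: power_mult_distrib ennreal_mult mult.assoc)

text \<open>Since \<open>F (min t s) + F (max t s) = F t + F s\<close>, every increment splits at s
  into an early and a late one, also when s does not lie between t and t'.\<close>

lemma min_max_split:
  fixes F :: "real \<Rightarrow> complex"
  shows "F t' - F t = (F (min t' s) - F (min t s)) + (F (max t' s) - F (max t s))"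
  by (auto simp: min_def max_def)

text \<open>The three summands stem from the late times, from the early times with the part of the
  function away from the ball, and from the early times with the part near it. The first 2 is that
  of \<open>sum_mult_le_lp_norm\<close>, the last one is due to writing windows as differences of
  tails.\<close>

definition log_const :: "'a::euclidean_space itself \<Rightarrow> real \<Rightarrow> real" where
  "log_const _ \<alpha> = 2 * far_const TYPE('a) \<alpha> + 2 * heat_const TYPE('a) / \<alpha> + 2 * local_const TYPE('a) \<alpha>"

lemma far_const_nonneg:
  assumes "0 < \<alpha>"
  shows "0 \<le> far_const TYPE('a::euclidean_space) \<alpha>"
  unfolding far_const_def using assms
  by (intro add_nonneg_nonneg mult_nonneg_nonneg divide_nonneg_pos integral_nonneg_AE) auto

lemma local_const_pos:
  assumes "0 < \<alpha>"
  shows "0 < local_const TYPE('a::euclidean_space) \<alpha>"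
  unfolding local_const_def using assms by (intro add_nonneg_pos add_pos_nonneg) auto

text \<open>M and the norm of v are strictly positive because the balanced mean inequality for the
  near part divides by their product. Only the near part has to be averaged; the other two
  contributions are bounded at every point of the ball.\<close>

lemma nn_integral_max_transform_le:
  fixes g :: "'a::euclidean_space \<Rightarrow> complex" and v a :: "int \<Rightarrow> real" and c :: 'a
  assumes \<alpha>: "0 < \<alpha>" "\<alpha> < 1" and p: "1 \<le> p" and v: "in_lp p v" and a: "\<And>j. 0 < a j" "mono a"
    and g_meas[measurable]: "g \<in> borel_measurable borel" and M: "\<And>y. norm (g y) \<le> M"
    and supp: "\<And>y. y \<notin> ball 0 1 \<Longrightarrow> g y = 0" and r: "0 < r" "2 * r < 1"
    and M0: "0 < M" and N0: "0 < lp_norm p v"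
  shows "(\<integral>\<^sup>+x\<in>ball c r. (SUP N\<in>windows J. ennreal (norm (\<Sum>j=fst N..snd N. v j * (fheat \<alpha> (a (j + 1)) g x - fheat \<alpha> (a j) g x)))) \<partial>lborel)
    \<le> ennreal (log_const TYPE('a) \<alpha> * ln (2 / r) powr real_of_ereal (1 / conj_exponent p) * lp_norm p v * M) * emeasure lborel (ball c r)"
proof -
  let ?N = "lp_norm p v" and ?A = "emeasure lborel (ball c r)" and ?L = "ln (2 / r)"
  let ?X = "?L powr real_of_ereal (1 / conj_exponent p)"
  have L1: "1 \<le> ?L" by (rule one_le_ln_two_div[OF r])
  have X1: "1 \<le> ?X"
  proof (rule ge_one_powr_ge_zero[OF L1])
    have "1 \<le> real_of_ereal p" if "p \<noteq> \<infinity>" using p that by (cases p) auto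
    then show "0 \<le> real_of_ereal (1 / conj_exponent p)"
      by (auto simp: conj_exponent_eq[OF p] divide_simps)
  qed
  have vN: "\<bar>v j\<bar> \<le> ?N" for j by (rule in_lp_abs_le_lp_norm[OF p v])
  define s where "s = r powr (2 * \<alpha>)"
  have s: "0 < s" using r by (simp add: s_def)
  have int_bd: "integrable lborel h" if "h \<in> borel_measurable borel" "\<And>y. norm (h y) \<le> M" "\<And>y. y \<notin> ball 0 1 \<Longrightarrow> h y = 0" for h :: "'a \<Rightarrow> complex"
  proof (rule Bochner_Integration.integrable_bound)
    show "integrable lborel (\<lambda>y::'a. M * indicator (ball 0 1) y)"
      using emeasure_lborel_ball_finite[of "0::'a" 1] by (intro integrable_mult_right) simp
    show "AE y in lborel. norm (h y) \<le> norm (M * indicator (ball 0 1) y)"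
      using that(2,3) M0 by (intro AE_I2) (auto simp: indicator_def)
  qed (use that in simp)
  have g: "integrable lborel g" by (rule int_bd) (use M supp in auto)
  \<comment> \<open>Doubling the radius leaves a distance of at least r between the points of the
    ball and the support of \<open>g2\<close>, as the off-diagonal bound requires.\<close>
  define g1 where "g1 y = (if norm (y - c) < 2 * r then g y else 0)" for y
  define g2 where "g2 y = (if norm (y - c) < 2 * r then 0 else g y)" for y
  have [measurable]: "g1 \<in> borel_measurable borel" "g2 \<in> borel_measurable borel"
    unfolding g1_def g2_def by measurable
  have g1: "integrable lborel g1" "\<And>y. norm (g1 y) \<le> M"
    using M M0 supp by (auto intro!: int_bd simp: g1_def)
  have g2: "integrable lborel g2" "\<And>y. norm (g2 y) \<le> M"
    using M M0 supp by (auto intro!: int_bd simp: g2_def)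
  have g12: "g = (\<lambda>y. g1 y + g2 y)" by (auto simp: g1_def g2_def)
  have [measurable]: "ball c r \<in> sets borel" by simp
  define T where "T h b N x = (\<Sum>j=fst N..snd N. v j * (fheat \<alpha> (b (j + 1)) h x - fheat \<alpha> (b j) h x))"
    for h :: "'a \<Rightarrow> complex" and b :: "int \<Rightarrow> real" and N :: "int \<times> int" and x
  define a1 where "a1 j = min (a j) s" for j
  define a2 where "a2 j = max (a j) s" for j
  have a1: "0 < a1 j" "mono a1" for j
    using a s by (auto simp: a1_def mono_def min_le_iff_disj)
  let ?S = "\<lambda>h b x. SUP N\<in>windows J. ennreal (norm (T h b N x))"
  have T_split: "T g a N x = T g1 a1 N x + T g2 a1 N x + T g a2 N x" for N x
  proof -
    have "T g a N x = T g a1 N x + T g a2 N x"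
      unfolding T_def a1_def a2_def sum.distrib[symmetric] distrib_left[symmetric]
      by (subst min_max_split[where F = "\<lambda>t. fheat \<alpha> t g x" and s = s]) simp
    also have "T g a1 N x = T g1 a1 N x + T g2 a1 N x"
      unfolding T_def sum.distrib[symmetric] g12
      by (intro sum.cong refl) (simp add: fheat_add[OF \<alpha>(1) a1(1) g1(1) g2(1)] algebra_simps)
    finally show ?thesis .
  qed
  let ?K = "2 * (M * far_const TYPE('a) \<alpha>) * ?N * ?X + ?N * (2 * heat_const TYPE('a) * M / \<alpha>)"
  have norm_T: "norm (T h b N x) \<le> (\<Sum>j=fst N..snd N. \<bar>v j\<bar> * norm (fheat \<alpha> (b (j + 1)) h x - fheat \<alpha> (b j) h x))" for h b N x
    unfolding T_def by (rule order_trans[OF norm_sum]) (simp add: norm_mult)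
  have far: "norm (T g a2 N x) \<le> 2 * (M * far_const TYPE('a) \<alpha>) * ?N * ?X" if N: "N \<in> windows J" for N x
  proof (rule order_trans[OF norm_T sum_mult_le_lp_norm[OF p v _ _ _ _ L1]])
    have N': "fst N \<le> snd N + 1" using N by (simp add: windows_def)
    show "norm (fheat \<alpha> (a2 (j + 1)) g x - fheat \<alpha> (a2 j) g x) \<le> M * far_const TYPE('a) \<alpha>" for j
      unfolding a2_def s_def by (rule far_le[OF \<alpha> g M supp a r])
    show "(\<Sum>j=fst N..snd N. norm (fheat \<alpha> (a2 (j + 1)) g x - fheat \<alpha> (a2 j) g x)) \<le> M * far_const TYPE('a) \<alpha> * ?L"
      unfolding a2_def s_def by (rule sum_far_le[OF \<alpha> g M supp a r N'])
  qed auto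
  have near: "norm (T g2 a1 N x) \<le> ?N * (2 * heat_const TYPE('a) * M / \<alpha>)" if N: "N \<in> windows J" and x: "x \<in> ball c r" for N x
  proof (rule order_trans[OF norm_T])
    have N': "fst N \<le> snd N + 1" using N by (simp add: windows_def)
    have "g2 y = 0" if "norm (y - x) < r" for y
    proof -
      have "norm (y - c) \<le> norm (y - x) + norm (x - c)" using norm_triangle_ineq[of "y - x" "x - c"] by simp
      also have "norm (x - c) < r" using x by (simp add: dist_norm norm_minus_commute)
      finally have "norm (y - c) < 2 * r" using that by simp
      then show ?thesis by (simp add: g2_def)
    qed
    then show "(\<Sum>j=fst N..snd N. \<bar>v j\<bar> * norm (fheat \<alpha> (a1 (j + 1)) g2 x - fheat \<alpha> (a1 j) g2 x)) \<le> ?N * (2 * heat_const TYPE('a) * M / \<alpha>)"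
      unfolding a1_def s_def by (intro sum_near_off_diagonal_le[OF \<alpha> g2 _ a r(1) vN N'])
  qed
  have K0: "0 \<le> ?K"
  proof -
    have "0 \<le> far_const TYPE('a) \<alpha>" by (rule far_const_nonneg[OF \<alpha>(1)])
    then show ?thesis using N0 M0 X1 \<alpha> by (intro add_nonneg_nonneg mult_nonneg_nonneg divide_nonneg_pos) auto
  qed
  have f2: "(\<integral>\<^sup>+x. (norm (g1 x))\<^sup>2 \<partial>lborel) \<le> ennreal (2 ^ DIM('a) * M\<^sup>2) * ?A"
  proof -
    have "(\<integral>\<^sup>+x. (norm (g1 x))\<^sup>2 \<partial>lborel) \<le> (\<integral>\<^sup>+x. ennreal (M\<^sup>2) * indicator (ball c (2 * r)) x \<partial>lborel)"
      using M M0 by (intro nn_integral_mono)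
        (auto simp: g1_def indicator_def dist_norm norm_minus_commute intro!: ennreal_leI power_mono)
    also have "\<dots> = ennreal (M\<^sup>2) * emeasure lborel (ball c (2 * r))"
      by (rule nn_integral_cmult_indicator) simp
    also have "\<dots> = ennreal (2 ^ DIM('a) * M\<^sup>2) * ?A"
      unfolding emeasure_ball_double[OF r(1)] by (simp add: ennreal_mult ac_simps)
    finally show ?thesis .
  qed
  have fin: "?A < \<infinity>" using emeasure_lborel_ball_finite[of c r] by simp
  have [measurable]: "T h b N \<in> borel_measurable borel" if [measurable]: "h \<in> borel_measurable borel" for h b N
  proof -
    have [measurable]: "fheat \<alpha> t h \<in> borel_measurable borel" for t unfolding fheat_def by measurable
    show ?thesis unfolding T_def by measurable
  qed
  have "(\<integral>\<^sup>+x\<in>ball c r. ?S g a x \<partial>lborel)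
    \<le> (\<integral>\<^sup>+x. ennreal ?K * indicator (ball c r) x + ?S g1 a1 x * indicator (ball c r) x \<partial>lborel)"
  proof (intro nn_integral_mono)
    fix x
    show "?S g a x * indicator (ball c r) x \<le>
      ennreal ?K * indicator (ball c r) x + ?S g1 a1 x * indicator (ball c r) x"
    proof (cases "x \<in> ball c r")
      case True
      have "?S g a x \<le> ennreal ?K + ?S g1 a1 x"
      proof (intro SUP_least)
        fix N assume N: "N \<in> windows J"
        have "norm (T g a N x) \<le> norm (T g1 a1 N x) + norm (T g2 a1 N x) + norm (T g a2 N x)"
          unfolding T_split by (intro norm_triangle_le add_mono norm_triangle_ineq order_refl)
        then have "norm (T g a N x) \<le> ?K + norm (T g1 a1 N x)"
          using far[OF N, of x] near[OF N True] by linarith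
        then have "ennreal (norm (T g a N x)) \<le> ennreal (?K + norm (T g1 a1 N x))"
          by (rule ennreal_leI)
        also have "\<dots> = ennreal ?K + ennreal (norm (T g1 a1 N x))"
          by (rule ennreal_plus[OF K0 norm_ge_zero])
        also have "\<dots> \<le> ennreal ?K + ?S g1 a1 x"
          by (intro add_left_mono SUP_upper N)
        finally show "ennreal (norm (T g a N x)) \<le> \<dots>" .
      qed
      then show ?thesis by (rule mult_indicator_le_add)
    qed simp
  qed
  also have "\<dots> = ennreal ?K * ?A + (\<integral>\<^sup>+x\<in>ball c r. ?S g1 a1 x \<partial>lborel)"
  proof (subst nn_integral_add)
    show "(\<lambda>x. ?S g1 a1 x * indicator (ball c r) x) \<in> borel_measurable lborel"
      using countable_finite[OF finite_windows[of J]] by measurable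
  qed (simp_all add: nn_integral_cmult_indicator)
  also have "\<dots> \<le> ennreal ?K * ?A + ennreal (2 * ?N * M * local_const TYPE('a) \<alpha>) * ?A"
    unfolding T_def
    by (intro add_left_mono nn_integral_max_windows_le[OF \<alpha> g1(1) a1 vN N0 M0 _ fin f2]) simp
  also have "\<dots> = ennreal (?K + 2 * ?N * M * local_const TYPE('a) \<alpha>) * ?A"
    using K0 N0 M0 \<alpha> by (subst ennreal_plus) (auto simp: distrib_right local_const_def)
  also have "\<dots> \<le> ennreal (log_const TYPE('a) \<alpha> * ?X * ?N * M) * ?A"
  proof (intro mult_right_mono ennreal_leI)
    have b: "0 \<le> 2 * heat_const TYPE('a) / \<alpha> + 2 * local_const TYPE('a) \<alpha>"
      using \<alpha> by (simp add: local_const_def)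
    \<comment> \<open>The contributions of the early times carry no logarithm; they are absorbed
      because its power is at least 1.\<close>
    have "?K + 2 * ?N * M * local_const TYPE('a) \<alpha> = ?N * M * (2 * far_const TYPE('a) \<alpha> * ?X + (2 * heat_const TYPE('a) / \<alpha> + 2 * local_const TYPE('a) \<alpha>) * 1)"
      by (simp add: algebra_simps)
    also have "\<dots> \<le> ?N * M * (2 * far_const TYPE('a) \<alpha> * ?X + (2 * heat_const TYPE('a) / \<alpha> + 2 * local_const TYPE('a) \<alpha>) * ?X)"
      using N0 M0 b X1 by (intro mult_left_mono add_left_mono) auto
    also have "\<dots> = log_const TYPE('a) \<alpha> * ?X * ?N * M"
      by (simp add: log_const_def algebra_simps)
    finally show "?K + 2 * ?N * M * local_const TYPE('a) \<alpha> \<le> \<dots>" .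
  qed simp
  finally show ?thesis unfolding T_def .
qed

theorem theorem1p3:
  fixes \<alpha> :: real and p :: ereal
  assumes "0 < \<alpha>" and "\<alpha> < 1" and "1 \<le> p"
  shows "\<exists>C>0. \<forall>(v :: int \<Rightarrow> real) (a :: int \<Rightarrow> real).
    in_lp p v \<longrightarrow> (\<forall>j. 0 < a j) \<longrightarrow> mono a \<longrightarrow>
    (\<forall>f :: real ^ 'n \<Rightarrow> complex.
      in_linfty f \<longrightarrow> (AE x in lebesgue. x \<notin> ball 0 1 \<longrightarrow> f x = 0) \<longrightarrow>
      (\<forall>(c :: real ^ 'n) (r :: real).
        0 < r \<longrightarrow> 2 * r < 1 \<longrightarrow> ball c r \<subseteq> ball 0 1 \<longrightarrow>
        (\<integral>\<^sup>+ x\<in>ball c r. max_diff_transform \<alpha> v a f x \<partial>lebesgue) / emeasure lebesgue (ball c r)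
          \<le> ennreal (C * ln (2 / r) powr real_of_ereal (1 / conj_exponent p)
                       * lp_norm p v * linfty_norm f)))"
proof (intro exI[of _ "log_const TYPE(real ^ 'n) \<alpha>"] conjI allI impI)
  show "0 < log_const TYPE(real ^ 'n) \<alpha>"
    unfolding log_const_def using assms far_const_nonneg[where 'a = "real ^ 'n", of \<alpha>] local_const_pos[where 'a = "real ^ 'n", of \<alpha>]
    by (intro add_nonneg_pos) auto
next
  fix v a :: "int \<Rightarrow> real" and f :: "real ^ 'n \<Rightarrow> complex" and c :: "real ^ 'n" and r :: real
  assume v: "in_lp p v" and a: "\<forall>j. 0 < a j" "mono a" and f: "in_linfty f"
    and supp: "AE x in lebesgue. x \<notin> ball 0 1 \<longrightarrow> f x = 0" and r: "0 < r" "2 * r < 1"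
  obtain g where g: "g \<in> borel_measurable borel" "\<And>x. norm (g x) \<le> linfty_norm f" "\<And>x. x \<notin> ball 0 1 \<Longrightarrow> g x = 0"
    and ae: "AE x in lebesgue. f x = g x" and M0: "0 \<le> linfty_norm f"
    using ex_borel_representative[OF f supp] by blast
  have f_meas: "f \<in> borel_measurable lebesgue" using f by (simp add: in_linfty_def)
  have [measurable]: "g \<in> borel_measurable borel" by (rule g)
  have [measurable]: "ball c r \<in> sets borel" by simp
  define T where "T N x = (\<Sum>j=fst N..snd N. v j * (fheat \<alpha> (a (j + 1)) g x - fheat \<alpha> (a j) g x))" for N :: "int \<times> int" and x
  let ?S = "\<lambda>J x. SUP N\<in>windows J. ennreal (norm (T N x))"
  have T: "diff_transform \<alpha> v a N f x = T N x" for N x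
    unfolding diff_transform_def T_def frac_heat_eq_fheat[OF f_meas g(1) ae] ..
  have T_meas[measurable]: "T N \<in> borel_measurable borel" for N
  proof -
    have [measurable]: "fheat \<alpha> t g \<in> borel_measurable borel" for t unfolding fheat_def by measurable
    show ?thesis unfolding T_def by measurable
  qed
  let ?A = "emeasure lborel (ball c r)"
  let ?C = "log_const TYPE(real ^ 'n) \<alpha> * ln (2 / r) powr real_of_ereal (1 / conj_exponent p) * lp_norm p v * linfty_norm f"
  have vN: "\<bar>v j\<bar> \<le> lp_norm p v" for j by (rule in_lp_abs_le_lp_norm[OF assms(3) v])
  have N0: "0 \<le> lp_norm p v" using vN[of 0] by linarith
  have window: "(\<integral>\<^sup>+x\<in>ball c r. ?S J x \<partial>lborel) \<le> ennreal ?C * ?A" for J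
  \<comment> \<open>In the degenerate case either all coefficients or the function vanish, so the
    transform is 0 everywhere; the general estimate takes both norms to be positive.\<close>
  proof (cases "lp_norm p v = 0 \<or> linfty_norm f = 0")
    case True
    have "T N x = 0" for N x
    proof -
      have "v j = 0 \<or> g = (\<lambda>y. 0)" for j using True vN[of j] g(2) by (auto simp: fun_eq_iff)
      moreover have "fheat \<alpha> t (\<lambda>y. 0) x = 0" for t by (simp add: fheat_def ft_def ift_def)
      ultimately show ?thesis unfolding T_def by (cases "g = (\<lambda>y. 0)") simp_all
    qed
    then have "(\<lambda>x. ?S J x * indicator (ball c r) x) = (\<lambda>x. 0)"
      by (cases "windows J = {}") (auto simp: fun_eq_iff bot_ennreal)
    then show ?thesis by simp
  next
    case False
    then show ?thesis
      unfolding T_def using a N0 M0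
      by (intro nn_integral_max_transform_le assms v g r) auto
  qed
  \<comment> \<open>Nonnegative integrals over \<open>lebesgue\<close> agree with those over
    \<open>lborel\<close>, its measure before completion, and the supremum over all index pairs
    becomes an increasing supremum over the finite sets \<open>windows J\<close>.\<close>
  have "(\<integral>\<^sup>+x\<in>ball c r. max_diff_transform \<alpha> v a f x \<partial>lebesgue)
    = (\<integral>\<^sup>+x. (SUP J. ?S J x * indicator (ball c r) x) \<partial>lborel)"
    unfolding nn_integral_completion max_diff_transform_def T UN_windows[symmetric]
    by (simp add: SUP_UNION SUP_mult_right_ennreal)
  also have "\<dots> = (SUP J. \<integral>\<^sup>+x\<in>ball c r. ?S J x \<partial>lborel)"
  proof (rule nn_integral_monotone_convergence_SUP)
    show "incseq (\<lambda>J x. ?S J x * indicator (ball c r) x)"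
      by (auto simp: incseq_def le_fun_def intro!: mult_right_mono SUP_subset_mono incseq_windows)
    show "(\<lambda>x. ?S J x * indicator (ball c r) x) \<in> borel_measurable lborel" for J
      using countable_finite[OF finite_windows[of J]] by measurable
  qed
  also have "\<dots> \<le> ennreal ?C * ?A" by (intro SUP_least window)
  finally have "(\<integral>\<^sup>+x\<in>ball c r. max_diff_transform \<alpha> v a f x \<partial>lebesgue) / emeasure lebesgue (ball c r) \<le> ennreal ?C * ?A / ?A"
    by (simp add: divide_right_mono_ennreal)
  also have "\<dots> = ennreal ?C"
  proof (rule mult_divide_eq_ennreal)
    show "?A \<noteq> 0" using content_ball_pos[OF r(1), of c] by (auto simp: measure_def)
    show "?A \<noteq> top" using emeasure_lborel_ball_finite[of c r] by simp
  qed
  finally show "(\<integral>\<^sup>+x\<in>ball c r. max_diff_transform \<alpha> v a f x \<partial>lebesgue) / emeasure lebesgue (ball c r) \<le> ennreal ?C" .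
qed

end
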